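(* Let $d\ge1$, let $I_1,\dots,I_d\subset\mathbb R$ be open intervals (bounded or unbounded), $\mathbf I=I_1\times\dots\times I_d$, and let $f\colon\mathbf I\to\mathbb R$ be a function. Let $\boldsymbol\alpha=(\alpha_1,\dots,\alpha_d)\in\mathbf I$ and let $\mathbf n=(n_1,\dots,n_d)\in\mathbb N^d$ be such that $n_i\ge2$ for $i=1,\dots,d$. Then $f$ is box-$\mathbf n$-convex if and only if it is of the form $$f(x_1,\dots,x_d)=W(x_1,\dots,x_d)+\int_{\mathbf I}\prod_{j=1}^d\frac{(x_j-u_j)^{n_j-1}}{(n_j-1)!}\chi_{\alpha_j,x_j}^{r}(u_j)\,d\mu(u_1,\dots,u_d)$$ for all $(x_1,\dots,x_d)\in\mathbf I$, where $W\colon\mathbf I\to\mathbb R$ is a pseudo-polynomial of degree $(n_1-1,\dots,n_d-1)$ and $\mu$ is a Borel measure on $\mathbf I$ which is finite on compact sets.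
   Context: $\mathbb N=\{0,1,2,\dots\}$; Borel measures are nonnegative. Divided differences: for a real function $g$ of one variable and pairwise distinct points, $[x_0;g]=g(x_0)$ and $[x_0,\dots,x_n;g]=\dfrac{[x_1,\dots,x_n;g]-[x_0,\dots,x_{n-1};g]}{x_n-x_0}$ for $n\ge1$. Multiple divided differences: for $f\colon\mathbf I\to\mathbb R$, $\mathbf n\in\mathbb N^d$, and vectors $\mathbf x_i=(x_{i0},\dots,x_{in_i})\in I_i^{n_i+1}$ with pairwise distinct coordinates ($i=1,\dots,d$), $[\mathbf x_1;\dots;\mathbf x_d;f]$ is defined by induction on $d$: for $d=1$ it is $[x_{10},\dots,x_{1n_1};f]$; for $d>1$ it is $[x_{d0},\dots,x_{dn_d};g]$, where $g(x)=[\mathbf x_1;\dots;\mathbf x_{d-1};f(\cdot,\dots,\cdot,x)]$ for $x\in I_d$. $f$ is box-$\mathbf n$-convex if $[\mathbf x_1;\dots;\mathbf x_d;f]\ge0$ for all such $\mathbf x_1,\dots,\mathbf x_d$. A pseudo-polynomial of degree $(m_1,\dots,m_d)$ is a function $W(x_1,\dots,x_d)=\sum_{i=1}^d\sum_{k=0}^{m_i}A_{ik}(x_1,\dots,x_{i-1},x_{i+1},\dots,x_d)\,x_i^k$, where $A_{ik}\colon\prod_{j\ne i}I_j\to\mathbb R$ are arbitrary functions (constants if $d=1$). For $x,y\in\mathbb R$: $\chi_{x,y}^r=\mathbf 1_{(-\infty,y]}-\mathbf 1_{(-\infty,x]}$. *)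

theory Defs
  imports "HOL-Analysis.Analysis"
begin

text \<open>
  Points of \<open>I\<^sub>1 \<times> \<dots> \<times> I\<^sub>d\<close> are represented as functions of type \<open>nat \<Rightarrow> real\<close> in
  \<open>Pi\<^sub>E {..<d} I\<close>, that is, coordinates are indexed by \<open>0, \<dots>, d - 1\<close> and a point takes the
  fixed value \<open>undefined\<close> at all other indices.
\<close>

abbreviation box_of :: "nat \<Rightarrow> (nat \<Rightarrow> real set) \<Rightarrow> (nat \<Rightarrow> real) set" where
  "box_of d I \<equiv> Pi\<^sub>E {..<d} I"

text \<open>
  \<open>divided_difference n x g\<close> is the divided difference \<open>[x 0, \<dots>, x n; g]\<close>; only the values of
  \<open>x\<close> on \<open>{..n}\<close> matter.
\<close>

primrec divided_difference :: "nat \<Rightarrow> (nat \<Rightarrow> real) \<Rightarrow> (real \<Rightarrow> real) \<Rightarrow> real" where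
  "divided_difference 0 x g = g (x 0)"
| "divided_difference (Suc n) x g =
     (divided_difference n (\<lambda>j. x (Suc j)) g - divided_difference n x g) / (x (Suc n) - x 0)"

text \<open>
  \<open>X i j\<close> is the \<open>j\<close>-th node (\<open>j \<le> n i\<close>) in direction \<open>i\<close>. In the successor case,
  \<open>\<lambda>y. f (y(d := x))\<close> is \<open>f\<close> with its last argument fixed to \<open>x\<close>. The recursion is anchored at
  the (unique) empty tuple, so that dimension one gives the ordinary divided difference; see the
  lemma below.
\<close>

primrec multiple_divided_difference ::
    "nat \<Rightarrow> (nat \<Rightarrow> nat) \<Rightarrow> (nat \<Rightarrow> nat \<Rightarrow> real) \<Rightarrow> ((nat \<Rightarrow> real) \<Rightarrow> real) \<Rightarrow> real" where
  "multiple_divided_difference 0 n X f = f (\<lambda>_. undefined)"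
| "multiple_divided_difference (Suc d) n X f =
     divided_difference (n d) (X d)
       (\<lambda>x. multiple_divided_difference d n X (\<lambda>y. f (y(d := x))))"

lemma multiple_divided_difference_one:
  "multiple_divided_difference (Suc 0) n X f =
     divided_difference (n 0) (X 0) (\<lambda>x. f (\<lambda>i\<in>{..<Suc 0}. x))"
proof -
  have "(\<lambda>_. undefined)(0 := x) = (\<lambda>i\<in>{..<Suc 0}. x)" for x :: real
    by (auto simp: fun_eq_iff)
  then show ?thesis by simp
qed

definition box_convex ::
    "nat \<Rightarrow> (nat \<Rightarrow> real set) \<Rightarrow> (nat \<Rightarrow> nat) \<Rightarrow> ((nat \<Rightarrow> real) \<Rightarrow> real) \<Rightarrow> bool" where
  "box_convex d I n f \<longleftrightarrow>
     (\<forall>X. (\<forall>i<d. (\<forall>j\<le>n i. X i j \<in> I i) \<and> inj_on (X i) {..n i}) \<longrightarrow>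
        multiple_divided_difference d n X f \<ge> 0)"

text \<open>
  The coefficient \<open>A i k\<close> is applied to the tuple of all coordinates of \<open>x\<close> except the \<open>i\<close>-th.
\<close>

definition pseudo_polynomial ::
    "nat \<Rightarrow> (nat \<Rightarrow> real set) \<Rightarrow> (nat \<Rightarrow> nat) \<Rightarrow> ((nat \<Rightarrow> real) \<Rightarrow> real) \<Rightarrow> bool" where
  "pseudo_polynomial d I m W \<longleftrightarrow>
     (\<exists>A :: nat \<Rightarrow> nat \<Rightarrow> (nat \<Rightarrow> real) \<Rightarrow> real. \<forall>x\<in>box_of d I.
        W x = (\<Sum>i<d. \<Sum>k\<le>m i. A i k (restrict x ({..<d} - {i})) * x i ^ k))"

definition chi_r :: "real \<Rightarrow> real \<Rightarrow> real \<Rightarrow> real" where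
  "chi_r x y u = indicator {..y} u - indicator {..x} u"

text \<open>
  Here \<open>borel\<close> and \<open>compact\<close> refer to the product topology on \<open>nat \<Rightarrow> real\<close>. Since points of the
  box are constant outside \<open>{..<d}\<close>, the topology induced on the box is the Euclidean one.
\<close>

definition locally_finite_borel_measure_on :: "(nat \<Rightarrow> real) set \<Rightarrow> (nat \<Rightarrow> real) measure \<Rightarrow> bool" where
  "locally_finite_borel_measure_on B \<mu> \<longleftrightarrow>
     sets \<mu> = sets (restrict_space borel B) \<and>
     (\<forall>K. compact K \<and> K \<subseteq> B \<longrightarrow> emeasure \<mu> K < \<infinity>)"

end

theory Submission
  imports Defs "HOL-Probability.Helly_Selection" "HOL-Probability.Probability_Mass_Function"
begin

text \<open>
  A divided difference in one direction annihilates polynomials of degree below \<open>n\<close> and turns the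
  kernel into a B-spline, which is nonnegative; applying divided differences in all directions to the
  representation therefore gives box-convexity.

  Conversely, on the grid with mesh \<open>1 / k!\<close> a discrete Taylor formula writes every multiple divided
  difference with grid nodes as a sum of discrete B-splines against nonnegative masses, the scaled
  multiple differences of \<open>f\<close> on consecutive grid points. Masses in a compact box telescope to
  differences of lower order, which are bounded because divided differences of order \<open>n - 1\<close> are monotone
  in the nodes. A vague limit \<open>\<mu>\<close> of the masses (Helly's theorem on the line, transported by a
  space-filling curve) represents all multiple divided differences of \<open>f\<close> with rational nodes.
  Hence \<open>f\<close> and the potential \<open>G\<close> of \<open>\<mu>\<close> have the same multiple divided differences at rational nodes.
  Both are box-convex, so their partial divided differences are continuous in the remaining variable as
  \<open>n\<^sub>i \<ge> 2\<close>, and the equality extends to all nodes \<open>T\<^sub>i \<union> {x\<^sub>i}\<close>. This says that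
  \<open>(Id - P\<^sub>1) \<dots> (Id - P\<^sub>d)\<close> annihilates \<open>f - G\<close>, where \<open>P\<^sub>i\<close> is interpolation at \<open>T\<^sub>i\<close>, so that
  \<open>f - G\<close> is a pseudo-polynomial.
\<close>

section \<open>Divided differences\<close>

text \<open>For d \<ge> 2 the coefficient functions of a pseudo-polynomial are arbitrary, so a
  box-convex \<open>f\<close> may be discontinuous, non-measurable and unbounded on compact sets.
  Only differences of full order in every direction are controlled. The proof therefore never
  approximates values of \<open>f\<close>; it manipulates linear functionals and compares them in
  the cone generated by full-order divided differences. For the same reason the mesh is 1 / k!: each
  rational number lies on all but finitely many of these grids, so rational nodes give exact
  identities. The masses are bounded only on compact boxes and may accumulate at the boundary. Hence
  the limit is vague rather than weak, and the box is exhausted by compact boxes. The bound n i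
  \<ge> 2 makes the B-splines continuous, as test functions for vague convergence must be. The base
  point \<alpha> settles integrability: a truncated power need not be integrable over the whole box,
  whereas the kernel based at \<alpha> has compact support in u and differs from it only by a
  polynomial of degree n i - 1 in x i.\<close>

definition dd_weight :: "real set \<Rightarrow> real \<Rightarrow> real" where
  "dd_weight A s = (if s \<in> A then 1 / (\<Prod>t\<in>A - {s}. s - t) else 0)"

text \<open>Lagrange's form makes symmetry in the nodes automatic. Since weights vanish off their
  node set, weights of different sets are functions on the whole line that can be added and
  compared.\<close>

definition dd :: "real set \<Rightarrow> (real \<Rightarrow> real) \<Rightarrow> real" where
  "dd A g = (\<Sum>s\<in>A. dd_weight A s * g s)"

lemma dd_weight_insert:
  assumes "finite A" "a \<notin> A" "s \<in> A"
  shows "dd_weight (insert a A) s = dd_weight A s / (s - a)"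
proof -
  have "insert a A - {s} = insert a (A - {s})" using assms by auto
  then show ?thesis using assms by (simp add: dd_weight_def)
qed

lemma dd_weight_insert_same:
  assumes "a \<notin> A"
  shows "dd_weight (insert a A) a = 1 / (\<Prod>t\<in>A. a - t)"
  using assms by (simp add: dd_weight_def)

lemma dd_insert:
  assumes "finite A" "a \<notin> A"
  shows "dd (insert a A) g = g a / (\<Prod>t\<in>A. a - t) + (\<Sum>s\<in>A. dd_weight A s * g s / (s - a))"
proof -
  have "(\<Sum>s\<in>A. dd_weight (insert a A) s * g s) = (\<Sum>s\<in>A. dd_weight A s * g s / (s - a))"
    by (intro sum.cong) (auto simp: dd_weight_insert assms)
  then show ?thesis
    using assms by (simp add: dd_def dd_weight_insert_same)
qed

lemma dd_singleton [simp]: "dd {a} g = g a"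
  by (simp add: dd_def dd_weight_def)

text \<open>Any two nodes may be dropped here, not just the first and the last as in
  \<open>divided_difference\<close>.\<close>

lemma dd_recurrence:
  assumes "finite A" "a \<notin> A" "b \<notin> A" "a \<noteq> b"
  shows "dd (insert a A) g - dd (insert b A) g = (a - b) * dd (insert a (insert b A)) g"
proof -
  have eq: "x / (s - a) - x / (s - b) = (a - b) * (x / (s - b) / (s - a))"
    if "s \<in> A" for s x :: real
  proof -
    have "s - a \<noteq> 0" "s - b \<noteq> 0" using that assms by auto
    then show ?thesis by (simp add: divide_simps) (simp add: algebra_simps)
  qed
  define P where "P = g a / (\<Prod>t\<in>A. a - t)"
  define Q where "Q = g b / (\<Prod>t\<in>A. b - t)"
  have "dd (insert a (insert b A)) g =
      P / (a - b) + (Q / (b - a) + (\<Sum>s\<in>A. dd_weight A s * g s / (s - b) / (s - a)))"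
    using assms by (simp add: dd_insert dd_weight_insert_same dd_weight_insert P_def Q_def)
  also have "(a - b) * \<dots> = P - Q + (a - b) * (\<Sum>s\<in>A. dd_weight A s * g s / (s - b) / (s - a))"
  proof -
    have "(a - b) * (P / (a - b)) = P" "(a - b) * (Q / (b - a)) = - Q"
      using assms(4) minus_divide_right[of "(a - b) * Q" "a - b"] by simp_all
    then show ?thesis by (simp only: distrib_left)
  qed
  also have "(a - b) * (\<Sum>s\<in>A. dd_weight A s * g s / (s - b) / (s - a)) =
      (\<Sum>s\<in>A. (a - b) * (dd_weight A s * g s / (s - b) / (s - a)))"
    by (rule sum_distrib_left)
  also have "(\<Sum>s\<in>A. (a - b) * (dd_weight A s * g s / (s - b) / (s - a))) =
      (\<Sum>s\<in>A. dd_weight A s * g s / (s - a)) - (\<Sum>s\<in>A. dd_weight A s * g s / (s - b))"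
    unfolding sum_subtractf[symmetric] by (intro sum.cong refl eq[symmetric])
  finally show ?thesis
    using assms by (simp add: dd_insert P_def Q_def)
qed

lemma divided_difference_eq_dd:
  assumes "inj_on x {..n}"
  shows "divided_difference n x g = dd (x ` {..n}) g"
  using assms
proof (induction n arbitrary: x)
  case 0
  then show ?case by simp
next
  case (Suc n)
  let ?C = "x ` {1..n}"
  have inj: "inj_on (\<lambda>j. x (Suc j)) {..n}" "inj_on x {..n}"
    using Suc.prems by (auto simp: inj_on_def)
  have notin: "x 0 \<notin> ?C" "x (Suc n) \<notin> ?C" "x (Suc n) \<noteq> x 0"
    using inj_onD[OF Suc.prems, of 0] inj_onD[OF Suc.prems, of "Suc n"] by force+
  have ivl: "Suc ` {..n} = insert (Suc n) {1..n}" "{..n} = insert 0 {1..n}"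
    "{..Suc n} = insert (Suc n) (insert 0 {1..n})"
    by (auto simp: image_Suc_atMost)
  have sets: "(\<lambda>j. x (Suc j)) ` {..n} = insert (x (Suc n)) ?C"
    "x ` {..n} = insert (x 0) ?C"
    "x ` {..Suc n} = insert (x (Suc n)) (insert (x 0) ?C)"
    using arg_cong[OF ivl(1), of "\<lambda>S. x ` S"] arg_cong[OF ivl(2), of "\<lambda>S. x ` S"]
      arg_cong[OF ivl(3), of "\<lambda>S. x ` S"] unfolding image_image image_insert by blast+
  have "dd (insert (x (Suc n)) ?C) g - dd (insert (x 0) ?C) g =
      (x (Suc n) - x 0) * dd (x ` {..Suc n}) g"
    unfolding sets(3) by (intro dd_recurrence) (use notin in auto)
  then show ?case
    using notin unfolding divided_difference.simps Suc.IH[OF inj(1)] Suc.IH[OF inj(2)] sets(1,2)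
    by simp
qed

lemma dd_add: "dd A (\<lambda>x. g x + h x) = dd A g + dd A h"
  by (simp add: dd_def sum.distrib algebra_simps)

lemma dd_cmult: "dd A (\<lambda>x. c * g x) = c * dd A g"
  by (simp add: dd_def sum_distrib_left algebra_simps)

lemma dd_diff: "dd A (\<lambda>x. g x - h x) = dd A g - dd A h"
  by (simp add: dd_def sum_subtractf algebra_simps)

lemma dd_sum: "dd A (\<lambda>x. \<Sum>k\<in>K. g k x) = (\<Sum>k\<in>K. dd A (g k))"
  unfolding dd_def by (simp add: sum_distrib_left) (rule sum.swap)

lemma dd_cong: "(\<And>s. s \<in> A \<Longrightarrow> g s = h s) \<Longrightarrow> dd A g = dd A h"
  by (simp add: dd_def)

text \<open>Leibniz' rule for a factor with a zero at a node: s - a cancels the denominator that the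
  node \<open>a\<close> contributes.\<close>

lemma dd_mult_linear:
  assumes "finite A" "a \<notin> A"
  shows "dd (insert a A) (\<lambda>x. (x - a) * g x) = dd A g"
proof -
  have "(\<Sum>s\<in>A. dd_weight A s * ((s - a) * g s) / (s - a)) = (\<Sum>s\<in>A. dd_weight A s * g s)"
    by (intro sum.cong refl) (use assms in auto)
  then show ?thesis using assms by (simp add: dd_insert) (simp add: dd_def)
qed

text \<open>With one of two nodes omitted, the divided difference is the same for either choice: 0
  by induction, or 1 if a single node is left. The recurrence then gives 0.\<close>

lemma dd_const:
  assumes "finite A" "card A \<ge> 2"
  shows "dd A (\<lambda>_. 1) = 0"
  using assms
proof (induction "card A" arbitrary: A rule: less_induct)
  case less
  obtain a b C where C: "A = insert a (insert b C)" "a \<noteq> b" "a \<notin> C" "b \<notin> C"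
    using less.prems(2) unfolding numeral_2_eq_2 card_le_Suc_iff by auto
  have fin: "finite C" using C less.prems by auto
  have "dd (insert a C) (\<lambda>_. 1) = dd (insert b C) (\<lambda>_. 1)"
  proof (cases "C = {}")
    case False
    then have "card C \<ge> 1" using fin by (simp add: Suc_leI card_gt_0_iff)
    then show ?thesis using less.hyps[of "insert a C"] less.hyps[of "insert b C"] C fin by auto
  qed simp
  then show ?case using dd_recurrence[OF fin C(3,4,2), of "\<lambda>_. 1"] C by simp
qed

lemma dd_power:
  assumes "finite A" "k + 1 < card A"
  shows "dd A (\<lambda>x. x ^ k) = 0"
  using assms
proof (induction k arbitrary: A)
  case 0
  then show ?case by (simp add: dd_const)
next
  case (Suc k)
  then have "A \<noteq> {}" by auto
  then obtain a C where C: "A = insert a C" "a \<notin> C" by (meson ex_in_conv Set.set_insert)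
  have fin: "finite C" using C Suc.prems by auto
  have "dd A (\<lambda>x. x ^ Suc k) = dd A (\<lambda>x. (x - a) * x ^ k + a * x ^ k)"
    by (intro dd_cong) (simp add: algebra_simps)
  also have "\<dots> = dd C (\<lambda>x. x ^ k) + a * dd A (\<lambda>x. x ^ k)"
    using dd_mult_linear[OF fin C(2)] C by (simp add: dd_add dd_cmult)
  also have "\<dots> = 0" using Suc fin C by simp
  finally show ?case .
qed

lemma dd_poly:
  assumes "finite A" "degree p + 1 < card A"
  shows "dd A (poly p) = 0"
proof -
  have "dd A (poly p) = (\<Sum>i\<le>degree p. coeff p i * dd A (\<lambda>x. x ^ i))"
    by (simp add: poly_altdef[abs_def] dd_sum dd_cmult)
  also have "\<dots> = 0" using assms by (auto intro!: sum.neutral simp: dd_power)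
  finally show ?thesis .
qed

section \<open>Truncated powers and B-splines\<close>

definition tpow :: "nat \<Rightarrow> real \<Rightarrow> real \<Rightarrow> real" where
  "tpow m u x = (if u \<le> x then (x - u) ^ m else 0)"

lemma degree_shift_power: "degree ([:-u, 1:] ^ m :: real poly) = m"
  by (simp add: degree_power_eq)

lemma dd_shift_power:
  assumes "finite A" "m + 1 < card A"
  shows "dd A (\<lambda>x. (x - u) ^ m) = 0"
proof -
  have "poly ([:-u, 1:] ^ m) = (\<lambda>x. (x - u) ^ m)" by (simp add: fun_eq_iff poly_power)
  then show ?thesis using dd_poly[of A "[:-u, 1:] ^ m"] assms by (simp add: degree_shift_power)
qed

lemma dd_tpow_left:
  assumes "finite A" "m + 1 < card A" "\<And>s. s \<in> A \<Longrightarrow> u \<le> s"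
  shows "dd A (tpow m u) = 0"
proof -
  have "dd A (tpow m u) = dd A (\<lambda>x. (x - u) ^ m)"
    by (intro dd_cong) (use assms in \<open>auto simp: tpow_def\<close>)
  then show ?thesis using dd_shift_power assms by simp
qed

lemma dd_tpow_right:
  assumes "\<And>s. s \<in> A \<Longrightarrow> s < u"
  shows "dd A (tpow m u) = 0"
proof -
  have "dd A (tpow m u) = dd A (\<lambda>x. 0 * 1)"
    by (intro dd_cong) (use assms in \<open>force simp: tpow_def\<close>)
  then show ?thesis unfolding dd_cmult by simp
qed

text \<open>The recursion for B-splines: Leibniz' rule for the product of \<open>x - u\<close> and a truncated power,
  with the node taken to be the smallest or the largest one.\<close>

lemma dd_tpow_nonneg:
  assumes "finite A" "card A = m + 2"
  shows "dd A (tpow m u) \<ge> 0"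
  using assms
proof (induction m arbitrary: A)
  have ex: "\<exists>a b C. A = insert a (insert b C) \<and> a = Min A \<and> b = Max A \<and> a < b \<and> a \<notin> C \<and> b \<notin> C \<and> finite C"
    if "finite A" "card A \<ge> 2" for A :: "real set"
  proof -
    have ne: "A \<noteq> {}" using that by auto
    have "Min A \<noteq> Max A"
    proof
      assume "Min A = Max A"
      then have "A \<subseteq> {Min A}"
        using that Min_le[OF that(1)] Max_ge[OF that(1)] by (metis antisym singleton_iff subsetI)
      then have "card A \<le> card {Min A}" by (intro card_mono) auto
      then show False using that by simp
    qed
    moreover have "Min A \<le> Max A" using that ne by simp
    ultimately have "Min A < Max A" by simp
    then show ?thesis
      using that ne Min_in[of A] Max_in[of A]
      by (intro exI[of _ "Min A"] exI[of _ "Max A"] exI[of _ "A - {Min A, Max A}"]) blast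
  qed
  {
    case 0
    obtain a b C where C: "A = insert a (insert b C)" "a < b" "a \<notin> C" "b \<notin> C" "finite C"
      using ex[of A] 0 by force
    then have "C = {}" using 0 by auto
    then have "tpow 0 u b - tpow 0 u a = (b - a) * dd A (tpow 0 u)"
      using dd_recurrence[of "{}" b a "tpow 0 u"] C by (simp add: insert_commute)
    moreover have "tpow 0 u b - tpow 0 u a \<ge> 0" using C by (auto simp: tpow_def)
    ultimately show ?case using C by (simp add: zero_le_mult_iff)
  next
    case (Suc m)
    obtain a b C where C: "A = insert a (insert b C)" "a = Min A" "b = Max A" "a < b" "a \<notin> C" "b \<notin> C" "finite C"
      using ex[of A] Suc.prems by force
    consider "u \<le> a" | "b < u" | "a \<le> u" "u \<le> b" by linarith
    then show ?case
    proof cases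
      case 1
      have "u \<le> s" if "s \<in> A" for s
        using Min_le[OF Suc.prems(1) that] 1 C(2) by linarith
      then have "dd A (tpow (Suc m) u) = 0"
        using Suc.prems by (intro dd_tpow_left) simp_all
      then show ?thesis by simp
    next
      case 2
      have "s < u" if "s \<in> A" for s
        using Max_ge[OF Suc.prems(1) that] 2 C(3) by linarith
      then have "dd A (tpow (Suc m) u) = 0"
        by (rule dd_tpow_right)
      then show ?thesis by simp
    next
      case 3
      let ?g = "tpow m u"
      have "card A = card C + 2" unfolding C(1) using C(4-7) by simp
      then have cC: "card C = m + 1" using Suc.prems by simp
      have pos: "dd (insert a C) ?g \<ge> 0" "dd (insert b C) ?g \<ge> 0"
        by (rule Suc.IH; use C(4-7) cC in simp)+
      have rec: "dd (insert b C) ?g - dd (insert a C) ?g = (b - a) * dd A ?g"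
        using dd_recurrence[of C b a ?g] C(4-7) unfolding C(1) by (simp add: insert_commute)
      have "dd A (tpow (Suc m) u) = dd A (\<lambda>x. (x - a) * ?g x + (a - u) * ?g x)"
        by (intro dd_cong) (simp add: tpow_def algebra_simps)
      also have "\<dots> = dd (insert b C) ?g + (a - u) * dd A ?g"
        using dd_mult_linear[of "insert b C" a ?g] C(4-7) unfolding C(1) by (simp add: dd_add dd_cmult)
      \<comment> \<open>Multiplying by b - a lets the recurrence remove the divided difference over
        all of \<open>A\<close>. What remains has coefficients b - u and u - a, which are
        nonnegative because u lies between the extreme nodes.\<close>
      also have "(b - a) * \<dots> = (b - a) * dd (insert b C) ?g + (a - u) * ((b - a) * dd A ?g)"
        by (simp add: algebra_simps)
      also have "\<dots> = (b - u) * dd (insert b C) ?g + (u - a) * dd (insert a C) ?g"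
        unfolding rec[symmetric] by (simp add: algebra_simps)
      also have "\<dots> \<ge> 0" using 3 pos by simp
      finally show ?thesis using C(4) by (simp add: zero_le_mult_iff)
    qed
  }
qed

text \<open>With x0 and n - 2 further nodes fixed, the divided difference of order n - 1 is monotone
  in its last node, hence bounded near x0 by its values at two points. So the one of order n - 2
  without x0 satisfies a Lipschitz estimate at x0, and \<open>g\<close> is recovered from it by
  continuous operations.\<close>

lemma convex_1d_continuous:
  fixes I :: "real set"
  assumes I: "open I" and n: "n \<ge> 2"
    and pos: "\<And>A. finite A \<Longrightarrow> card A = n + 1 \<Longrightarrow> A \<subseteq> I \<Longrightarrow> dd A g \<ge> 0"
  shows "continuous_on I g"
proof -
  have "isCont g x0" if x0: "x0 \<in> I" for x0
  proof -
    obtain e where e: "e > 0" "ball x0 e \<subseteq> I"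
      using I x0 open_contains_ball by blast
    have sub: "{x0 + e/2 <..< x0 + e} \<subseteq> I" using e by (auto simp: dist_real_def subset_iff)
    have "infinite {x0 + e/2 <..< x0 + e}" using e by (simp add: infinite_Ioo)
    \<comment> \<open>These nodes stay in the outer half of the right neighbourhood, so that the
      moving node, confined to \<open>J\<close>, never meets them.\<close>
    then obtain C where C: "finite C" "card C = n - 2" "C \<subseteq> {x0 + e/2 <..< x0 + e}"
      using infinite_arbitrarily_large by metis
    define J where "J = {x0 - e/2 .. x0 + e/2}"
    have J: "J \<subseteq> I" "x0 \<in> J" "J \<inter> C = {}" using e C by (auto simp: J_def dist_real_def subset_iff)
    have x0C: "x0 \<notin> C" using J by auto
    let ?D = "\<lambda>x. dd (insert x (insert x0 C)) g"
    have mono: "?D x \<le> ?D y" if "x \<in> J - {x0}" "y \<in> J - {x0}" "x < y" for x y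
    proof -
      have ni: "x \<notin> insert x0 C" "y \<notin> insert x0 C" using that J by auto
      have "?D y - ?D x = (y - x) * dd (insert y (insert x (insert x0 C))) g"
        by (rule dd_recurrence) (use ni C that in auto)
      moreover have "dd (insert y (insert x (insert x0 C))) g \<ge> 0"
        using ni that C x0C n J sub x0 by (intro pos) auto
      ultimately show ?thesis using that by (smt (verit) mult_nonneg_nonneg)
    qed
    define M where "M = \<bar>?D (x0 - e/2)\<bar> + \<bar>?D (x0 + e/2)\<bar>"
    have bdd: "\<bar>?D x\<bar> \<le> M" if "x \<in> J - {x0}" for x
    proof -
      have "?D (x0 - e/2) \<le> ?D x"
        using mono[of "x0 - e/2" x] that e by (cases "x = x0 - e/2") (auto simp: J_def)
      moreover have "?D x \<le> ?D (x0 + e/2)"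
        using mono[of x "x0 + e/2"] that e by (cases "x = x0 + e/2") (auto simp: J_def)
      ultimately show ?thesis unfolding M_def by linarith
    qed
    let ?E = "\<lambda>x. dd (insert x C) g"
    have lip: "\<bar>?E x - ?E x0\<bar> \<le> M * \<bar>x - x0\<bar>" if "x \<in> J" for x
    proof (cases "x = x0")
      case False
      have "?E x - ?E x0 = (x - x0) * ?D x"
        by (rule dd_recurrence) (use False C that J x0C in auto)
      then show ?thesis using bdd[of x] that False
        by (simp add: abs_mult mult.commute mult_left_mono)
    qed simp
    have evJ: "\<forall>\<^sub>F x in at x0. x \<in> J"
      unfolding eventually_at J_def
    proof (intro exI[of _ "e/2"] conjI ballI impI)
      fix x assume "x \<noteq> x0 \<and> dist x x0 < e / 2"
      then have "\<bar>x - x0\<bar> < e / 2" by (simp add: dist_real_def)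
      then show "x \<in> {x0 - e / 2..x0 + e / 2}" by (simp only: atLeastAtMost_iff) linarith
    qed (use e in simp)
    have "?E \<midarrow>x0\<rightarrow> ?E x0"
    proof (rule Lim_transform_bound[where g = "\<lambda>x. M * \<bar>x - x0\<bar>" and f = "\<lambda>x. ?E x - ?E x0", THEN LIM_zero_cancel])
      show "\<forall>\<^sub>F x in at x0. norm (?E x - ?E x0) \<le> norm (M * \<bar>x - x0\<bar>)"
        using evJ by eventually_elim (use lip in force)
      show "(\<lambda>x. M * \<bar>x - x0\<bar>) \<midarrow>x0\<rightarrow> 0" by (rule tendsto_eq_intros refl | simp)+
    qed
    moreover have "(\<lambda>x. \<Sum>t\<in>C. dd_weight C t * g t / (t - x)) \<midarrow>x0\<rightarrow> (\<Sum>t\<in>C. dd_weight C t * g t / (t - x0))"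
    proof (intro tendsto_intros)
      show "t - x0 \<noteq> 0" if "t \<in> C" for t using x0C that by auto
    qed
    moreover have "(\<lambda>x. \<Prod>t\<in>C. x - t) \<midarrow>x0\<rightarrow> (\<Prod>t\<in>C. x0 - t)"
      by (intro tendsto_intros)
    ultimately have "(\<lambda>x. (?E x - (\<Sum>t\<in>C. dd_weight C t * g t / (t - x))) * (\<Prod>t\<in>C. x - t)) \<midarrow>x0\<rightarrow>
       (?E x0 - (\<Sum>t\<in>C. dd_weight C t * g t / (t - x0))) * (\<Prod>t\<in>C. x0 - t)"
      by (rule tendsto_mult[OF tendsto_diff])
    moreover have eq: "(?E x - (\<Sum>t\<in>C. dd_weight C t * g t / (t - x))) * (\<Prod>t\<in>C. x - t) = g x"
      if "x \<in> J" for x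
    proof -
      have "x \<notin> C" using that J by auto
      moreover have "(\<Prod>t\<in>C. x - t) \<noteq> 0" using \<open>x \<notin> C\<close> C by auto
      ultimately show ?thesis using C by (simp add: dd_insert)
    qed
    ultimately have "(\<lambda>x. (?E x - (\<Sum>t\<in>C. dd_weight C t * g t / (t - x))) * (\<Prod>t\<in>C. x - t)) \<midarrow>x0\<rightarrow> g x0"
      using J by simp
    then have "g \<midarrow>x0\<rightarrow> g x0"
      by (rule Lim_transform_eventually) (use evJ in \<open>eventually_elim; use eq in simp\<close>)
    then show ?thesis by (simp add: isCont_def)
  qed
  then show ?thesis by (simp add: continuous_at_imp_continuous_on)
qed

section \<open>Tensor products of divided differences\<close>

text \<open>The weights are arbitrary so that an identity between weights in one variable can be
  multiplied out over all directions by \<open>tensor_expand\<close>. The index set is arbitrary so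
  that one direction can be split off.\<close>

definition tensor ::
    "nat set \<Rightarrow> (nat \<Rightarrow> real set) \<Rightarrow> (nat \<Rightarrow> real \<Rightarrow> real) \<Rightarrow> ((nat \<Rightarrow> real) \<Rightarrow> real) \<Rightarrow> real" where
  "tensor A S w f = (\<Sum>y\<in>Pi\<^sub>E A S. (\<Prod>i\<in>A. w i (y i)) * f y)"

lemma tensor_empty [simp]: "tensor {} S w f = f (\<lambda>_. undefined)"
  by (simp add: tensor_def)

lemma tensor_insert:
  assumes "finite A" "j \<notin> A"
  shows "tensor (insert j A) S w f = (\<Sum>s\<in>S j. w j s * tensor A S w (\<lambda>y. f (y(j := s))))"
proof -
  have "tensor (insert j A) S w f =
      (\<Sum>(s, y)\<in>S j \<times> Pi\<^sub>E A S. (\<Prod>i\<in>insert j A. w i ((y(j := s)) i)) * f (y(j := s)))"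
    unfolding tensor_def PiE_insert_eq
    by (subst sum.reindex) (use inj_combinator[OF assms(2)] in \<open>auto simp: case_prod_unfold\<close>)
  also have "\<dots> = (\<Sum>(s, y)\<in>S j \<times> Pi\<^sub>E A S. w j s * ((\<Prod>i\<in>A. w i (y i)) * f (y(j := s))))"
  proof (intro sum.cong refl, clarify)
    fix s y
    have "(\<Prod>i\<in>A. w i ((y(j := s)) i)) = (\<Prod>i\<in>A. w i (y i))"
      by (intro prod.cong) (use assms in auto)
    then show "(\<Prod>i\<in>insert j A. w i ((y(j := s)) i)) * f (y(j := s)) =
        w j s * ((\<Prod>i\<in>A. w i (y i)) * f (y(j := s)))"
      using assms by simp
  qed
  also have "\<dots> = (\<Sum>s\<in>S j. w j s * tensor A S w (\<lambda>y. f (y(j := s))))"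
    by (simp add: sum.cartesian_product[symmetric] tensor_def sum_distrib_left)
  finally show ?thesis .
qed

lemma tensor_cong:
  assumes "\<And>i. i \<in> A \<Longrightarrow> S i = S' i"
    and "\<And>i s. i \<in> A \<Longrightarrow> s \<in> S i \<Longrightarrow> w i s = w' i s"
    and "\<And>y. y \<in> Pi\<^sub>E A S \<Longrightarrow> f y = f' y"
  shows "tensor A S w f = tensor A S' w' f'"
proof -
  have "Pi\<^sub>E A S = Pi\<^sub>E A S'" using assms(1) by (auto simp: PiE_def Pi_def)
  then show ?thesis
    unfolding tensor_def
    by (intro sum.cong arg_cong2[of _ _ _ _ "(*)"] prod.cong) (use assms in \<open>auto simp: PiE_def Pi_def\<close>)
qed

lemma tensor_superset:
  assumes "finite A" and "\<And>i. i \<in> A \<Longrightarrow> finite (S' i) \<and> S i \<subseteq> S' i"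
    and "\<And>i s. i \<in> A \<Longrightarrow> s \<in> S' i - S i \<Longrightarrow> w i s = 0"
  shows "tensor A S' w f = tensor A S w f"
  unfolding tensor_def
proof (rule sum.mono_neutral_right)
  show "finite (Pi\<^sub>E A S')" by (intro finite_PiE) (use assms in auto)
  show "Pi\<^sub>E A S \<subseteq> Pi\<^sub>E A S'" using assms by (intro PiE_mono) auto
  show "\<forall>y\<in>Pi\<^sub>E A S' - Pi\<^sub>E A S. (\<Prod>i\<in>A. w i (y i)) * f y = 0"
  proof
    fix y assume y: "y \<in> Pi\<^sub>E A S' - Pi\<^sub>E A S"
    then obtain i where "i \<in> A" "y i \<notin> S i" by (auto simp: PiE_iff)
    then have "w i (y i) = 0" using y assms(3)[of i "y i"] by (auto simp: PiE_iff)
    then show "(\<Prod>i\<in>A. w i (y i)) * f y = 0" using assms(1) \<open>i \<in> A\<close> by auto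
  qed
qed

lemma tensor_expand:
  assumes "finite A" and "\<And>i. i \<in> A \<Longrightarrow> finite (B i)"
    and "\<And>i s. i \<in> A \<Longrightarrow> s \<in> S i \<Longrightarrow> w i s = (\<Sum>b\<in>B i. l i b * v i b s)"
  shows "tensor A S w f = (\<Sum>b\<in>Pi\<^sub>E A B. (\<Prod>i\<in>A. l i (b i)) * tensor A S (\<lambda>i. v i (b i)) f)"
proof -
  have "tensor A S w f =
      (\<Sum>y\<in>Pi\<^sub>E A S. (\<Prod>i\<in>A. \<Sum>b\<in>B i. l i b * v i b (y i)) * f y)"
    unfolding tensor_def
    by (intro sum.cong arg_cong2[of _ _ _ _ "(*)"] prod.cong) (use assms(3) in \<open>auto simp: PiE_def Pi_def\<close>)
  also have "\<dots> = (\<Sum>y\<in>Pi\<^sub>E A S. (\<Sum>b\<in>Pi\<^sub>E A B. \<Prod>i\<in>A. l i (b i) * v i (b i) (y i)) * f y)"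
    using assms by (intro sum.cong refl) (simp add: prod_sum_PiE)
  also have "\<dots> = (\<Sum>b\<in>Pi\<^sub>E A B. \<Sum>y\<in>Pi\<^sub>E A S. (\<Prod>i\<in>A. l i (b i) * v i (b i) (y i)) * f y)"
    unfolding sum_distrib_right by (rule sum.swap)
  finally show ?thesis
    by (simp add: tensor_def sum_distrib_left prod.distrib mult.assoc)
qed

lemma tensor_add: "tensor A S w (\<lambda>y. f y + g y) = tensor A S w f + tensor A S w g"
  by (simp add: tensor_def sum.distrib distrib_left)

lemma tensor_diff: "tensor A S w (\<lambda>y. f y - g y) = tensor A S w f - tensor A S w g"
  by (simp add: tensor_def sum_subtractf right_diff_distrib)

lemma tensor_sum: "tensor A S w (\<lambda>y. \<Sum>k\<in>K. f k y) = (\<Sum>k\<in>K. tensor A S w (f k))"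
  unfolding tensor_def sum_distrib_left by (rule sum.swap)

lemma tensor_prod:
  assumes "finite A" "\<And>i. i \<in> A \<Longrightarrow> finite (S i)"
  shows "tensor A S w (\<lambda>y. \<Prod>i\<in>A. g i (y i)) = (\<Prod>i\<in>A. \<Sum>s\<in>S i. w i s * g i s)"
proof -
  have "tensor A S w (\<lambda>y. \<Prod>i\<in>A. g i (y i)) = (\<Sum>y\<in>Pi\<^sub>E A S. \<Prod>i\<in>A. w i (y i) * g i (y i))"
    by (simp add: tensor_def prod.distrib)
  also have "\<dots> = (\<Prod>i\<in>A. \<Sum>s\<in>S i. w i s * g i s)"
    using assms by (simp add: prod_sum_PiE)
  finally show ?thesis .
qed

abbreviation dd_tensor :: "nat \<Rightarrow> (nat \<Rightarrow> real set) \<Rightarrow> ((nat \<Rightarrow> real) \<Rightarrow> real) \<Rightarrow> real" where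
  "dd_tensor d S f \<equiv> tensor {..<d} S (\<lambda>i. dd_weight (S i)) f"

lemma multiple_divided_difference_eq_dd_tensor:
  assumes "\<And>i. i < d \<Longrightarrow> inj_on (X i) {..n i}"
  shows "multiple_divided_difference d n X f = dd_tensor d (\<lambda>i. X i ` {..n i}) f"
  using assms
proof (induction d arbitrary: f)
  case (Suc d)
  then show ?case
    by (simp add: lessThan_Suc tensor_insert divided_difference_eq_dd dd_def)
qed simp

lemma box_convex_iff_dd_tensor:
  "box_convex d I n f \<longleftrightarrow>
    (\<forall>S. (\<forall>i<d. finite (S i) \<and> card (S i) = n i + 1 \<and> S i \<subseteq> I i) \<longrightarrow> dd_tensor d S f \<ge> 0)"
proof (intro iffI allI impI)
  fix S assume conv: "box_convex d I n f"
    and S: "\<forall>i<d. finite (S i) \<and> card (S i) = n i + 1 \<and> S i \<subseteq> I i"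
  have "\<exists>x. bij_betw x {..n i} (S i)" if "i < d" for i
    using ex_bij_betw_nat_finite[of "S i"] S that
    by (metis Suc_eq_plus1 atLeast0LessThan lessThan_Suc_atMost)
  then obtain X where X: "\<And>i. i < d \<Longrightarrow> bij_betw (X i) {..n i} (S i)" by metis
  have im: "X i ` {..n i} = S i" if "i < d" for i using X[OF that] by (simp add: bij_betw_def)
  have inj: "inj_on (X i) {..n i}" if "i < d" for i using X[OF that] by (simp add: bij_betw_def)
  have "multiple_divided_difference d n X f \<ge> 0"
    using conv im inj S unfolding box_convex_def by blast
  moreover have "multiple_divided_difference d n X f = dd_tensor d S f"
    by (subst multiple_divided_difference_eq_dd_tensor, erule inj, rule tensor_cong) (auto simp: im)
  ultimately show "dd_tensor d S f \<ge> 0" by simp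
next
  assume *: "\<forall>S. (\<forall>i<d. finite (S i) \<and> card (S i) = n i + 1 \<and> S i \<subseteq> I i) \<longrightarrow> dd_tensor d S f \<ge> 0"
  show "box_convex d I n f"
    unfolding box_convex_def
  proof (intro allI impI)
    fix X assume X: "\<forall>i<d. (\<forall>j\<le>n i. X i j \<in> I i) \<and> inj_on (X i) {..n i}"
    then have "\<forall>i<d. finite (X i ` {..n i}) \<and> card (X i ` {..n i}) = n i + 1 \<and> X i ` {..n i} \<subseteq> I i"
      by (auto simp: card_image)
    then show "multiple_divided_difference d n X f \<ge> 0"
      using * X by (simp add: multiple_divided_difference_eq_dd_tensor)
  qed
qed

lemma tensor_extract:
  assumes "j < d"
  shows "tensor {..<d} S w f =
    (\<Sum>s\<in>S j. w j s * tensor ({..<d} - {j}) S w (\<lambda>y. f (y(j := s))))"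
  using tensor_insert[of "{..<d} - {j}" j S w f] assms by (simp add: insert_absorb)

text \<open>A divided difference of order n j of this section is a full multiple divided difference
  of \<open>f\<close>, so the section is convex of order n j in one variable.\<close>

lemma box_convex_section_continuous:
  assumes conv: "box_convex d I n f" and "j < d" "open (I j)" "n j \<ge> 2"
    and S: "\<And>i. i < d \<Longrightarrow> i \<noteq> j \<Longrightarrow> finite (S i) \<and> card (S i) = n i + 1 \<and> S i \<subseteq> I i"
  shows "continuous_on (I j)
    (\<lambda>z. tensor ({..<d} - {j}) S (\<lambda>i. dd_weight (S i)) (\<lambda>y. f (y(j := z))))"
proof (rule convex_1d_continuous)
  fix A assume A: "finite A" "card A = n j + 1" "A \<subseteq> I j"
  have "dd_tensor d (S(j := A)) f \<ge> 0"
    by (rule conv[unfolded box_convex_iff_dd_tensor, rule_format]) (use A S in auto)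
  also have "dd_tensor d (S(j := A)) f = (\<Sum>s\<in>A. dd_weight A s *
      tensor ({..<d} - {j}) S (\<lambda>i. dd_weight (S i)) (\<lambda>y. f (y(j := s))))"
    unfolding tensor_extract[OF \<open>j < d\<close>]
    by (intro sum.cong arg_cong2[of _ _ _ _ "(*)"] tensor_cong) auto
  finally show "dd A (\<lambda>z. tensor ({..<d} - {j}) S (\<lambda>i. dd_weight (S i)) (\<lambda>y. f (y(j := z)))) \<ge> 0"
    by (simp add: dd_def)
qed (use assms in auto)

section \<open>Taylor's formula on a grid\<close>

definition lagrange :: "real set \<Rightarrow> (real \<Rightarrow> real) \<Rightarrow> real \<Rightarrow> real" where
  "lagrange T g x = (\<Sum>t\<in>T. g t * dd_weight T t * (\<Prod>s\<in>T - {t}. x - s))"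

text \<open>Term by term this is (x - a) / (t - a) = 1 + (x - t) / (t - a).\<close>

lemma lagrange_insert:
  assumes "finite C" "a \<notin> C"
  shows "lagrange (insert a C) g x = lagrange C g x + dd (insert a C) g * (\<Prod>s\<in>C. x - s)"
proof -
  have *: "g t * dd_weight (insert a C) t * (\<Prod>s\<in>insert a C - {t}. x - s) =
      g t * dd_weight C t * (\<Prod>s\<in>C - {t}. x - s) + dd_weight C t * g t / (t - a) * (\<Prod>s\<in>C. x - s)"
    if t: "t \<in> C" for t
  proof -
    have 1: "insert a C - {t} = insert a (C - {t})" using assms t by auto
    have 2: "(\<Prod>s\<in>C. x - s) = (x - t) * (\<Prod>s\<in>C - {t}. x - s)"
      using assms t by (simp add: prod.remove)
    have 3: "t - a \<noteq> 0" using assms t by auto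
    have "(x - a) / (t - a) = 1 + (x - t) / (t - a)" using 3 by (simp add: field_simps)
    then have eq: "G * D * p * ((x - a) / (t - a)) = G * D * p * (1 + (x - t) / (t - a))" for G D p
      by (rule arg_cong)
    have "g t * (dd_weight C t / (t - a)) * ((x - a) * p) =
        g t * dd_weight C t * p + dd_weight C t * g t / (t - a) * ((x - t) * p)" for p
      using eq[of "g t" "dd_weight C t" p] by (simp add: distrib_left mult_ac)
    then show ?thesis
      using assms t unfolding 1 2 by (simp add: dd_weight_insert)
  qed
  have "lagrange (insert a C) g x = g a / (\<Prod>t\<in>C. a - t) * (\<Prod>s\<in>C. x - s) +
      (\<Sum>t\<in>C. g t * dd_weight C t * (\<Prod>s\<in>C - {t}. x - s) + dd_weight C t * g t / (t - a) * (\<Prod>s\<in>C. x - s))"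
    using assms * by (simp add: lagrange_def dd_weight_insert_same)
  then show ?thesis
    using assms by (simp add: dd_insert sum.distrib lagrange_def sum_distrib_right distrib_right)
qed

lemma lagrange_node:
  assumes "finite T" "x \<in> T"
  shows "lagrange T g x = g x"
proof -
  have "lagrange T g x = g x * dd_weight T x * (\<Prod>s\<in>T - {x}. x - s)"
    unfolding lagrange_def
    by (rule sum.mono_neutral_cong_right[where S = "{x}", simplified sum.insert, simplified])
      (use assms in \<open>auto intro!: prod_zero\<close>)
  also have "(\<Prod>s\<in>T - {x}. x - s) \<noteq> 0" using assms by auto
  then have "g x * dd_weight T x * (\<Prod>s\<in>T - {x}. x - s) = g x"
    using assms by (simp add: dd_weight_def)
  finally show ?thesis .
qed

lemma dd_prod_linear:
  assumes "finite S" "finite K" "card K + 1 < card S"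
  shows "dd S (\<lambda>x. \<Prod>k\<in>K. x - c k) = 0"
proof -
  have "degree (\<Prod>k\<in>K. [:- c k, 1:]) = card K"
    by (subst degree_prod_eq_sum_degree) auto
  moreover have "poly (\<Prod>k\<in>K. [:- c k, 1:]) = (\<lambda>x. \<Prod>k\<in>K. x - c k)"
    by (simp add: fun_eq_iff poly_prod)
  ultimately show ?thesis using dd_poly[of S "\<Prod>k\<in>K. [:- c k, 1:]"] assms by simp
qed

lemma dd_lagrange:
  assumes "finite S" "finite T" "card T < card S"
  shows "dd S (lagrange T g) = 0"
proof -
  have "dd S (lagrange T g) = (\<Sum>t\<in>T. g t * dd_weight T t * dd S (\<lambda>x. \<Prod>s\<in>T - {t}. x - s))"
    by (simp add: lagrange_def[abs_def] dd_sum dd_cmult)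
  also have "\<dots> = 0"
  proof (rule sum.neutral, rule ballI)
    fix t assume t: "t \<in> T"
    then have "card T > 0" using assms by (auto simp: card_gt_0_iff)
    then have "card (T - {t}) + 1 < card S" using assms t by (simp add: card_Diff_singleton)
    then show "g t * dd_weight T t * dd S (\<lambda>x. \<Prod>s\<in>T - {t}. x - s) = 0"
      using dd_prod_linear[of S "T - {t}" "\<lambda>s. s"] assms by simp
  qed
  finally show ?thesis .
qed

text \<open>Tested on the indicator of a point, an identity of divided differences valid for all
  \<open>g\<close> becomes an identity of weights, which is the form that
  \<open>tensor_expand\<close> accepts.\<close>

lemma dd_indicator:
  assumes "finite A"
  shows "dd A (\<lambda>x. if x = s then 1 else 0) = dd_weight A s"
proof -
  have "dd A (\<lambda>x. if x = s then 1 else 0) = (\<Sum>x\<in>A. if x = s then dd_weight A x else 0)"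
    unfolding dd_def by (intro sum.cong) auto
  then show ?thesis using assms by (auto simp: dd_weight_def)
qed

lemma dd_weight_recurrence:
  assumes "finite A" "a \<notin> A" "b \<notin> A" "a \<noteq> b"
  shows "dd_weight (insert a A) s - dd_weight (insert b A) s = (a - b) * dd_weight (insert a (insert b A)) s"
  using dd_recurrence[OF assms, of "\<lambda>x. if x = s then 1 else 0"] assms by (simp add: dd_indicator)

section \<open>Windows of consecutive grid points and discrete B-splines\<close>

definition grid_nodes :: "nat \<Rightarrow> real \<Rightarrow> int \<Rightarrow> real set" where
  "grid_nodes n h j = (\<lambda>l. h * of_int (j + int l)) ` {..n}"

text \<open>The n - 1 points common to the windows of n points that start at j and at j + 1.\<close>

definition grid_inner :: "nat \<Rightarrow> real \<Rightarrow> int \<Rightarrow> real set" where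
  "grid_inner n h j = (\<lambda>l. h * of_int (j + int l)) ` {1..<n}"

lemma finite_grid_nodes [simp]: "finite (grid_nodes n h j)" "finite (grid_inner n h j)"
  by (simp_all add: grid_nodes_def grid_inner_def)

lemma card_grid_nodes:
  assumes "h > 0"
  shows "card (grid_nodes n h j) = n + 1"
  unfolding grid_nodes_def by (subst card_image) (use assms in \<open>auto simp: inj_on_def\<close>)

lemma grid_nodes_eq:
  assumes "h > 0" "n \<ge> 1"
  shows "grid_nodes (n - 1) h j = insert (h * of_int j) (grid_inner n h j)"
    and "grid_nodes (n - 1) h (j + 1) = insert (h * of_int (j + int n)) (grid_inner n h j)"
    and "grid_nodes n h j = insert (h * of_int (j + int n)) (insert (h * of_int j) (grid_inner n h j))"
    and "h * of_int j \<notin> grid_inner n h j" and "h * of_int (j + int n) \<notin> grid_inner n h j"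
    and "h * of_int (j + int n) \<noteq> h * of_int j"
proof -
  let ?f = "\<lambda>l. h * of_int (j + int l)"
  have s1: "{..n - 1} = insert 0 {1..<n}" "{..n} = insert n (insert 0 {1..<n})" using assms by auto
  show "grid_nodes (n - 1) h j = insert (h * of_int j) (grid_inner n h j)"
    unfolding grid_nodes_def grid_inner_def s1(1) image_insert by simp
  show "grid_nodes n h j = insert (h * of_int (j + int n)) (insert (h * of_int j) (grid_inner n h j))"
    unfolding grid_nodes_def grid_inner_def s1(2) image_insert by simp
  have "Suc ` {..n - 1} = insert n {1..<n}" using assms by (auto simp: image_Suc_atMost)
  from arg_cong[OF this, of "\<lambda>A. ?f ` A"]
  show "grid_nodes (n - 1) h (j + 1) = insert (h * of_int (j + int n)) (grid_inner n h j)"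
    by (simp add: grid_nodes_def grid_inner_def image_image algebra_simps)
  show "h * of_int j \<notin> grid_inner n h j" "h * of_int (j + int n) \<notin> grid_inner n h j"
    "h * of_int (j + int n) \<noteq> h * of_int j"
    using assms by (auto simp: grid_inner_def)
qed

lemma dd_grid_telescope:
  assumes "h > 0" "n \<ge> 1"
  shows "dd (grid_nodes (n - 1) h (j + 1)) g - dd (grid_nodes (n - 1) h j) g =
    real n * h * dd (grid_nodes n h j) g"
proof -
  have "dd (grid_nodes (n - 1) h (j + 1)) g - dd (grid_nodes (n - 1) h j) g =
     (h * of_int (j + int n) - h * of_int j) * dd (grid_nodes n h j) g"
    unfolding grid_nodes_eq[OF assms, of j]
    by (rule dd_recurrence) (use grid_nodes_eq(4-6)[OF assms, of j] in auto)
  then show ?thesis by (simp add: algebra_simps)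
qed

text \<open>A discrete truncated power; for h = 0 and n \<ge> 2 it is
  \<open>tpow (n - 1) u x / fact (n - 1)\<close>. Positive parts of the single factors keep it
  jointly continuous in h, u and x. If x and u are grid points with u < x, they can be omitted:
  either no factor is negative, or one of them is exactly 0.\<close>

definition discrete_kernel :: "nat \<Rightarrow> real \<Rightarrow> real \<Rightarrow> real \<Rightarrow> real" where
  "discrete_kernel n h u x = (\<Prod>l\<in>{1..<n}. max 0 (x - u - h * real l)) / fact (n - 1)"

lemma discrete_kernel_eq_0:
  assumes "h > 0" "n \<ge> 2" "m < j + int n"
  shows "discrete_kernel n h (h * of_int j) (h * of_int m) = 0"
proof -
  have "\<exists>l\<in>{1..<n}. max 0 (h * of_int m - h * of_int j - h * real l) = 0"
  proof (cases "m \<le> j")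
    case True
    then have "h * of_int m \<le> h * of_int j" using assms by simp
    then have "h * of_int m - h * of_int j - h * real 1 \<le> 0" using assms by linarith
    then show ?thesis using assms by (intro bexI[of _ 1] max_absorb1) auto
  next
    case False
    then have "h * of_int m - h * of_int j - h * real (nat (m - j)) = 0"
      by (simp add: algebra_simps)
    then show ?thesis using assms False by (intro bexI[of _ "nat (m - j)"]) auto
  qed
  then show ?thesis by (auto simp: discrete_kernel_def)
qed

lemma discrete_kernel_eq_prod:
  assumes "h > 0" "j < m"
  shows "discrete_kernel n h (h * of_int j) (h * of_int m) =
    (\<Prod>l\<in>{1..<n}. h * of_int m - h * of_int (j + int l)) / fact (n - 1)"
proof (cases "m < j + int n")
  case True
  then have l: "nat (m - j) \<in> {1..<n}" using assms by auto
  have "h * of_int m - h * of_int j - h * real (nat (m - j)) = 0"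
    "h * of_int m - h * of_int (j + int (nat (m - j))) = 0"
    using assms by (auto simp: algebra_simps)
  then have "max 0 (h * of_int m - h * of_int j - h * real (nat (m - j))) = 0"
    "h * of_int m - h * of_int (j + int (nat (m - j))) = 0" by linarith+
  then have "(\<Prod>l\<in>{1..<n}. max 0 (h * of_int m - h * of_int j - h * real l)) = 0"
    "(\<Prod>l\<in>{1..<n}. h * of_int m - h * of_int (j + int l)) = 0"
    using l by (blast intro: prod_zero[OF finite_atLeastLessThan])+
  then show ?thesis by (simp only: discrete_kernel_def)
next
  case False
  have "max 0 (h * of_int m - h * of_int j - h * real l) = h * of_int m - h * of_int (j + int l)"
    if "l \<in> {1..<n}" for l
  proof -
    have "j + int l \<le> m" using False that by auto
    then have "h * of_int (j + int l) \<le> h * of_int m" using assms by simp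
    then show ?thesis by (simp add: algebra_simps)
  qed
  then show ?thesis by (simp add: discrete_kernel_def)
qed

text \<open>Taylor's formula on a grid: the increments of the interpolation polynomial on \<open>n\<close> consecutive
  grid points telescope, and the final polynomial interpolates at \<open>h * m\<close>.\<close>

lemma discrete_taylor:
  fixes j0 m :: int
  assumes "h > 0" "n \<ge> 1" "j0 \<le> m"
  shows "g (h * of_int m) = lagrange (grid_nodes (n - 1) h j0) g (h * of_int m) +
    (\<Sum>j\<in>{j0..<m}. fact n * h * dd (grid_nodes n h j) g * discrete_kernel n h (h * of_int j) (h * of_int m))"
proof -
  let ?x = "h * of_int m"
  have step: "lagrange (grid_nodes (n - 1) h (j + 1)) g ?x - lagrange (grid_nodes (n - 1) h j) g ?x =
      fact n * h * dd (grid_nodes n h j) g * discrete_kernel n h (h * of_int j) ?x" if "j < m" for j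
  proof -
    note eqs = grid_nodes_eq[OF assms(1,2), of j]
    have inner: "(\<Prod>s\<in>grid_inner n h j. ?x - s) = (\<Prod>l\<in>{1..<n}. ?x - h * of_int (j + int l))"
      unfolding grid_inner_def
      by (subst prod.reindex) (use assms in \<open>auto simp: inj_on_def\<close>)
    have "lagrange (grid_nodes (n - 1) h (j + 1)) g ?x - lagrange (grid_nodes (n - 1) h j) g ?x =
       (dd (grid_nodes (n - 1) h (j + 1)) g - dd (grid_nodes (n - 1) h j) g) *
       (\<Prod>s\<in>grid_inner n h j. ?x - s)"
      unfolding eqs(1,2) lagrange_insert[OF finite_grid_nodes(2) eqs(4)]
        lagrange_insert[OF finite_grid_nodes(2) eqs(5)] left_diff_distrib by simp
    also have "\<dots> = real n * h * dd (grid_nodes n h j) g *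
       (\<Prod>l\<in>{1..<n}. ?x - h * of_int (j + int l))"
      by (simp only: dd_grid_telescope[OF assms(1,2)] inner)
    also have "(\<Prod>l\<in>{1..<n}. ?x - h * of_int (j + int l)) =
       fact (n - 1) * discrete_kernel n h (h * of_int j) ?x"
      unfolding discrete_kernel_eq_prod[OF assms(1) that] by simp
    also have "real n * h * dd (grid_nodes n h j) g * (fact (n - 1) * discrete_kernel n h (h * of_int j) ?x) =
       (real n * fact (n - 1)) * h * dd (grid_nodes n h j) g * discrete_kernel n h (h * of_int j) ?x"
      by (simp add: mult_ac)
    also have "real n * fact (n - 1) = fact n" using assms by (simp add: fact_reduce)
    finally show ?thesis .
  qed
  have tel: "(\<Sum>j\<in>{j0..<k}. fact n * h * dd (grid_nodes n h j) g * discrete_kernel n h (h * of_int j) ?x)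
      = lagrange (grid_nodes (n - 1) h k) g ?x - lagrange (grid_nodes (n - 1) h j0) g ?x"
    if "j0 \<le> k" "k \<le> m" for k
    using that
  proof (induction k rule: int_ge_induct)
    case (step i)
    have "{j0..<i + 1} = insert i {j0..<i}" using step by auto
    then show ?case using step \<open>\<And>j. j < m \<Longrightarrow> _ j\<close>[of i] by simp
  qed simp
  have "lagrange (grid_nodes (n - 1) h m) g ?x = g ?x"
    by (rule lagrange_node) (auto simp: grid_nodes_def intro!: image_eqI[of _ _ 0])
  then show ?thesis using tel[of m] assms by simp
qed

text \<open>To the right of \<open>h * of_int j\<close> the kernel agrees at grid points with a
  polynomial of degree n - 1, which n + 1 nodes annihilate.\<close>

lemma dd_discrete_kernel_left:
  assumes "h > 0" "n \<ge> 1" "finite S" "card S = n + 1"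
    and "\<And>s. s \<in> S \<Longrightarrow> h * of_int j < s \<and> s \<in> range (\<lambda>m. h * of_int m)"
  shows "dd S (discrete_kernel n h (h * of_int j)) = 0"
proof -
  have "dd S (discrete_kernel n h (h * of_int j)) =
      dd S (\<lambda>x. 1 / fact (n - 1) * (\<Prod>l\<in>{1..<n}. x - h * of_int (j + int l)))"
  proof (rule dd_cong)
    fix s assume s: "s \<in> S"
    then obtain m where m: "s = h * of_int m" using assms(5) by blast
    have "j < m" using assms(5)[OF s] assms(1) by (simp add: m)
    then show "discrete_kernel n h (h * of_int j) s =
        1 / fact (n - 1) * (\<Prod>l\<in>{1..<n}. s - h * of_int (j + int l))"
      unfolding m discrete_kernel_eq_prod[OF assms(1) \<open>j < m\<close>] by simp
  qed
  also have "\<dots> = 0"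
    using assms by (subst dd_cmult) (simp add: dd_prod_linear)
  finally show ?thesis .
qed

lemma dd_discrete_kernel_right:
  assumes "h > 0" "n \<ge> 2"
    and "\<And>s. s \<in> S \<Longrightarrow> s < h * of_int (j + int n) \<and> s \<in> range (\<lambda>m. h * of_int m)"
  shows "dd S (discrete_kernel n h (h * of_int j)) = 0"
proof -
  have "discrete_kernel n h (h * of_int j) s = 0" if s: "s \<in> S" for s
  proof -
    obtain m where m: "s = h * of_int m" using assms(3) s by blast
    have "h * of_int m < h * of_int (j + int n)" using assms(3)[OF s] by (simp only: m)
    then have "m < j + int n" using assms(1) by (simp only: mult_less_cancel_left_pos of_int_less_iff)
    then show ?thesis unfolding m by (rule discrete_kernel_eq_0[OF assms(1,2)])
  qed
  then show ?thesis by (simp add: dd_def)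
qed

text \<open>A discrete Peano formula: \<open>dd S\<close> annihilates the interpolation polynomial
  in \<open>discrete_taylor\<close>. Only windows between the extreme nodes contribute, so any
  finite \<open>V\<close> that contains them will do.\<close>

lemma dd_eq_discrete_sum:
  fixes V :: "int set"
  assumes h: "h > 0" and n: "n \<ge> 2" and S: "finite S" "card S = n + 1" "S \<subseteq> range (\<lambda>m. h * of_int m)"
    and V: "finite V"
      "\<And>j s t. s \<in> S \<Longrightarrow> t \<in> S \<Longrightarrow> s \<le> h * of_int j \<Longrightarrow> h * of_int (j + int n) \<le> t \<Longrightarrow> j \<in> V"
  shows "dd S g = (\<Sum>j\<in>V. fact n * h * dd S (discrete_kernel n h (h * of_int j)) * dd (grid_nodes n h j) g)"
proof -
  have ne: "S \<noteq> {}" using S by auto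
  obtain j0 where j0: "Min S = h * of_int j0" using Min_in[OF S(1) ne] S(3) by auto
  obtain j1 where j1: "Max S = h * of_int j1" using Max_in[OF S(1) ne] S(3) by auto
  let ?K = "\<lambda>j. discrete_kernel n h (h * of_int j)"
  let ?c = "\<lambda>j. fact n * h * dd (grid_nodes n h j) g"
  have zero: "dd S (?K j) = 0" if "j < j0 \<or> j1 < j + int n" for j
    using that
  proof
    assume "j < j0"
    then have "h * of_int j < Min S" using h j0 by simp
    then have "h * of_int j < s" if "s \<in> S" for s
      using Min_le[OF S(1) that] by linarith
    then show ?thesis using S n h by (intro dd_discrete_kernel_left) auto
  next
    assume "j1 < j + int n"
    then have "Max S < h * of_int (j + int n)" unfolding j1 using h
      by (simp only: mult_less_cancel_left_pos of_int_less_iff)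
    then have "s < h * of_int (j + int n)" if "s \<in> S" for s
      using Max_ge[OF S(1) that] by linarith
    then show ?thesis using S n h by (intro dd_discrete_kernel_right) auto
  qed
  have "g s = lagrange (grid_nodes (n - 1) h j0) g s + (\<Sum>j\<in>{j0..<j1}. ?c j * ?K j s)"
    if s: "s \<in> S" for s
  proof -
    obtain m where m: "s = h * of_int m" using S s by auto
    have "h * of_int j0 \<le> s" "s \<le> h * of_int j1"
      unfolding j0[symmetric] j1[symmetric] using S s by auto
    then have jm: "j0 \<le> m" "m \<le> j1" using h by (auto simp: m)
    have "(\<Sum>j\<in>{j0..<m}. ?c j * ?K j s) = (\<Sum>j\<in>{j0..<j1}. ?c j * ?K j s)"
      by (rule sum.mono_neutral_left)
        (use jm n h in \<open>auto simp: m discrete_kernel_eq_0\<close>)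
    then show ?thesis using discrete_taylor[OF h _ jm(1), of n g] n by (simp add: m)
  qed
  then have "dd S g = dd S (\<lambda>s. lagrange (grid_nodes (n - 1) h j0) g s + (\<Sum>j\<in>{j0..<j1}. ?c j * ?K j s))"
    by (rule dd_cong)
  also have "\<dots> = dd S (lagrange (grid_nodes (n - 1) h j0) g) + (\<Sum>j\<in>{j0..<j1}. ?c j * dd S (?K j))"
    by (simp only: dd_add dd_sum dd_cmult)
  also have "dd S (lagrange (grid_nodes (n - 1) h j0) g) = 0"
    using S n h by (intro dd_lagrange) (auto simp: card_grid_nodes)
  also have "(\<Sum>j\<in>{j0..<j1}. ?c j * dd S (?K j)) = (\<Sum>j\<in>V \<union> {j0..<j1}. ?c j * dd S (?K j))"
  proof (rule sum.mono_neutral_left)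
    show "\<forall>j\<in>V \<union> {j0..<j1} - {j0..<j1}. ?c j * dd S (?K j) = 0"
    proof
      fix j assume "j \<in> V \<union> {j0..<j1} - {j0..<j1}"
      then have "j < j0 \<or> j1 < j + int n" using n by auto
      then show "?c j * dd S (?K j) = 0" using zero by simp
    qed
  qed (use V in auto)
  also have "\<dots> = (\<Sum>j\<in>V. ?c j * dd S (?K j))"
  proof (rule sum.mono_neutral_right)
    show "\<forall>j\<in>V \<union> {j0..<j1} - V. ?c j * dd S (?K j) = 0"
    proof
      fix j assume j: "j \<in> V \<union> {j0..<j1} - V"
      have "j < j0 \<or> j1 < j + int n"
      proof (rule ccontr)
        assume "\<not> ?thesis"
        then have "Min S \<le> h * of_int j" "h * of_int (j + int n) \<le> Max S"
          unfolding j0 j1 using h by (auto simp only: mult_le_cancel_left_pos of_int_le_iff not_less de_Morgan_disj)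
        then show False using V(2)[of "Min S" "Max S" j] S ne j by auto
      qed
      then show "?c j * dd S (?K j) = 0" using zero by simp
    qed
  qed (use V in auto)
  finally show ?thesis by (simp add: mult_ac)
qed

section \<open>The cone of divided differences and bounds for masses\<close>

definition dd_cone :: "nat \<Rightarrow> real set \<Rightarrow> (real \<Rightarrow> real) \<Rightarrow> bool" where
  "dd_cone n I w \<longleftrightarrow> (\<exists>\<A> c. finite \<A> \<and> (\<forall>A\<in>\<A>. finite A \<and> card A = n + 1 \<and> A \<subseteq> I \<and> 0 \<le> c A) \<and>
     (\<forall>s. w s = (\<Sum>A\<in>\<A>. c A * dd_weight A s)))"

lemma dd_cone_0 [simp]: "dd_cone n I (\<lambda>_. 0)"
  unfolding dd_cone_def by (intro exI[of _ "{}"]) auto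

lemma dd_cone_dd_weight:
  assumes "finite A" "card A = n + 1" "A \<subseteq> I" "c \<ge> 0"
  shows "dd_cone n I (\<lambda>s. c * dd_weight A s)"
  unfolding dd_cone_def by (intro exI[of _ "{A}"] exI[of _ "\<lambda>_. c"]) (use assms in auto)

text \<open>Padding with zero coefficients puts both weights on one family of node sets, where
  coefficients can be compared one by one.\<close>

lemma dd_cone_common:
  assumes "dd_cone n I v" "dd_cone n I w"
  obtains \<A> a b where "finite \<A>"
    "\<And>A. A \<in> \<A> \<Longrightarrow> finite A \<and> card A = n + 1 \<and> A \<subseteq> I \<and> 0 \<le> a A \<and> 0 \<le> b A"
    "\<And>s. v s = (\<Sum>A\<in>\<A>. a A * dd_weight A s)" "\<And>s. w s = (\<Sum>A\<in>\<A>. b A * dd_weight A s)"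
proof -
  obtain \<A> a where A: "finite \<A>" "\<forall>A\<in>\<A>. finite A \<and> card A = n + 1 \<and> A \<subseteq> I \<and> 0 \<le> a A"
    "\<forall>s. v s = (\<Sum>A\<in>\<A>. a A * dd_weight A s)" using assms(1) by (auto simp: dd_cone_def)
  obtain \<B> b where B: "finite \<B>" "\<forall>A\<in>\<B>. finite A \<and> card A = n + 1 \<and> A \<subseteq> I \<and> 0 \<le> b A"
    "\<forall>s. w s = (\<Sum>A\<in>\<B>. b A * dd_weight A s)" using assms(2) by (auto simp: dd_cone_def)
  define a' where "a' A = (if A \<in> \<A> then a A else 0)" for A
  define b' where "b' A = (if A \<in> \<B> then b A else 0)" for A
  have "v s = (\<Sum>A\<in>\<A> \<union> \<B>. a' A * dd_weight A s)" for s
    unfolding A(3)[rule_format] using A(1) B(1)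
    by (intro sum.mono_neutral_cong_left) (auto simp: a'_def)
  moreover have "w s = (\<Sum>A\<in>\<A> \<union> \<B>. b' A * dd_weight A s)" for s
    unfolding B(3)[rule_format] using A(1) B(1)
    by (intro sum.mono_neutral_cong_left) (auto simp: b'_def)
  ultimately show ?thesis
    using A(1,2) B(1,2) by (intro that[of "\<A> \<union> \<B>" a' b']) (auto simp: a'_def b'_def)
qed

lemma dd_cone_add:
  assumes "dd_cone n I v" "dd_cone n I w"
  shows "dd_cone n I (\<lambda>s. v s + w s)"
proof -
  obtain \<A> a b where "finite \<A>"
    "\<And>A. A \<in> \<A> \<Longrightarrow> finite A \<and> card A = n + 1 \<and> A \<subseteq> I \<and> 0 \<le> a A \<and> 0 \<le> b A"
    "\<And>s. v s = (\<Sum>A\<in>\<A>. a A * dd_weight A s)" "\<And>s. w s = (\<Sum>A\<in>\<A>. b A * dd_weight A s)"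
    using dd_cone_common[OF assms] by blast
  then show ?thesis
    unfolding dd_cone_def
    by (intro exI[of _ \<A>] exI[of _ "\<lambda>A. a A + b A"]) (simp add: sum.distrib distrib_right)
qed

lemma dd_cone_sum:
  assumes "finite K" "\<And>k. k \<in> K \<Longrightarrow> dd_cone n I (w k)"
  shows "dd_cone n I (\<lambda>s. \<Sum>k\<in>K. w k s)"
  using assms by (induction K rule: finite_induct) (auto intro: dd_cone_add)

text \<open>Over a common family \<open>v i\<close> has coefficients a and \<open>w i\<close> has a
  + b. Multiplying out, each product of coefficients can only grow, and it multiplies a full divided
  difference of \<open>f\<close>, which is nonnegative.\<close>

lemma tensor_mono_dd_cone:
  assumes conv: "box_convex d I n f"
    and cone: "\<And>i. i < d \<Longrightarrow> dd_cone (n i) (I i) (v i)" "\<And>i. i < d \<Longrightarrow> dd_cone (n i) (I i) (\<lambda>s. w i s - v i s)"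
    and S: "\<And>i. i < d \<Longrightarrow> finite (S i)" "\<And>i s. i < d \<Longrightarrow> s \<notin> S i \<Longrightarrow> v i s = 0 \<and> w i s = 0"
  shows "tensor {..<d} S v f \<le> tensor {..<d} S w f"
proof -
  define P where "P i \<A> a b \<longleftrightarrow> finite \<A> \<and>
     (\<forall>A\<in>\<A>. finite A \<and> card A = n i + 1 \<and> A \<subseteq> I i \<and> 0 \<le> a A \<and> 0 \<le> b A) \<and>
     (\<forall>s. v i s = (\<Sum>A\<in>\<A>. a A * dd_weight A s)) \<and>
     (\<forall>s. w i s - v i s = (\<Sum>A\<in>\<A>. b A * dd_weight A s))" for i \<A> a b
  have "\<exists>\<A> a b. P i \<A> a b" if "i < d" for i
    unfolding P_def by (rule dd_cone_common[OF cone(1)[OF that] cone(2)[OF that]]) blast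
  then obtain \<A> a b where P: "\<And>i. i < d \<Longrightarrow> P i (\<A> i) (a i) (b i)"
    by metis
  have 1: "\<And>i. i < d \<Longrightarrow> finite (\<A> i)"
    "\<And>i A. i < d \<Longrightarrow> A \<in> \<A> i \<Longrightarrow> finite A \<and> card A = n i + 1 \<and> A \<subseteq> I i \<and> 0 \<le> a i A \<and> 0 \<le> b i A"
    "\<And>i s. i < d \<Longrightarrow> v i s = (\<Sum>A\<in>\<A> i. a i A * dd_weight A s)"
    "\<And>i s. i < d \<Longrightarrow> w i s - v i s = (\<Sum>A\<in>\<A> i. b i A * dd_weight A s)"
    using P unfolding P_def by blast+
  have w: "w i s = (\<Sum>A\<in>\<A> i. (a i A + b i A) * dd_weight A s)" if "i < d" for i s
    using 1(3,4)[OF that, of s] by (simp add: sum.distrib distrib_right)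
  \<comment> \<open>Members of the families may have nodes outside \<open>S\<close> that cancel only
    in the sum, so both sides are moved to node sets containing all of them before
    expanding.\<close>
  define T where "T i = S i \<union> \<Union> (\<A> i)" for i
  have T: "finite (T i)" if "i < d" for i using 1 S that by (auto simp: T_def)
  have pos: "tensor {..<d} T (\<lambda>i. dd_weight (B i)) f \<ge> 0" if B: "B \<in> Pi\<^sub>E {..<d} \<A>" for B
  proof -
    have "tensor {..<d} T (\<lambda>i. dd_weight (B i)) f = dd_tensor d B f"
      by (rule tensor_superset) (use B T in \<open>auto simp: T_def dd_weight_def\<close>)
    moreover have "dd_tensor d B f \<ge> 0"
      by (rule conv[unfolded box_convex_iff_dd_tensor, rule_format])
        (use B 1 in \<open>auto simp: PiE_def Pi_def\<close>)
    ultimately show ?thesis by simp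
  qed
  have "tensor {..<d} S v f = tensor {..<d} T v f"
    by (rule tensor_superset[symmetric]) (use S T in \<open>auto simp: T_def\<close>)
  also have "\<dots> = (\<Sum>B\<in>Pi\<^sub>E {..<d} \<A>. (\<Prod>i<d. a i (B i)) * tensor {..<d} T (\<lambda>i. dd_weight (B i)) f)"
    by (rule tensor_expand) (use 1 in auto)
  also have "\<dots> \<le> (\<Sum>B\<in>Pi\<^sub>E {..<d} \<A>. (\<Prod>i<d. a i (B i) + b i (B i)) * tensor {..<d} T (\<lambda>i. dd_weight (B i)) f)"
    by (intro sum_mono mult_right_mono prod_mono pos) (use 1(2) in \<open>auto simp: PiE_def Pi_def\<close>)
  also have "\<dots> = tensor {..<d} T w f"
    by (rule tensor_expand[symmetric]) (use 1 w in auto)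
  also have "\<dots> = tensor {..<d} S w f"
    by (rule tensor_superset) (use S T in \<open>auto simp: T_def\<close>)
  finally show ?thesis .
qed

text \<open>Nodes are moved to the right one at a time. Moving l to r adds r - l times a divided
  difference with n + 1 nodes, which is in the cone. \<open>C\<close> collects the nodes already
  moved.\<close>

lemma dd_cone_shift_aux:
  assumes "finite L" "finite R" "finite C" "card L = card R" "card C + card L = n"
    and "C \<inter> (L \<union> R) = {}" "C \<union> L \<union> R \<subseteq> I" "\<And>l r. l \<in> L \<Longrightarrow> r \<in> R \<Longrightarrow> l < r"
  shows "dd_cone n I (\<lambda>s. dd_weight (C \<union> R) s - dd_weight (C \<union> L) s)"
  using assms
proof (induction L arbitrary: R C rule: finite_induct)
  case empty
  then show ?case by simp
next
  case (insert l L)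
  then have "R \<noteq> {}" by auto
  then obtain r R' where R: "R = insert r R'" "r \<notin> R'" by (meson ex_in_conv Set.set_insert)
  have lr: "l < r" "\<And>x. x \<in> L \<Longrightarrow> x < r" "\<And>x. x \<in> R' \<Longrightarrow> l < x" using insert.prems R by auto
  have notin: "r \<notin> L" "l \<notin> R'" "r \<noteq> l" "r \<notin> C" "l \<notin> C" using lr insert.prems R by auto
  have fin: "finite L" "finite C" "finite R'" using insert R by auto
  have cone1: "dd_cone n I (\<lambda>s. dd_weight (insert r C \<union> R') s - dd_weight (insert r C \<union> L) s)"
    by (rule insert.IH) (use insert.prems insert.hyps R notin in auto)
  have card: "card (insert r (insert l (C \<union> L))) = n + 1"
  proof -
    have "card (C \<union> L) = card C + card L" using insert.prems insert.hyps by (intro card_Un_disjoint) auto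
    then show ?thesis using insert notin fin by simp
  qed
  have cone2: "dd_cone n I (\<lambda>s. (r - l) * dd_weight (insert r (insert l (C \<union> L))) s)"
    by (rule dd_cone_dd_weight) (use insert.prems(1-6) R lr(1) card fin in auto)
  have "(\<lambda>s. dd_weight (C \<union> R) s - dd_weight (C \<union> insert l L) s) =
      (\<lambda>s. (dd_weight (insert r C \<union> R') s - dd_weight (insert r C \<union> L) s) +
           (r - l) * dd_weight (insert r (insert l (C \<union> L))) s)"
  proof
    fix s
    have "dd_weight (insert r (C \<union> L)) s - dd_weight (insert l (C \<union> L)) s =
      (r - l) * dd_weight (insert r (insert l (C \<union> L))) s"
      by (rule dd_weight_recurrence) (use notin insert.hyps fin in auto)
    then show "dd_weight (C \<union> R) s - dd_weight (C \<union> insert l L) s =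
      (dd_weight (insert r C \<union> R') s - dd_weight (insert r C \<union> L) s) +
           (r - l) * dd_weight (insert r (insert l (C \<union> L))) s"
      by (simp add: R)
  qed
  then show ?case using dd_cone_add[OF cone1 cone2] by simp
qed

lemma dd_cone_shift:
  assumes "finite L" "finite R" "card L = n" "card R = n" "L \<union> R \<subseteq> I"
    "\<And>l r. l \<in> L \<Longrightarrow> r \<in> R \<Longrightarrow> l < r"
  shows "dd_cone n I (\<lambda>s. dd_weight R s - dd_weight L s)"
  using dd_cone_shift_aux[of L R "{}" n I] assms by auto

text \<open>The tensor product of these weights over all directions sums the masses of all windows
  with indices in the product of the sets \<open>V\<close>.\<close>

definition mass_weight :: "nat \<Rightarrow> real \<Rightarrow> int set \<Rightarrow> real \<Rightarrow> real" where
  "mass_weight n h V s = (\<Sum>j\<in>V. fact n * h * dd_weight (grid_nodes n h j) s)"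

lemma mass_weight_telescope:
  assumes "h > 0" "n \<ge> 1" "j0 \<le> j1"
  shows "mass_weight n h {j0..<j1} s =
    fact (n - 1) * (dd_weight (grid_nodes (n - 1) h j1) s - dd_weight (grid_nodes (n - 1) h j0) s)"
  using assms(3)
proof (induction j1 rule: int_ge_induct)
  case (step i)
  have "{j0..<i + 1} = insert i {j0..<i}" using step by auto
  moreover have "dd_weight (grid_nodes (n - 1) h (i + 1)) s - dd_weight (grid_nodes (n - 1) h i) s =
      real n * h * dd_weight (grid_nodes n h i) s"
    using dd_grid_telescope[OF assms(1,2), of i "\<lambda>x. if x = s then 1 else 0"] by (simp add: dd_indicator)
  moreover have "fact n = fact (n - 1) * real n" using assms by (simp add: fact_reduce)
  ultimately show ?case using step
    by (simp add: mass_weight_def algebra_simps)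
qed (simp add: mass_weight_def)

text \<open>\<open>V\<close> lists the grid points in [a, b]. The sum over \<open>V\<close>
  telescopes to order n - 1 at two end windows. Replacing the last one by a fixed \<open>R\<close>
  further right and the first one by a fixed \<open>L\<close> further left only increases it in the
  cone order, which leaves a bound free of h.\<close>

lemma mass_weight_dominated:
  fixes I :: "real set"
  assumes I: "open I" "is_interval I" and n: "n \<ge> 1" and ab: "a \<in> I" "b \<in> I" "a \<le> b"
  obtains L R h0 where "finite L" "finite R" "h0 > 0"
    "\<And>h V. 0 < h \<Longrightarrow> h < h0 \<Longrightarrow> V = {\<lceil>a / h\<rceil>..<\<lfloor>b / h\<rfloor> + 1} \<Longrightarrow>
       (\<forall>j\<in>V. grid_nodes n h j \<subseteq> I) \<and> dd_cone n I (mass_weight n h V) \<and>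
       dd_cone n I (\<lambda>s. fact (n - 1) * (dd_weight R s - dd_weight L s) - mass_weight n h V s)"
proof -
  obtain e where e: "e > 0" "ball a e \<subseteq> I" using I ab open_contains_ball by blast
  obtain e' where e': "e' > 0" "ball b e' \<subseteq> I" using I ab open_contains_ball by blast
  have iv: "x \<in> I" if "y \<in> I" "z \<in> I" "y \<le> x" "x \<le> z" for x y z
    using I(2) that mem_is_interval_1_I by blast
  obtain L where L: "finite L" "card L = n" "L \<subseteq> {a - e <..< a}"
    using infinite_arbitrarily_large[of "{a - e<..<a}" n] e by (auto simp: infinite_Ioo)
  obtain R where R: "finite R" "card R = n" "R \<subseteq> {b + e'/2 <..< b + e'}"
    using infinite_arbitrarily_large[of "{b + e'/2 <..< b + e'}" n] e' by (auto simp: infinite_Ioo)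
  have LI: "L \<subseteq> I" "R \<subseteq> I" using e e' L R by (force simp: dist_real_def subset_iff)+
  \<comment> \<open>The last window starts at most at b + h and extends at most n steps; (n + 1) h <
    e' / 2 keeps it inside \<open>I\<close> and to the left of \<open>R\<close>.\<close>
  define h0 where "h0 = e' / (2 * real (n + 1))"
  show ?thesis
  proof (rule that[of L R h0])
    fix h V assume h: "0 < h" "h < h0" and V: "V = {\<lceil>a / h\<rceil>..<\<lfloor>b / h\<rfloor> + 1}"
    define j0 where "j0 = \<lceil>a / h\<rceil>"
    define j1 where "j1 = \<lfloor>b / h\<rfloor> + 1"
    have nh: "real (n + 1) * h < e' / 2"
      using h(2) by (simp add: h0_def field_simps)
    have "a / h \<le> b / h" using ab h by (simp add: divide_right_mono)
    then have j01: "j0 \<le> j1" unfolding j0_def j1_def by linarith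
    have "a / h \<le> of_int j0" unfolding j0_def by linarith
    then have aj: "a \<le> h * of_int j0" using h by (simp add: field_simps)
    have "b / h < of_int j1" unfolding j1_def by linarith
    then have bj: "b < h * of_int j1" using h by (simp add: field_simps)
    have "of_int j1 \<le> b / h + 1" unfolding j1_def by linarith
    then have bj': "h * of_int j1 \<le> b + h" using h by (simp add: field_simps)
    have up: "h * of_int (j + int l) < b + e'/2" if "j \<le> j1" "l \<le> n" for j l
    proof -
      have "h * of_int (j + int l) \<le> h * of_int (j1 + int n)"
        using that h by (intro mult_left_mono) auto
      also have "\<dots> = h * of_int j1 + real n * h" by (simp add: algebra_simps)
      also have "\<dots> \<le> b + real (n + 1) * h" using bj' by (simp add: algebra_simps)
      finally show ?thesis using nh by linarith
    qed
    have lo: "a \<le> h * of_int (j + int l)" if "j0 \<le> j" for j l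
    proof -
      have "h * of_int j0 \<le> h * of_int (j + int l)" using that h by (intro mult_left_mono) auto
      then show ?thesis using aj by linarith
    qed
    have be: "b + e'/2 \<in> I" using e' by (auto simp: dist_real_def subset_iff)
    have inI: "h * of_int (j + int l) \<in> I" if "j0 \<le> j" "j \<le> j1" "l \<le> n" for j l
      using iv[OF ab(1) be lo[OF that(1), of l]] up[OF that(2,3)] by simp
    have VI: "grid_nodes n h j \<subseteq> I" if "j \<in> V" for j
      using that inI unfolding V j0_def[symmetric] j1_def[symmetric] by (auto simp: grid_nodes_def)
    have c0: "dd_cone n I (mass_weight n h V)"
      unfolding mass_weight_def[abs_def]
      by (intro dd_cone_sum dd_cone_dd_weight) (use VI h card_grid_nodes in \<open>auto simp: V\<close>)
    have GI: "grid_nodes (n - 1) h j \<subseteq> I" if "j = j0 \<or> j = j1" for j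
      using that inI[of j] j01 by (auto simp: grid_nodes_def)
    have GR: "x < r" if "x \<in> grid_nodes (n - 1) h j1" "r \<in> R" for x r
    proof -
      obtain l where "l \<le> n - 1" "x = h * of_int (j1 + int l)"
        using \<open>x \<in> grid_nodes (n - 1) h j1\<close> by (auto simp: grid_nodes_def)
      then show ?thesis using up[of j1 l] that R by fastforce
    qed
    have GL: "l < x" if "x \<in> grid_nodes (n - 1) h j0" "l \<in> L" for x l
    proof -
      obtain k where "x = h * of_int (j0 + int k)"
        using \<open>x \<in> grid_nodes (n - 1) h j0\<close> by (auto simp: grid_nodes_def)
      then show ?thesis using lo[of j0 k] that L by fastforce
    qed
    have c1: "dd_cone n I (\<lambda>s. dd_weight R s - dd_weight (grid_nodes (n - 1) h j1) s)"
      by (rule dd_cone_shift) (use R LI GI[of j1] GR h n card_grid_nodes in auto)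
    have c2: "dd_cone n I (\<lambda>s. dd_weight (grid_nodes (n - 1) h j0) s - dd_weight L s)"
      by (rule dd_cone_shift) (use L LI GI[of j0] GL h n card_grid_nodes in auto)
    obtain \<A> c where A: "finite \<A>" "\<forall>A\<in>\<A>. finite A \<and> card A = n + 1 \<and> A \<subseteq> I \<and> 0 \<le> c A"
      "\<forall>s. dd_weight R s - dd_weight (grid_nodes (n - 1) h j1) s + (dd_weight (grid_nodes (n - 1) h j0) s - dd_weight L s)
         = (\<Sum>A\<in>\<A>. c A * dd_weight A s)"
      using dd_cone_add[OF c1 c2] by (auto simp: dd_cone_def)
    have "fact (n - 1) * (dd_weight R s - dd_weight L s) - mass_weight n h V s =
       (\<Sum>A\<in>\<A>. (fact (n - 1) * c A) * dd_weight A s)" for s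
    proof -
      have "fact (n - 1) * (dd_weight R s - dd_weight L s) - mass_weight n h V s = fact (n - 1) *
       (dd_weight R s - dd_weight (grid_nodes (n - 1) h j1) s + (dd_weight (grid_nodes (n - 1) h j0) s - dd_weight L s))"
        unfolding V j0_def[symmetric] j1_def[symmetric] mass_weight_telescope[OF h(1) n j01]
        by (simp add: algebra_simps)
      then show ?thesis unfolding A(3)[rule_format] by (simp add: sum_distrib_left mult.assoc)
    qed
    then have c3: "dd_cone n I (\<lambda>s. fact (n - 1) * (dd_weight R s - dd_weight L s) - mass_weight n h V s)"
      unfolding dd_cone_def using A(1,2) by (intro exI[of _ \<A>] exI[of _ "\<lambda>A. fact (n - 1) * c A"]) auto
    show "(\<forall>j\<in>V. grid_nodes n h j \<subseteq> I) \<and> dd_cone n I (mass_weight n h V) \<and>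
       dd_cone n I (\<lambda>s. fact (n - 1) * (dd_weight R s - dd_weight L s) - mass_weight n h V s)"
      using VI c0 c3 by blast
  qed (use L R e' in \<open>auto simp: h0_def\<close>)
qed

section \<open>A curve filling the box\<close>

lemma continuous_on_suminf_Weierstrass:
  fixes f :: "nat \<Rightarrow> 'a::topological_space \<Rightarrow> real"
  assumes "\<And>k. continuous_on A (f k)" "\<And>k x. x \<in> A \<Longrightarrow> \<bar>f k x\<bar> \<le> M k" "summable M"
  shows "continuous_on A (\<lambda>x. \<Sum>k. f k x)"
proof (rule uniform_limit_theorem)
  show "uniform_limit A (\<lambda>n x. \<Sum>i<n. f i x) (\<lambda>x. \<Sum>k. f k x) sequentially"
    by (rule Weierstrass_m_test) (use assms in auto)
  show "\<forall>\<^sub>F n in sequentially. continuous_on A (\<lambda>x. \<Sum>i<n. f i x)"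
    using assms by (intro always_eventually allI continuous_on_sum) auto
qed simp

lemma binary_expansion:
  fixes v :: real
  assumes "0 \<le> v" "v \<le> 1"
  obtains b :: "nat \<Rightarrow> nat" where "\<And>k. b k \<le> 1" "(\<lambda>k. real (b k) * (1/2) ^ Suc k) sums v"
proof -
  \<comment> \<open>\<open>rem k\<close> is 2 ^ k times the part of v that the first k digits leave
    over.\<close>
  define rem where "rem = rec_nat v (\<lambda>_ x. 2 * x - (if x \<ge> 1/2 then 1 else 0))"
  have rem: "rem 0 = v" "rem (Suc k) = 2 * rem k - (if rem k \<ge> 1/2 then 1 else 0)" for k
    by (simp_all add: rem_def)
  define b :: "nat \<Rightarrow> nat" where "b k = (if rem k \<ge> 1/2 then 1 else 0)" for k
  have bounds: "0 \<le> rem k \<and> rem k \<le> 1" for k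
    by (induction k) (use assms in \<open>auto simp: rem\<close>)
  have part: "(\<Sum>k<m. real (b k) * (1/2) ^ Suc k) = v - rem m * (1/2) ^ m" for m
    by (induction m) (auto simp: rem b_def algebra_simps)
  have "(\<lambda>m. rem m * (1/2) ^ m) \<longlonglongrightarrow> 0"
  proof (rule Lim_null_comparison)
    show "\<forall>\<^sub>F m in sequentially. norm (rem m * (1/2) ^ m) \<le> (1/2) ^ m"
      using bounds by (intro always_eventually allI) (auto simp: abs_mult mult_left_le_one_le)
    show "(\<lambda>m. (1/2 :: real) ^ m) \<longlonglongrightarrow> 0" by (rule LIMSEQ_realpow_zero) auto
  qed
  then have "(\<lambda>m. v - rem m * (1/2) ^ m) \<longlonglongrightarrow> v - 0" by (intro tendsto_intros)
  then have "(\<lambda>k. real (b k) * (1/2) ^ Suc k) sums v" by (simp only: sums_def part diff_0_right)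
  then show ?thesis by (intro that[of b]) (auto simp: b_def)
qed

text \<open>Schoenberg's space-filling curve. The function \<open>zigzag\<close> is even, has period 2, vanishes on
  \<open>[0, 1/3]\<close> and equals 1 on \<open>[2/3, 1]\<close>, so that \<open>zigzag (3 ^ j * t)\<close> reads off the \<open>j\<close>-th ternary
  digit of a point \<open>t\<close> of the Cantor set.\<close>

definition zigzag :: "real \<Rightarrow> real" where
  "zigzag t = max 0 (min 1 (3 * arccos (cos (pi * t)) / pi - 1))"

lemma continuous_on_zigzag [continuous_intros]:
  assumes "continuous_on A g"
  shows "continuous_on A (\<lambda>t. zigzag (g t))"
proof -
  have "continuous_on UNIV (\<lambda>t::real. cos (pi * t))"
    by (intro continuous_on_cos continuous_on_mult continuous_on_const continuous_on_id)
  then have "continuous_on UNIV zigzag"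
    unfolding zigzag_def[abs_def]
    by (intro continuous_on_max continuous_on_min continuous_on_diff continuous_on_divide
        continuous_on_mult continuous_on_const continuous_on_arccos) auto
  then show ?thesis by (rule continuous_on_compose2) (use assms in auto)
qed

lemma zigzag_bounds: "0 \<le> zigzag t" "zigzag t \<le> 1"
  by (auto simp: zigzag_def)

lemma zigzag_period:
  assumes "0 \<le> \<tau>" "\<tau> \<le> 1"
  shows "zigzag (2 * real N + \<tau>) = max 0 (min 1 (3 * \<tau> - 1))"
proof -
  have "cos (pi * (2 * real N + \<tau>)) = cos (pi * \<tau>)"
    using cos_int_2pin[of "int N"] sin_int_2pin[of "int N"]
    by (simp add: distrib_left cos_add mult_ac)
  moreover have "arccos (cos (pi * \<tau>)) = pi * \<tau>"
    by (rule arccos_cos) (use assms in auto)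
  ultimately show ?thesis by (simp add: zigzag_def)
qed

text \<open>Coordinate i takes its binary digits from the ternary positions congruent to i modulo
  d.\<close>

definition schoenberg :: "nat \<Rightarrow> nat \<Rightarrow> real \<Rightarrow> real" where
  "schoenberg d i t = (\<Sum>k. zigzag (3 ^ (d * k + i) * t) * (1/2) ^ Suc k)"

lemma summable_half_powers: "summable (\<lambda>k. (1/2 :: real) ^ Suc k)"
  using power_half_series sums_summable by blast

lemma continuous_on_schoenberg [continuous_intros]:
  assumes "continuous_on A g"
  shows "continuous_on A (\<lambda>t. schoenberg d i (g t))"
  unfolding schoenberg_def
proof (rule continuous_on_suminf_Weierstrass[OF _ _ summable_half_powers])
  show "continuous_on A (\<lambda>t. zigzag (3 ^ (d * k + i) * g t) * (1/2) ^ Suc k)" for k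
    by (intro continuous_intros assms)
  show "\<bar>zigzag (3 ^ (d * k + i) * g t) * (1/2) ^ Suc k\<bar> \<le> (1/2) ^ Suc k" for k t
    using zigzag_bounds[of "3 ^ (d * k + i) * g t"] by (simp add: abs_mult mult_left_le_one_le)
qed

text \<open>t has the ternary digits 2 * a j. In 3 ^ m * t the digits before position m give an even
  integer, digit m gives 0 or 2/3, and the rest is at most 1/3, so \<open>zigzag\<close> is
  evaluated on one of its plateaus. Even shifts of t change nothing; through them the curve runs
  over the cube again and again.\<close>

lemma ternary_digits:
  fixes a :: "nat \<Rightarrow> nat"
  assumes a: "\<And>j. a j \<le> 1"
  obtains t where "0 \<le> t" "t \<le> 1" "\<And>j r. zigzag (3 ^ j * (t + 2 * real r)) = real (a j)"
proof -
  define c where "c j = 2 * real (a j) * (1/3) ^ Suc j" for j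
  have geo: "(\<lambda>j. 2 * (1/3 :: real) ^ Suc j) sums 1"
    using sums_mult[OF geometric_sums[of "1/3 :: real"], of "2/3"] by simp
  have c_le: "0 \<le> c j" "c j \<le> 2 * (1/3) ^ Suc j" for j
    using a[of j] by (auto simp: c_def)
  have smc: "summable c"
    by (rule summable_comparison_test'[OF sums_summable[OF geo], of 0]) (use c_le in auto)
  define t where "t = (\<Sum>j. c j)"
  have t0: "0 \<le> t" unfolding t_def by (rule suminf_nonneg[OF smc c_le(1)])
  have "t \<le> (\<Sum>j. 2 * (1/3) ^ Suc j)"
    unfolding t_def by (rule suminf_le[OF c_le(2) smc sums_summable[OF geo]])
  then have t1: "t \<le> 1" by (simp only: sums_unique[OF geo, symmetric])
  have "zigzag (3 ^ m * (t + 2 * real r)) = real (a m)" for m r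
  proof -
    define tl where "tl = (\<Sum>j. c (j + Suc m))"
    have smt: "summable (\<lambda>j. c (j + Suc m))" using smc by (subst summable_iff_shift)
    have geo': "(\<lambda>j. 2 * (1/3 :: real) ^ Suc j * (1/3) ^ Suc m) sums (1 * (1/3) ^ Suc m)"
      by (rule sums_mult2[OF geo])
    have "tl \<le> (\<Sum>j. 2 * (1/3 :: real) ^ Suc j * (1/3) ^ Suc m)"
      unfolding tl_def
    proof (rule suminf_le[OF _ smt sums_summable[OF geo']])
      show "c (j + Suc m) \<le> 2 * (1/3) ^ Suc j * (1/3) ^ Suc m" for j
        using c_le(2)[of "j + Suc m"] by (simp add: power_add mult_ac)
    qed
    then have tl1: "tl \<le> (1/3) ^ Suc m" using sums_unique[OF geo'] by simp
    have tl0: "0 \<le> tl" unfolding tl_def by (rule suminf_nonneg[OF smt c_le(1)])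
    have split: "t = tl + (\<Sum>j<m. c j) + c m"
      unfolding t_def tl_def using suminf_split_initial_segment[OF smc, of "Suc m"] by simp
    define N where "N = (\<Sum>j<m. a j * 3 ^ (m - Suc j))"
    have "3 ^ m * (\<Sum>j<m. c j) = 2 * real N"
      unfolding N_def of_nat_sum sum_distrib_left
    proof (rule sum.cong[OF refl])
      fix j assume "j \<in> {..<m}"
      then have "m = (m - Suc j) + Suc j" by simp
      then have "(3::real) ^ m = 3 ^ (m - Suc j) * 3 ^ Suc j" by (metis power_add)
      then show "3 ^ m * c j = 2 * real (a j * 3 ^ (m - Suc j))"
        by (simp add: c_def power_one_over field_simps)
    qed
    moreover have "3 ^ m * c m = 2 * real (a m) / 3" by (simp add: c_def power_one_over)
    ultimately have eq: "3 ^ m * (t + 2 * real r) =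
        2 * real (N + 3 ^ m * r) + (2 * real (a m) / 3 + 3 ^ m * tl)"
      by (simp add: split distrib_left)
    have t3: "0 \<le> 3 ^ m * tl" "3 ^ m * tl \<le> 1/3"
    proof -
      have "3 ^ m * tl \<le> 3 ^ m * (1/3) ^ Suc m" using tl1 by (intro mult_left_mono) auto
      also have "\<dots> = 1/3" by (simp add: power_one_over)
      finally show "3 ^ m * tl \<le> 1/3" .
    qed (use tl0 in auto)
    have am: "a m = 0 \<or> a m = 1" using a[of m] by auto
    have "zigzag (3 ^ m * (t + 2 * real r)) = max 0 (min 1 (3 * (2 * real (a m) / 3 + 3 ^ m * tl) - 1))"
      unfolding eq by (rule zigzag_period) (use am t3 in auto)
    then show ?thesis using am t3 by auto
  qed
  then show ?thesis using t0 t1 by (intro that[of t])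
qed

lemma schoenberg_surj:
  assumes "d \<ge> 1" "\<And>i. i < d \<Longrightarrow> 0 \<le> v i \<and> v i \<le> 1"
  obtains t where "0 \<le> t" "t \<le> 1" "\<And>i r. i < d \<Longrightarrow> schoenberg d i (t + 2 * real r) = v i"
proof -
  have "\<exists>b :: nat \<Rightarrow> nat. (\<forall>k. b k \<le> 1) \<and> (\<lambda>k. real (b k) * (1/2) ^ Suc k) sums v i" if "i < d" for i
    using binary_expansion[of "v i"] assms(2)[OF that] by metis
  then obtain b :: "nat \<Rightarrow> nat \<Rightarrow> nat" where b: "\<And>i k. i < d \<Longrightarrow> b i k \<le> 1"
    "\<And>i. i < d \<Longrightarrow> (\<lambda>k. real (b i k) * (1/2) ^ Suc k) sums v i"
    by metis
  obtain t where t: "0 \<le> t" "t \<le> 1"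
    "\<And>j r. zigzag (3 ^ j * (t + 2 * real r)) = real (b (j mod d) (j div d))"
    using ternary_digits[of "\<lambda>j. b (j mod d) (j div d)"] b(1) assms(1) by auto
  have "schoenberg d i (t + 2 * real r) = v i" if "i < d" for i r
    unfolding schoenberg_def t(3) using sums_unique[OF b(2)[OF that]] that by simp
  then show ?thesis using t by (intro that[of t])
qed

section \<open>From the unit cube to a product of open intervals\<close>

lemma open_interval_homeomorphic_UNIV:
  fixes I :: "real set"
  assumes "open I" "is_interval I" "I \<noteq> {}"
  shows "\<exists>\<eta> \<xi>. homeomorphism (UNIV :: real set) I \<eta> \<xi>"
proof -
  obtain a b where "I = UNIV \<or> I = {..<b} \<or> I = {..b} \<or> I = {a<..} \<or> I = {a..} \<or>
    I = {a<..<b} \<or> I = {a<..b} \<or> I = {a..<b} \<or> I = {a..b}"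
    using is_real_interval[OF assms(2)] assms(3) by blast
  moreover have "interior I = I" using assms(1) by (simp add: interior_open)
  ultimately have "I = UNIV \<or> I = {..<b} \<or> I = {a<..} \<or> I = {a<..<b}"
    by (elim disjE) simp_all
  then consider "I = UNIV" | "I = {..<b}" | "I = {a<..}" | "I = {a<..<b}" by blast
  then show ?thesis
  proof cases
    case 1
    show ?thesis unfolding 1 by (intro exI, rule homeomorphism_ident)
  next
    case 2
    have "homeomorphism (UNIV :: real set) I (\<lambda>s. b - exp s) (\<lambda>x. ln (b - x))"
      unfolding 2
      by (rule homeomorphismI) (auto intro!: continuous_intros)
    then show ?thesis by blast
  next
    case 3
    have "homeomorphism (UNIV :: real set) I (\<lambda>s. a + exp s) (\<lambda>x. ln (x - a))"
      unfolding 3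
      by (rule homeomorphismI) (auto intro!: continuous_intros)
    then show ?thesis by blast
  next
    case 4
    then have "a < b" using assms(3) by auto
    then show ?thesis
      using homeomorphic_open_interval_UNIV[of a b] unfolding 4
      by (metis homeomorphic_def homeomorphic_sym)
  qed
qed

lemma compact_PiE_lessThan:
  fixes S :: "nat \<Rightarrow> 'a::topological_space set"
  assumes "\<And>i. i < d \<Longrightarrow> compact (S i)"
  shows "compact (Pi\<^sub>E {..<d} S)"
proof -
  define S' where "S' i = (if i < d then S i else {undefined})" for i
  have eq: "Pi\<^sub>E {..<d} S = Pi\<^sub>E UNIV S'"
  proof (intro set_eqI iffI)
    fix y assume y: "y \<in> Pi\<^sub>E {..<d} S"
    show "y \<in> Pi\<^sub>E UNIV S'"
    proof (rule PiE_I)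
      show "y i \<in> S' i" for i using y by (cases "i < d") (auto simp: S'_def)
    qed simp
  next
    fix y assume y: "y \<in> Pi\<^sub>E UNIV S'"
    have "y i \<in> S' i" for i using y by blast
    then show "y \<in> Pi\<^sub>E {..<d} S"
      by (intro PiE_I) (metis S'_def lessThan_iff, metis S'_def lessThan_iff singletonD)
  qed
  have "compactin (product_topology (\<lambda>_. euclidean) UNIV) (Pi\<^sub>E UNIV S')"
    unfolding compactin_PiE using assms by (auto simp: S'_def)
  then show ?thesis by (simp add: eq euclidean_product_topology)
qed

text \<open>Schoenberg's curve covers the unit cube during every interval [2 r, 2 r + 1]. Its
  coordinates are rescaled to [-1, 1], clipped away from the ends, stretched to the line by v / (1 -
  |v|) and mapped to \<open>I i\<close>. The clip loosens as |t| grows, so that every compact box is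
  eventually covered although the curve stays inside the open box.\<close>

lemma box_curve:
  assumes d: "d \<ge> 1" and I: "\<And>i. i < d \<Longrightarrow> open (I i) \<and> is_interval (I i) \<and> I i \<noteq> {}"
  obtains \<Psi> :: "real \<Rightarrow> nat \<Rightarrow> real" and C :: "nat \<Rightarrow> nat \<Rightarrow> real set" and \<theta>
  where "continuous_on UNIV \<Psi>" "range \<Psi> \<subseteq> box_of d I"
    "\<And>r i. i < d \<Longrightarrow> compact (C r i) \<and> C r i \<subseteq> I i"
    "\<And>S. \<forall>i<d. compact (S i) \<and> S i \<subseteq> I i \<Longrightarrow> \<exists>r. \<forall>i<d. S i \<subseteq> C r i"
    "\<And>r. box_of d (C r) \<subseteq> \<Psi> ` {0..2 * real r + 3}"
    "\<And>r. continuous_on (box_of d I) (\<theta> r)" "\<And>r u. 0 \<le> \<theta> r u \<and> \<theta> r u \<le> (1::real)"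
    "\<And>r u. u \<in> box_of d I \<Longrightarrow> u \<notin> box_of d (C r) \<Longrightarrow> \<theta> r u = 0"
    "\<And>u. u \<in> box_of d I \<Longrightarrow> \<exists>r. \<theta> r u > 0"
proof -
  have "\<exists>\<eta> \<xi>. homeomorphism (UNIV :: real set) (I i) \<eta> \<xi>" if "i < d" for i
    using open_interval_homeomorphic_UNIV I[OF that] by blast
  then obtain \<eta> \<xi> where hom: "\<And>i. i < d \<Longrightarrow> homeomorphism (UNIV :: real set) (I i) (\<eta> i) (\<xi> i)" by metis
  have \<eta>: "continuous_on UNIV (\<eta> i)" "range (\<eta> i) = I i" if "i < d" for i
    using hom[OF that] by (auto simp: homeomorphism_def)
  have \<xi>: "continuous_on (I i) (\<xi> i)" "\<And>x. x \<in> I i \<Longrightarrow> \<eta> i (\<xi> i x) = x" "\<And>y. \<xi> i (\<eta> i y) = y" if "i < d" for i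
    using hom[OF that] by (auto simp: homeomorphism_def)
  define clip where "clip t v = max (- (1 - 1 / (\<bar>t\<bar> + 2))) (min (1 - 1 / (\<bar>t\<bar> + 2)) v)" for t v :: real
  have clip_less: "\<bar>clip t v\<bar> < 1" for t v
  proof -
    have "\<bar>max (- (1 - q)) (min (1 - q) v)\<bar> < 1" if "0 < q" "q \<le> 1" for q :: real
      using that by (simp add: max_def min_def abs_less_iff)
    from this[of "1 / (\<bar>t\<bar> + 2)"] show ?thesis unfolding clip_def by simp
  qed
  define sq where "sq v = v / (1 - \<bar>v\<bar>)" for v :: real
  define \<Psi> where "\<Psi> t i = (if i < d then \<eta> i (sq (clip t (2 * schoenberg d i t - 1))) else undefined)" for t i
  define C where "C r i = \<eta> i ` {- real (Suc r)..real (Suc r)}" for r i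
  \<comment> \<open>Tents in the coordinates \<open>\<xi> i\<close>: they vanish off the box of
    \<open>C r\<close>, and at a given point they are positive once r is large.\<close>
  define \<theta> where "\<theta> r u = (\<Prod>i<d. max 0 (1 - \<bar>\<xi> i (u i)\<bar> / real (Suc r)))" for r u
  have cont_in: "continuous_on UNIV (\<lambda>t. sq (clip t (2 * schoenberg d i t - 1)))" for i
    unfolding sq_def
  proof (intro continuous_on_divide)
    show "continuous_on UNIV (\<lambda>t. clip t (2 * schoenberg d i t - 1))"
      unfolding clip_def by (intro continuous_intros) auto
    then show "continuous_on UNIV (\<lambda>t. 1 - \<bar>clip t (2 * schoenberg d i t - 1)\<bar>)"
      by (intro continuous_intros)
    show "\<forall>t\<in>UNIV. 1 - \<bar>clip t (2 * schoenberg d i t - 1)\<bar> \<noteq> 0"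
    proof
      fix t
      show "1 - \<bar>clip t (2 * schoenberg d i t - 1)\<bar> \<noteq> 0"
        using clip_less[of t "2 * schoenberg d i t - 1"] by linarith
    qed
  qed
  show ?thesis
  proof (rule that[of \<Psi> C \<theta>])
    show "continuous_on UNIV \<Psi>"
    proof (rule continuous_on_coordinatewise_then_product)
      fix i
      show "continuous_on UNIV (\<lambda>t. \<Psi> t i)"
      proof (cases "i < d")
        case True
        then show ?thesis
          using continuous_on_compose2[OF \<eta>(1)[OF True] cont_in[of i]] by (simp add: \<Psi>_def)
      qed (simp add: \<Psi>_def)
    qed
    have "\<eta> i x \<in> I i" if "i < d" for i x using \<eta>(2)[OF that] by blast
    then show "range \<Psi> \<subseteq> box_of d I" by (auto simp: \<Psi>_def PiE_def extensional_def)
    show "compact (C r i) \<and> C r i \<subseteq> I i" if "i < d" for r i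
    proof -
      have "continuous_on {- real (Suc r)..real (Suc r)} (\<eta> i)"
        using \<eta>(1)[OF that] continuous_on_subset by blast
      then show ?thesis using \<eta>(2)[OF that] by (auto simp: C_def intro: compact_continuous_image)
    qed
    show "\<exists>r. \<forall>i<d. S i \<subseteq> C r i" if "\<forall>i<d. compact (S i) \<and> S i \<subseteq> I i" for S
    proof -
      have S: "compact (S i) \<and> S i \<subseteq> I i" if "i < d" for i
        using \<open>\<forall>i<d. compact (S i) \<and> S i \<subseteq> I i\<close> that by blast
      have "\<exists>r. \<forall>x\<in>S i. \<bar>\<xi> i x\<bar> \<le> real r" if "i < d" for i
      proof -
        have "compact (\<xi> i ` S i)"
          using S[OF that] \<xi>(1)[OF that] compact_continuous_image continuous_on_subset by blast
        then obtain B where "\<forall>y\<in>\<xi> i ` S i. norm y \<le> B"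
          using compact_imp_bounded bounded_iff by metis
        moreover obtain r where "B \<le> real r" using real_arch_simple by blast
        ultimately show ?thesis by (intro exI[of _ r]) force
      qed
      then obtain \<rho> where \<rho>: "\<And>i x. i < d \<Longrightarrow> x \<in> S i \<Longrightarrow> \<bar>\<xi> i x\<bar> \<le> real (\<rho> i)" by metis
      define r where "r = Max (\<rho> ` {..<d})"
      have "S i \<subseteq> C r i" if "i < d" for i
      proof
        fix x assume x: "x \<in> S i"
        have "\<rho> i \<le> r" unfolding r_def using that by (intro Max_ge) auto
        then have "\<bar>\<xi> i x\<bar> \<le> real (Suc r)" using \<rho>[OF that x] by linarith
        then show "x \<in> C r i"
          unfolding C_def using \<xi>(2)[OF that, of x] S[OF that] x
          by (intro image_eqI[of _ _ "\<xi> i x"]) auto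
      qed
      then show ?thesis by blast
    qed
    show "box_of d (C r) \<subseteq> \<Psi> ` {0..2 * real r + 3}" for r
    proof
      fix u assume u: "u \<in> box_of d (C r)"
      have "\<exists>y. \<bar>y\<bar> \<le> real (Suc r) \<and> u i = \<eta> i y" if "i < d" for i
        using u that by (force simp: PiE_def Pi_def C_def)
      then obtain y where y: "\<And>i. i < d \<Longrightarrow> \<bar>y i\<bar> \<le> real (Suc r) \<and> u i = \<eta> i (y i)" by metis
      define w where "w i = y i / (1 + \<bar>y i\<bar>)" for i
      have w1: "\<bar>w i\<bar> = 1 - 1 / (1 + \<bar>y i\<bar>)" for i
        by (simp add: w_def field_simps)
      have sqw: "sq (w i) = y i" for i
        unfolding sq_def w1 by (simp add: w_def)
      have wb: "\<bar>w i\<bar> \<le> 1" for i unfolding w1 by simp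
      have wb': "0 \<le> (w i + 1) / 2 \<and> (w i + 1) / 2 \<le> 1" for i using wb[of i] by auto
      obtain t where t: "0 \<le> t" "t \<le> 1"
        "\<And>i s. i < d \<Longrightarrow> schoenberg d i (t + 2 * real s) = (w i + 1) / 2"
        using schoenberg_surj[OF d, of "\<lambda>i. (w i + 1) / 2"] wb' by auto
      \<comment> \<open>At such a late time the clip leaves all \<open>w i\<close> unchanged, since
        1 + |y i| \<le> r + 2 \<le> t' + 2.\<close>
      define t' where "t' = t + 2 * real (Suc r)"
      have "\<Psi> t' i = u i" for i
      proof (cases "i < d")
        case True
        have "\<bar>w i\<bar> \<le> 1 - 1 / (\<bar>t'\<bar> + 2)"
        proof -
          have "1 + \<bar>y i\<bar> \<le> \<bar>t'\<bar> + 2" using y[OF True] t(1) by (simp add: t'_def)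
          then have "1 / (\<bar>t'\<bar> + 2) \<le> 1 / (1 + \<bar>y i\<bar>)" by (intro divide_left_mono) auto
          then show ?thesis unfolding w1 by simp
        qed
        then have "clip t' (w i) = w i" unfolding clip_def by (auto simp: abs_le_iff)
        moreover have "2 * schoenberg d i t' - 1 = w i" unfolding t'_def t(3)[OF True] by (simp add: field_simps)
        ultimately show ?thesis using True y[OF True] by (simp add: \<Psi>_def sqw)
      next
        case False
        then show ?thesis using u by (simp add: \<Psi>_def PiE_def extensional_def)
      qed
      then have "u = \<Psi> t'" by auto
      moreover have "t' \<in> {0..2 * real r + 3}" using t by (simp add: t'_def)
      ultimately show "u \<in> \<Psi> ` {0..2 * real r + 3}" by blast
    qed
    show "continuous_on (box_of d I) (\<theta> r)" for r
      unfolding \<theta>_def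
    proof (intro continuous_on_prod continuous_on_max continuous_on_diff continuous_on_divide
        continuous_on_const continuous_on_rabs ballI)
      fix i assume "i \<in> {..<d}"
      then have i: "i < d" by simp
      show "continuous_on (box_of d I) (\<lambda>u. \<xi> i (u i))"
        by (rule continuous_on_compose2[OF \<xi>(1)[OF i]])
          (use i in \<open>auto intro: continuous_on_subset[OF continuous_on_product_coordinates]\<close>)
    qed simp
    show "0 \<le> \<theta> r u \<and> \<theta> r u \<le> 1" for r u
      unfolding \<theta>_def by (auto intro!: prod_nonneg prod_le_1)
    show "\<theta> r u = 0" if u: "u \<in> box_of d I" "u \<notin> box_of d (C r)" for r u
    proof -
      obtain i where i: "i < d" "u i \<notin> C r i" using u by (auto simp: PiE_iff)
      have "\<bar>\<xi> i (u i)\<bar> > real (Suc r)"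
      proof (rule ccontr)
        assume "\<not> ?thesis"
        moreover have "u i \<in> I i" using u i by auto
        ultimately have "u i \<in> C r i"
          unfolding C_def using \<xi>(2)[OF i(1), of "u i"] by (intro image_eqI[of _ _ "\<xi> i (u i)"]) auto
        then show False using i by simp
      qed
      then have "max 0 (1 - \<bar>\<xi> i (u i)\<bar> / real (Suc r)) = 0" by (simp add: field_simps)
      then show ?thesis unfolding \<theta>_def using i by (intro prod_zero) auto
    qed
    show "\<exists>r. \<theta> r u > 0" if "u \<in> box_of d I" for u
    proof -
      obtain r where r: "(\<Sum>i<d. \<bar>\<xi> i (u i)\<bar>) \<le> real r" using real_arch_simple by blast
      have "max 0 (1 - \<bar>\<xi> i (u i)\<bar> / real (Suc r)) > 0" if "i < d" for i
      proof -
        have "\<bar>\<xi> i (u i)\<bar> \<le> (\<Sum>i<d. \<bar>\<xi> i (u i)\<bar>)"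
          by (rule member_le_sum[of i "{..<d}" "\<lambda>i. \<bar>\<xi> i (u i)\<bar>"]) (use that in auto)
        then show ?thesis using r by (simp add: field_simps)
      qed
      then have "\<theta> r u > 0" unfolding \<theta>_def by (intro prod_pos) auto
      then show ?thesis by blast
    qed
  qed
qed

section \<open>Vague compactness\<close>

text \<open>The masses are transported to the real line along a section of the curve \<open>\<Psi>\<close>, where Helly's
  selection theorem applies. The weight \<open>\<rho>\<close> makes the transported masses tight, and the missing
  mass is placed at \<open>-1\<close>, where the function \<open>cut\<close> below vanishes.\<close>

lemma vague_compactness:
  fixes \<Psi> :: "real \<Rightarrow> 'a::t2_space" and m :: "nat \<Rightarrow> 'b \<Rightarrow> real" and C R :: "nat \<Rightarrow> real"
  assumes \<Psi>: "continuous_on UNIV \<Psi>" "range \<Psi> \<subseteq> B"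
    and K: "\<And>r. compact (K r)" "\<And>r. K r \<subseteq> B" "\<And>r. K r \<subseteq> \<Psi> ` {0..R r}" "mono R"
    and \<theta>: "\<And>r. continuous_on B (\<theta> r)" "\<And>r u. 0 \<le> \<theta> r u \<and> \<theta> r u \<le> (1::real)"
      "\<And>r u. u \<in> B \<Longrightarrow> u \<notin> K r \<Longrightarrow> \<theta> r u = 0" "\<And>u. u \<in> B \<Longrightarrow> \<exists>r. \<theta> r u > 0"
    and U: "\<And>k. finite (U k)" "\<And>k u. u \<in> U k \<Longrightarrow> pt k u \<in> B \<and> 0 \<le> m k u"
      "\<And>k r. (\<Sum>u\<in>{u\<in>U k. pt k u \<in> K r}. m k u) \<le> C r"
  obtains s :: "nat \<Rightarrow> nat" and \<mu> where "strict_mono s" "sets \<mu> = sets (restrict_space borel B)"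
    "\<And>L. compact L \<Longrightarrow> L \<subseteq> B \<Longrightarrow> emeasure \<mu> L < \<infinity>"
    "\<And>r \<psi>. continuous_on B \<psi> \<Longrightarrow> \<forall>u\<in>B - K r. \<psi> u = 0 \<Longrightarrow>
      (\<lambda>k. \<Sum>u\<in>U (s k). m (s k) u * \<psi> (pt (s k) u)) \<longlonglongrightarrow> (\<integral>u. \<psi> u \<partial>\<mu>)"
proof -
  have C0: "0 \<le> C r" for r
    using U(3)[of 0 r] sum_nonneg[of "{u\<in>U 0. pt 0 u \<in> K r}" "m 0"] U(2) by fastforce
  \<comment> \<open>The power of 1/2 makes the series for \<rho> converge uniformly. The denominator
    bounds the weighted mass of its r-th term by (1/2) ^ Suc r, so the total weighted mass is at
    most 1.\<close>
  define c where "c r = (1/2) ^ Suc r / (1 + C r)" for r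
  have c0: "0 < c r" for r using C0[of r] by (simp add: c_def)
  have c1: "c r \<le> (1/2) ^ Suc r" for r
    unfolding c_def using C0[of r] by (intro divide_left_mono[where b = 1, simplified]) (auto simp: field_simps)
  have cC: "c r * C r \<le> (1/2) ^ Suc r" for r
  proof -
    have "c r * C r = (1/2) ^ Suc r * (C r / (1 + C r))" by (simp add: c_def)
    also have "\<dots> \<le> (1/2) ^ Suc r * 1" using C0[of r] by (intro mult_left_mono) auto
    finally show ?thesis by simp
  qed
  have c\<theta>: "0 \<le> c r * \<theta> r u" "c r * \<theta> r u \<le> (1/2) ^ Suc r" for r u
    using c0[of r] \<theta>(2)[of r u] c1[of r]
    by (simp, metis (no_types, opaque_lifting) less_imp_le mult_left_le order_trans)
  have sm: "summable (\<lambda>r. c r * \<theta> r u)" for u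
    by (rule summable_comparison_test'[OF summable_half_powers, of 0]) (use c\<theta>[of _ u] in auto)
  define \<rho> where "\<rho> u = (\<Sum>r. c r * \<theta> r u)" for u
  have \<rho>cont: "continuous_on B \<rho>"
    unfolding \<rho>_def
    by (rule continuous_on_suminf_Weierstrass[OF _ _ summable_half_powers])
      (use c\<theta> in \<open>auto intro!: continuous_intros \<theta>(1)\<close>)
  have \<rho>pos: "\<rho> u > 0" if u: "u \<in> B" for u
  proof -
    obtain r where "\<theta> r u > 0" using \<theta>(4)[OF u] by blast
    then have "0 < c r * \<theta> r u" using c0 by simp
    then show ?thesis unfolding \<rho>_def using suminf_pos2[OF sm] c\<theta>(1) by blast
  qed
  \<comment> \<open>At points outside every \<open>K r\<close> with r < q the first q terms of
    \<rho> vanish, which leaves the tail of a geometric series.\<close>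
  have tail: "(\<Sum>u\<in>{u\<in>U k. \<forall>r<q. pt k u \<notin> K r}. m k u * \<rho> (pt k u)) \<le> (1/2) ^ q" for k q
  proof -
    define A where "A = {u\<in>U k. \<forall>r<q. pt k u \<notin> K r}"
    have finA: "finite A" "A \<subseteq> U k" using U(1) by (auto simp: A_def)
    define F where "F r = (\<Sum>u\<in>A. m k u * (c r * \<theta> r (pt k u)))" for r
    have smF: "summable F"
      unfolding F_def by (intro summable_sum summable_mult sm)
    have "(\<Sum>u\<in>A. m k u * \<rho> (pt k u)) = suminf F"
      unfolding F_def \<rho>_def
      by (subst suminf_sum) (auto intro!: summable_mult sm sum.cong suminf_mult[symmetric])
    also have "\<dots> = (\<Sum>r. F (r + q)) + (\<Sum>r<q. F r)"
      by (rule suminf_split_initial_segment[OF smF])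
    also have "(\<Sum>r<q. F r) = 0"
    proof (rule sum.neutral, rule ballI)
      fix r assume "r \<in> {..<q}"
      then show "F r = 0"
        unfolding F_def using U(2) by (intro sum.neutral) (auto simp: A_def \<theta>(3))
    qed
    also have "(\<Sum>r. F (r + q)) \<le> (\<Sum>r. (1/2) ^ Suc r * (1/2) ^ q)"
    proof (rule suminf_le)
      show "F (r + q) \<le> (1/2) ^ Suc r * (1/2) ^ q" for r
      proof -
        define t where "t = r + q"
        have "F t = (\<Sum>u\<in>{u\<in>A. pt k u \<in> K t}. m k u * (c t * \<theta> t (pt k u)))"
          unfolding F_def
        proof (rule sum.mono_neutral_right)
          show "\<forall>u\<in>A - {u \<in> A. pt k u \<in> K t}. m k u * (c t * \<theta> t (pt k u)) = 0"
          proof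
            fix u assume u: "u \<in> A - {u \<in> A. pt k u \<in> K t}"
            then have "pt k u \<in> B" using finA U(2) by blast
            then show "m k u * (c t * \<theta> t (pt k u)) = 0" using \<theta>(3) u by simp
          qed
        qed (use finA in auto)
        also have "\<dots> \<le> (\<Sum>u\<in>{u\<in>A. pt k u \<in> K t}. m k u * c t)"
          using finA U(2) c0[of t] \<theta>(2)
          by (intro sum_mono mult_left_mono) (auto simp: mult_left_le)
        also have "\<dots> \<le> (\<Sum>u\<in>{u\<in>U k. pt k u \<in> K t}. m k u * c t)"
          using finA U c0[of t] by (intro sum_mono2) (auto intro!: mult_nonneg_nonneg)
        also have "\<dots> \<le> C t * c t"
          unfolding sum_distrib_right[symmetric] using U(3)[of k t] c0[of t]
          by (intro mult_right_mono) auto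
        also have "\<dots> \<le> (1/2) ^ Suc t" using cC[of t] by (simp add: mult.commute)
        finally show ?thesis by (simp add: t_def power_add)
      qed
      show "summable (\<lambda>r. F (r + q))" using smF by (simp add: summable_iff_shift)
      show "summable (\<lambda>r. (1/2 :: real) ^ Suc r * (1/2) ^ q)"
        by (rule summable_mult2[OF summable_half_powers])
    qed
    also have "(\<Sum>r. (1/2 :: real) ^ Suc r * (1/2) ^ q) = (1/2) ^ q"
      using sums_unique[OF sums_mult2[OF power_half_series, of "(1/2) ^ q"]] by simp
    finally show ?thesis by (simp add: A_def)
  qed
  define N where "N k = (\<Sum>u\<in>U k. m k u * \<rho> (pt k u))" for k
  have N1: "N k \<le> 1" for k using tail[of k 0] by (simp add: N_def)
  define p where "p k x = (case x of None \<Rightarrow> 1 - N k | Some u \<Rightarrow> if u \<in> U k then m k u * \<rho> (pt k u) else 0)" for k x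
  have p0: "0 \<le> p k x" for k x
    using N1[of k] U(2) \<rho>pos by (auto simp: p_def less_imp_le split: option.split)
  have sum_p: "(\<Sum>x\<in>insert None (Some ` U k). g x * p k x) =
      (1 - N k) * g None + (\<Sum>u\<in>U k. m k u * \<rho> (pt k u) * g (Some u))" for g :: "'b option \<Rightarrow> real" and k
    using U(1) by (simp add: sum.reindex p_def mult.commute)
  have p1: "(\<integral>\<^sup>+x. p k x \<partial>count_space UNIV) = 1" for k
  proof -
    have "(\<integral>\<^sup>+x. p k x \<partial>count_space UNIV) = (\<Sum>x\<in>insert None (Some ` U k). ennreal (p k x))"
      by (rule nn_integral_count_space') (use U(1) in \<open>auto simp: p_def split: option.splits\<close>)
    also have "\<dots> = ennreal (\<Sum>x\<in>insert None (Some ` U k). 1 * p k x)"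
      using p0 by (simp only: sum_ennreal mult_1)
    also have "\<dots> = 1" unfolding sum_p by (simp add: N_def)
    finally show ?thesis .
  qed
  define P where "P k = embed_pmf (p k)" for k
  have pmfP: "pmf (P k) x = p k x" for k x
    unfolding P_def by (rule pmf_embed_pmf[OF p0 p1])
  \<comment> \<open>The parameter is taken from the first \<open>K r\<close> that contains u. Hence
    points of early \<open>K r\<close> have bounded parameters, and \<open>tail\<close> turns into
    tightness on the line.\<close>
  have "\<exists>t\<ge>0. \<Psi> t = u \<and> (\<forall>q. (\<exists>r<q. u \<in> K r) \<longrightarrow> t \<le> R q)" if u: "u \<in> B" for u
  proof -
    have ex: "\<exists>r. u \<in> K r" using \<theta>(3,4)[OF u] by (metis less_irrefl)
    define r0 where "r0 = (LEAST r. u \<in> K r)"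
    have "u \<in> K r0" unfolding r0_def using ex by (rule LeastI_ex)
    then have "u \<in> \<Psi> ` {0..R r0}" using K(3) by blast
    then obtain t where t: "0 \<le> t" "t \<le> R r0" "\<Psi> t = u" by auto
    have "t \<le> R q" if "r < q" "u \<in> K r" for q r
    proof -
      have "r0 \<le> q" using Least_le[of "\<lambda>r. u \<in> K r" r] that by (simp add: r0_def)
      then show ?thesis using t(2) monoD[OF K(4)] order_trans by blast
    qed
    then show ?thesis using t by blast
  qed
  then obtain \<tau> where \<tau>: "\<And>u. u \<in> B \<Longrightarrow> 0 \<le> \<tau> u \<and> \<Psi> (\<tau> u) = u"
    "\<And>u r q. u \<in> B \<Longrightarrow> r < q \<Longrightarrow> u \<in> K r \<Longrightarrow> \<tau> u \<le> R q"
    by metis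
  define loc where "loc k x = (case x of None \<Rightarrow> -1 | Some u \<Rightarrow> \<tau> (pt k u))" for k and x :: "'b option"
  define \<sigma> where "\<sigma> k = distr (measure_pmf (P k)) borel (loc k)" for k
  have \<sigma>rd: "real_distribution (\<sigma> k)" for k
    unfolding \<sigma>_def by (rule prob_space.real_distribution_distr) (auto intro: measure_pmf.prob_space_axioms)
  have \<sigma>int: "(\<integral>t. g t \<partial>\<sigma> k) = (1 - N k) * g (-1) + (\<Sum>u\<in>U k. m k u * \<rho> (pt k u) * g (\<tau> (pt k u)))"
    if [measurable]: "g \<in> borel_measurable borel" for g :: "real \<Rightarrow> real" and k
  proof -
    have "(\<integral>t. g t \<partial>\<sigma> k) = (\<integral>x. g (loc k x) \<partial>measure_pmf (P k))"
      unfolding \<sigma>_def by (rule integral_distr) auto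
    also have "\<dots> = (\<Sum>x\<in>insert None (Some ` U k). g (loc k x) * pmf (P k) x)"
      by (rule integral_measure_pmf_real)
        (use U(1) in \<open>auto simp: set_pmf_eq pmfP p_def split: option.splits if_splits\<close>)
    finally show ?thesis unfolding pmfP sum_p by (simp add: loc_def)
  qed
  have tight: "tight \<sigma>"
    unfolding tight_def
  proof (intro conjI allI impI \<sigma>rd)
    fix \<epsilon> :: real assume "\<epsilon> > 0"
    then obtain q where q: "(1/2) ^ q < \<epsilon>" using real_arch_pow_inv[of \<epsilon> "1/2"] by auto
    define S where "S = {-2<..max 0 (R q)}"
    have "1 - \<epsilon> < measure (\<sigma> k) S" for k
    proof -
      interpret real_distribution "\<sigma> k" by (rule \<sigma>rd)
      have "measure (\<sigma> k) S = (\<integral>t. indicator S t \<partial>\<sigma> k)" by (simp add: S_def)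
      also have "\<dots> = (1 - N k) + (\<Sum>u\<in>U k. m k u * \<rho> (pt k u) * indicator S (\<tau> (pt k u)))"
        by (subst \<sigma>int) (auto simp: S_def)
      also have "\<dots> = 1 - (\<Sum>u\<in>U k. m k u * \<rho> (pt k u) * (1 - indicator S (\<tau> (pt k u))))"
        by (simp add: N_def sum_subtractf right_diff_distrib)
      finally have eq: "measure (\<sigma> k) S =
          1 - (\<Sum>u\<in>U k. m k u * \<rho> (pt k u) * (1 - indicator S (\<tau> (pt k u))))" .
      have "(\<Sum>u\<in>U k. m k u * \<rho> (pt k u) * (1 - indicator S (\<tau> (pt k u)))) =
          (\<Sum>u\<in>{u\<in>U k. \<forall>r<q. pt k u \<notin> K r}. m k u * \<rho> (pt k u) * (1 - indicator S (\<tau> (pt k u))))"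
      proof (rule sum.mono_neutral_right)
        show "\<forall>u\<in>U k - {u\<in>U k. \<forall>r<q. pt k u \<notin> K r}. m k u * \<rho> (pt k u) * (1 - indicator S (\<tau> (pt k u))) = 0"
        proof
          fix u assume u: "u \<in> U k - {u\<in>U k. \<forall>r<q. pt k u \<notin> K r}"
          then have uB: "pt k u \<in> B" using U(2) by auto
          then have "\<tau> (pt k u) \<in> S"
            using u \<tau>(1)[OF uB] \<tau>(2)[OF uB] by (fastforce simp: S_def)
          then show "m k u * \<rho> (pt k u) * (1 - indicator S (\<tau> (pt k u))) = 0" by simp
        qed
      qed (use U in auto)
      also have "\<dots> \<le> (\<Sum>u\<in>{u\<in>U k. \<forall>r<q. pt k u \<notin> K r}. m k u * \<rho> (pt k u))"
        using U(2) \<rho>pos by (intro sum_mono mult_left_le) (auto simp: indicator_def less_imp_le)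
      also have "\<dots> \<le> (1/2) ^ q" by (rule tail)
      finally show ?thesis using q eq by linarith
    qed
    then show "\<exists>a b. a < b \<and> (\<forall>k. 1 - \<epsilon> < measure (\<sigma> k) {a<..b})"
      unfolding S_def by (intro exI[of _ "-2"] exI[of _ "max 0 (R q)"]) auto
  qed
  obtain s M where s: "strict_mono s" "real_distribution M" "weak_conv_m (\<sigma> \<circ> s) M"
    using tight_imp_convergent_subsubsequence[OF tight strict_mono_id] by auto
  interpret M: real_distribution M by (rule s(2))
  interpret \<sigma>: real_distribution "(\<sigma> \<circ> s) k" for k using \<sigma>rd by simp
  define cut where "cut t = max 0 (min 1 (t + 1))" for t :: real
  have cut: "0 \<le> cut t" "cut t \<le> 1" "cut (-1) = 0" "t \<ge> 0 \<Longrightarrow> cut t = 1" for t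
    by (auto simp: cut_def)
  have cutcont: "continuous_on UNIV cut"
    unfolding cut_def by (intro continuous_intros)
  have \<Psi>B: "\<Psi> t \<in> B" for t using \<Psi>(2) by auto
  have \<rho>\<Psi>: "continuous_on UNIV (\<lambda>t. \<rho> (\<Psi> t))"
    by (rule continuous_on_compose2[OF \<rho>cont \<Psi>])
  \<comment> \<open>This density undoes the weight \<rho>. The factor \<open>cut\<close> is
    continuous, removes the atom at -1 and is 1 at all parameters chosen by \<tau>, since these are
    nonnegative.\<close>
  define D where "D t = cut t / \<rho> (\<Psi> t)" for t
  have Dcont: "continuous_on UNIV D"
    unfolding D_def
  proof (rule continuous_on_divide[OF cutcont \<rho>\<Psi>])
    show "\<forall>t\<in>UNIV. \<rho> (\<Psi> t) \<noteq> 0" using \<rho>pos[OF \<Psi>B] by (auto simp: less_le)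
  qed
  have [measurable]: "D \<in> borel_measurable borel"
    by (rule borel_measurable_continuous_onI[OF Dcont])
  have D0: "0 \<le> D t" for t using cut(1)[of t] \<rho>pos[OF \<Psi>B, of t] by (simp add: D_def)
  have \<Psi>m [measurable]: "\<Psi> \<in> borel \<rightarrow>\<^sub>M restrict_space borel B"
    using \<Psi>(2) by (intro measurable_restrict_space2 borel_measurable_continuous_onI \<Psi>(1)) auto
  define \<mu> where "\<mu> = distr (density M D) (restrict_space borel B) \<Psi>"
  show ?thesis
  proof (rule that[of s \<mu>])
    show "strict_mono s" by (rule s(1))
    show "sets \<mu> = sets (restrict_space borel B)" by (simp add: \<mu>_def)
    show "emeasure \<mu> L < \<infinity>" if L: "compact L" "L \<subseteq> B" for L
    proof -
      have "\<exists>e>0. \<forall>u\<in>L. e \<le> \<rho> u"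
      proof (cases "L = {}")
        case True
        then show ?thesis by (intro exI[of _ 1]) auto
      next
        case False
        then obtain x where "x \<in> L" "\<forall>u\<in>L. \<rho> x \<le> \<rho> u"
          using continuous_attains_inf[OF L(1) False continuous_on_subset[OF \<rho>cont L(2)]] by blast
        then show ?thesis using \<rho>pos L(2) by (intro exI[of _ "\<rho> x"]) auto
      qed
      then obtain e where e: "e > 0" "\<And>u. u \<in> L \<Longrightarrow> e \<le> \<rho> u" by blast
      have LB: "L \<in> sets (restrict_space borel B)"
        using borel_compact[OF L(1)] L(2) by (auto simp: sets_restrict_space intro!: image_eqI[of _ _ L])
      have meas: "\<Psi> -` L \<in> sets borel"
        using measurable_sets[OF \<Psi>m LB] by simp
      have "emeasure \<mu> L = emeasure (density M D) (\<Psi> -` L)"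
        unfolding \<mu>_def using LB by (subst emeasure_distr) auto
      also have "\<dots> = (\<integral>\<^sup>+t. ennreal (D t) * indicator (\<Psi> -` L) t \<partial>M)"
        using meas by (subst emeasure_density) auto
      also have "\<dots> \<le> (\<integral>\<^sup>+t. ennreal (1 / e) \<partial>M)"
      proof (rule nn_integral_mono)
        fix t
        show "ennreal (D t) * indicator (\<Psi> -` L) t \<le> ennreal (1 / e)"
        proof (cases "\<Psi> t \<in> L")
          case True
          have "D t \<le> 1 / e"
            unfolding D_def using cut(1,2)[of t] e True by (intro frac_le) auto
          then show ?thesis using True by (simp add: ennreal_leI)
        qed simp
      qed
      also have "\<dots> = ennreal (1 / e)" using M.emeasure_space_1 by simp
      also have "\<dots> < \<infinity>" by simp
      finally show ?thesis .
    qed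
    show "(\<lambda>k. \<Sum>u\<in>U (s k). m (s k) u * \<psi> (pt (s k) u)) \<longlonglongrightarrow> (\<integral>u. \<psi> u \<partial>\<mu>)"
      if \<psi>: "continuous_on B \<psi>" "\<forall>u\<in>B - K r. \<psi> u = 0" for r \<psi>
    proof -
      have \<psi>m: "\<psi> \<in> borel_measurable (restrict_space borel B)"
        by (rule borel_measurable_continuous_on_restrict[OF \<psi>(1)])
      define g where "g t = D t * \<psi> (\<Psi> t)" for t
      have gcont: "continuous_on UNIV g"
        unfolding g_def by (intro continuous_on_mult Dcont continuous_on_compose2[OF \<psi>(1) \<Psi>])
      have "continuous_on (K r) (\<lambda>u. \<psi> u / \<rho> u)"
        using \<rho>pos K(2) by (intro continuous_on_divide continuous_on_subset[OF \<psi>(1)] continuous_on_subset[OF \<rho>cont])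
          (auto simp: less_le subset_iff)
      then have "compact ((\<lambda>u. \<psi> u / \<rho> u) ` K r)" using K(1) compact_continuous_image by blast
      then obtain b where "\<forall>y\<in>(\<lambda>u. \<psi> u / \<rho> u) ` K r. norm y \<le> b"
        using compact_imp_bounded bounded_iff by blast
      then have b: "\<And>u. u \<in> K r \<Longrightarrow> \<bar>\<psi> u / \<rho> u\<bar> \<le> b" by simp
      \<comment> \<open>\<psi> / \<rho> is bounded on the compact set \<open>K r\<close>, and off
        \<open>K r\<close> the function g vanishes; this accounts for the maximum with 0.\<close>
      have gb: "norm (g t) \<le> max 0 b" for t
      proof (cases "\<Psi> t \<in> K r")
        case True
        have "norm (g t) = cut t * \<bar>\<psi> (\<Psi> t) / \<rho> (\<Psi> t)\<bar>"
          using cut(1)[of t] by (simp add: g_def D_def abs_mult)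
        also have "\<dots> \<le> 1 * b" using cut(1,2)[of t] b[OF True] by (intro mult_mono) auto
        finally show ?thesis by simp
      qed (use \<psi>(2) \<Psi>B in \<open>simp add: g_def\<close>)
      have gm: "g \<in> borel_measurable borel" by (rule borel_measurable_continuous_onI[OF gcont])
      have "(\<lambda>k. \<integral>t. g t \<partial>(\<sigma> \<circ> s) k) \<longlonglongrightarrow> (\<integral>t. g t \<partial>M)"
      proof (rule weak_conv_imp_integral_bdd_continuous_conv[OF _ s(2,3) _ gb])
        show "real_distribution ((\<sigma> \<circ> s) k)" for k using \<sigma>rd by simp
        show "isCont g t" for t using gcont by (simp add: continuous_on_eq_continuous_at)
      qed
      moreover have "(\<integral>t. g t \<partial>(\<sigma> \<circ> s) k) = (\<Sum>u\<in>U (s k). m (s k) u * \<psi> (pt (s k) u))" for k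
      proof -
        have "(\<integral>t. g t \<partial>(\<sigma> \<circ> s) k) = (\<Sum>u\<in>U (s k). m (s k) u * \<rho> (pt (s k) u) * g (\<tau> (pt (s k) u)))"
          using \<sigma>int[OF gm, of "s k"] by (simp add: g_def D_def cut)
        also have "\<dots> = (\<Sum>u\<in>U (s k). m (s k) u * \<psi> (pt (s k) u))"
        proof (rule sum.cong[OF refl])
          fix u assume "u \<in> U (s k)"
          then have uB: "pt (s k) u \<in> B" using U(2) by auto
          then show "m (s k) u * \<rho> (pt (s k) u) * g (\<tau> (pt (s k) u)) = m (s k) u * \<psi> (pt (s k) u)"
            using \<tau>(1)[OF uB] \<rho>pos[OF uB] by (simp add: g_def D_def cut)
        qed
        finally show ?thesis .
      qed
      moreover have "(\<integral>u. \<psi> u \<partial>\<mu>) = (\<integral>t. g t \<partial>M)"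
      proof -
        have "(\<integral>u. \<psi> u \<partial>\<mu>) = (\<integral>t. \<psi> (\<Psi> t) \<partial>density M D)"
          unfolding \<mu>_def by (rule integral_distr) (use \<psi>m in auto)
        also have "\<dots> = (\<integral>t. D t *\<^sub>R \<psi> (\<Psi> t) \<partial>M)"
          using D0 measurable_compose[OF \<Psi>m \<psi>m] by (intro integral_density) auto
        finally show ?thesis by (simp add: g_def)
      qed
      ultimately show ?thesis by simp
    qed
  qed
qed

section \<open>Spline kernels and pseudo-polynomials\<close>

definition spline_kernel :: "real \<Rightarrow> nat \<Rightarrow> real \<Rightarrow> real \<Rightarrow> real" where
  "spline_kernel a n x u = (x - u) ^ (n - 1) / fact (n - 1) * chi_r a x u"

text \<open>The indicator of u \<le> x in \<open>chi_r\<close> yields the truncated power. The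
  indicator of u \<le> a does not depend on x, so it yields a polynomial of degree n - 1, which is
  annihilated. The base point thus disappears.\<close>

lemma dd_spline_kernel:
  assumes "finite S" "card S = n + 1" "n \<ge> 1"
  shows "dd S (\<lambda>x. spline_kernel a n x u) = dd S (tpow (n - 1) u) / fact (n - 1)"
proof -
  define c :: real where "c = 1 / fact (n - 1)"
  define e :: real where "e = (if u \<le> a then 1 else 0)"
  have "dd S (\<lambda>x. spline_kernel a n x u) = dd S (\<lambda>x. c * tpow (n - 1) u x - (c * e) * (x - u) ^ (n - 1))"
    by (intro dd_cong) (auto simp: spline_kernel_def chi_r_def tpow_def indicator_def c_def e_def)
  also have "\<dots> = c * dd S (tpow (n - 1) u) - (c * e) * dd S (\<lambda>x. (x - u) ^ (n - 1))"
    by (simp only: dd_diff dd_cmult)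
  also have "dd S (\<lambda>x. (x - u) ^ (n - 1)) = 0"
    using assms by (intro dd_shift_power) auto
  finally show ?thesis by (simp add: c_def)
qed

lemma spline_kernel_bound: "\<bar>spline_kernel a n x u\<bar> \<le> \<bar>x - a\<bar> ^ (n - 1)"
proof (cases "chi_r a x u = 0")
  case False
  then have "\<bar>x - u\<bar> \<le> \<bar>x - a\<bar>" "\<bar>chi_r a x u\<bar> \<le> 1"
    by (cases "u \<le> x"; cases "u \<le> a"; simp add: chi_r_def)+
  then have "\<bar>(x - u) ^ (n - 1)\<bar> * \<bar>chi_r a x u\<bar> \<le> \<bar>x - a\<bar> ^ (n - 1) * 1"
    unfolding power_abs by (intro mult_mono power_mono) auto
  moreover have "\<bar>spline_kernel a n x u\<bar> = \<bar>(x - u) ^ (n - 1)\<bar> * \<bar>chi_r a x u\<bar> / fact (n - 1)"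
    by (simp add: spline_kernel_def abs_mult)
  moreover have "\<bar>(x - u) ^ (n - 1)\<bar> * \<bar>chi_r a x u\<bar> / fact (n - 1) \<le> \<bar>(x - u) ^ (n - 1)\<bar> * \<bar>chi_r a x u\<bar> / 1"
    by (intro divide_left_mono) (auto simp: fact_ge_1)
  ultimately show ?thesis by simp
qed (simp add: spline_kernel_def)

lemma spline_kernel_support: "u \<notin> {min a x..max a x} \<Longrightarrow> spline_kernel a n x u = 0"
  by (auto simp: spline_kernel_def chi_r_def indicator_def)

lemma borel_measurable_spline_kernel [measurable]: "spline_kernel a n x \<in> borel_measurable borel"
  unfolding spline_kernel_def[abs_def] chi_r_def[abs_def] by measurable

lemma locally_finite_integrable:
  assumes \<mu>: "locally_finite_borel_measure_on B \<mu>" and K: "compact K" "K \<subseteq> B"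
    and g: "g \<in> borel_measurable \<mu>" "\<And>u. u \<in> B \<Longrightarrow> \<bar>g u\<bar> \<le> M" "\<And>u. u \<in> B \<Longrightarrow> u \<notin> K \<Longrightarrow> g u = (0::real)"
  shows "integrable \<mu> g"
proof -
  have sets: "sets \<mu> = sets (restrict_space borel B)" and fin: "emeasure \<mu> K < \<infinity>"
    using \<mu> K by (auto simp: locally_finite_borel_measure_on_def)
  have space: "space \<mu> = B" using sets_eq_imp_space_eq[OF sets] by (simp add: space_restrict_space)
  have Ks: "K \<in> sets \<mu>"
    unfolding sets using borel_compact[OF K(1)] K(2) by (auto simp: sets_restrict_space intro!: image_eqI[of _ _ K])
  have "integrable \<mu> (\<lambda>u. M * indicator K u)"
    using Ks fin by (intro integrable_mult_right integrable_real_indicator) auto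
  then show ?thesis
  proof (rule Bochner_Integration.integrable_bound[OF _ g(1)])
    show "AE u in \<mu>. norm (g u) \<le> norm (M * indicator K u)"
    proof (rule AE_I2)
      fix u assume "u \<in> space \<mu>"
      then show "norm (g u) \<le> norm (M * indicator K u)"
        using g(2)[of u] g(3)[of u] by (cases "u \<in> K") (auto simp: space)
    qed
  qed
qed

section \<open>The potential of a locally finite measure\<close>

context
  fixes d :: nat and I :: "nat \<Rightarrow> real set" and \<alpha> :: "nat \<Rightarrow> real" and n :: "nat \<Rightarrow> nat"
    and \<mu> :: "(nat \<Rightarrow> real) measure"
  assumes I: "\<And>i. i < d \<Longrightarrow> open (I i) \<and> is_interval (I i)"
    and \<alpha>: "\<alpha> \<in> box_of d I" and n: "\<And>i. i < d \<Longrightarrow> n i \<ge> 2"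
    and \<mu>: "locally_finite_borel_measure_on (box_of d I) \<mu>"
begin

abbreviation spline_potential :: "(nat \<Rightarrow> real) \<Rightarrow> real" where
  "spline_potential x \<equiv> \<integral>u. (\<Prod>j<d. spline_kernel (\<alpha> j) (n j) (x j) (u j)) \<partial>\<mu>"

text \<open>Each factor vanishes unless u j lies between \<alpha> j and x j. The product is bounded
  and supported in a compact box, where \<mu> is finite.\<close>

lemma integrable_spline_kernel_prod:
  assumes x: "\<And>i. i < d \<Longrightarrow> x i \<in> I i"
  shows "integrable \<mu> (\<lambda>u. \<Prod>j<d. spline_kernel (\<alpha> j) (n j) (x j) (u j))"
proof -
  define K where "K = box_of d (\<lambda>j. {min (\<alpha> j) (x j)..max (\<alpha> j) (x j)})"
  have ivl: "{min (\<alpha> j) (x j)..max (\<alpha> j) (x j)} \<subseteq> I j" if j: "j < d" for j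
  proof
    fix y assume y: "y \<in> {min (\<alpha> j) (x j)..max (\<alpha> j) (x j)}"
    have "\<alpha> j \<in> I j" "x j \<in> I j" "is_interval (I j)" using \<alpha> x j I by auto
    then show "y \<in> I j"
      using y mem_is_interval_1_I[of "I j" "\<alpha> j" "x j" y] mem_is_interval_1_I[of "I j" "x j" "\<alpha> j" y]
      by (cases "\<alpha> j \<le> x j") (auto simp: min_def max_def)
  qed
  show ?thesis
  proof (rule locally_finite_integrable[OF \<mu>])
    show "compact K" unfolding K_def by (rule compact_PiE_lessThan) simp
    show "K \<subseteq> box_of d I" unfolding K_def using ivl by (intro PiE_mono) auto
    have "(\<lambda>u. u j) \<in> borel_measurable \<mu>" for j
    proof -
      have "(\<lambda>u. u j) \<in> borel_measurable (restrict_space borel (box_of d I))"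
        by (intro measurable_restrict_space1 borel_measurable_continuous_onI) simp
      then show ?thesis
        using \<mu> measurable_cong_sets[of \<mu> "restrict_space borel (box_of d I)"]
        by (auto simp: locally_finite_borel_measure_on_def)
    qed
    then show "(\<lambda>u. \<Prod>j<d. spline_kernel (\<alpha> j) (n j) (x j) (u j)) \<in> borel_measurable \<mu>"
      by (intro borel_measurable_prod measurable_compose[OF _ borel_measurable_spline_kernel])
    show "\<bar>\<Prod>j<d. spline_kernel (\<alpha> j) (n j) (x j) (u j)\<bar> \<le> (\<Prod>j<d. \<bar>x j - \<alpha> j\<bar> ^ (n j - 1))" for u
      unfolding abs_prod by (intro prod_mono conjI spline_kernel_bound abs_ge_zero)
    show "(\<Prod>j<d. spline_kernel (\<alpha> j) (n j) (x j) (u j)) = 0" if u: "u \<in> box_of d I" "u \<notin> K" for u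
    proof -
      obtain j where "j < d" "u j \<notin> {min (\<alpha> j) (x j)..max (\<alpha> j) (x j)}"
        using u by (auto simp: K_def PiE_iff)
      then show ?thesis using spline_kernel_support by (intro prod_zero bexI[of _ j]) simp_all
    qed
  qed
qed

lemma tensor_spline_potential:
  assumes S: "\<And>i. i < d \<Longrightarrow> finite (S i) \<and> S i \<subseteq> I i"
  shows "tensor {..<d} S w spline_potential =
    (\<integral>u. (\<Prod>j<d. \<Sum>s\<in>S j. w j s * spline_kernel (\<alpha> j) (n j) s (u j)) \<partial>\<mu>)"
proof -
  have int: "integrable \<mu> (\<lambda>u. \<Prod>j<d. spline_kernel (\<alpha> j) (n j) (y j) (u j))"
    if "y \<in> Pi\<^sub>E {..<d} S" for y
    using that S by (intro integrable_spline_kernel_prod) (auto simp: PiE_def Pi_def)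
  have "tensor {..<d} S w spline_potential =
      (\<Sum>y\<in>Pi\<^sub>E {..<d} S. \<integral>u. (\<Prod>j<d. w j (y j)) * (\<Prod>j<d. spline_kernel (\<alpha> j) (n j) (y j) (u j)) \<partial>\<mu>)"
    by (simp add: tensor_def)
  also have "\<dots> = (\<integral>u. (\<Sum>y\<in>Pi\<^sub>E {..<d} S. (\<Prod>j<d. w j (y j)) * (\<Prod>j<d. spline_kernel (\<alpha> j) (n j) (y j) (u j))) \<partial>\<mu>)"
    by (rule Bochner_Integration.integral_sum[symmetric]) (use int in auto)
  also have "\<dots> = (\<integral>u. (\<Prod>j<d. \<Sum>s\<in>S j. w j s * spline_kernel (\<alpha> j) (n j) s (u j)) \<partial>\<mu>)"
  proof (rule Bochner_Integration.integral_cong[OF refl])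
    fix u
    show "(\<Sum>y\<in>Pi\<^sub>E {..<d} S. (\<Prod>j<d. w j (y j)) * (\<Prod>j<d. spline_kernel (\<alpha> j) (n j) (y j) (u j))) =
      (\<Prod>j<d. \<Sum>s\<in>S j. w j s * spline_kernel (\<alpha> j) (n j) s (u j))"
      using tensor_prod[of "{..<d}" S w "\<lambda>j s. spline_kernel (\<alpha> j) (n j) s (u j)"] S
      by (simp add: tensor_def)
  qed
  finally show ?thesis .
qed

lemma dd_tensor_spline_potential:
  assumes S: "\<And>i. i < d \<Longrightarrow> finite (S i) \<and> card (S i) = n i + 1 \<and> S i \<subseteq> I i"
  shows "dd_tensor d S spline_potential =
    (\<integral>u. (\<Prod>j<d. dd (S j) (tpow (n j - 1) (u j)) / fact (n j - 1)) \<partial>\<mu>)"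
proof -
  have "dd_tensor d S spline_potential =
      (\<integral>u. (\<Prod>j<d. dd (S j) (\<lambda>s. spline_kernel (\<alpha> j) (n j) s (u j))) \<partial>\<mu>)"
    unfolding dd_def using S by (intro tensor_spline_potential) auto
  also have "\<dots> = (\<integral>u. (\<Prod>j<d. dd (S j) (tpow (n j - 1) (u j)) / fact (n j - 1)) \<partial>\<mu>)"
  proof (intro Bochner_Integration.integral_cong prod.cong refl)
    fix u :: "nat \<Rightarrow> real" and j assume "j \<in> {..<d}"
    then show "dd (S j) (\<lambda>s. spline_kernel (\<alpha> j) (n j) s (u j)) =
        dd (S j) (tpow (n j - 1) (u j)) / fact (n j - 1)"
      using S n[of j] by (intro dd_spline_kernel) auto
  qed
  finally show ?thesis .
qed

lemma box_convex_spline_potential: "box_convex d I n spline_potential"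
  unfolding box_convex_iff_dd_tensor
proof (intro allI impI)
  fix S assume S: "\<forall>i<d. finite (S i) \<and> card (S i) = n i + 1 \<and> S i \<subseteq> I i"
  have "dd (S j) (tpow (n j - 1) u) \<ge> 0" if "j < d" for j u
    using S n[OF that] that by (intro dd_tpow_nonneg) auto
  then have "0 \<le> (\<integral>u. (\<Prod>j<d. dd (S j) (tpow (n j - 1) (u j)) / fact (n j - 1)) \<partial>\<mu>)"
    by (intro Bochner_Integration.integral_nonneg prod_nonneg divide_nonneg_nonneg) auto
  also have "\<dots> = dd_tensor d S spline_potential"
    by (rule dd_tensor_spline_potential[symmetric]) (use S in blast)
  finally show "dd_tensor d S spline_potential \<ge> 0" .
qed

end

text \<open>A summand with the power x i ^ k is annihilated in direction i alone, whatever its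
  coefficient function is.\<close>

lemma dd_tensor_pseudo_polynomial:
  assumes W: "pseudo_polynomial d I (\<lambda>i. n i - 1) W" and n: "\<And>i. i < d \<Longrightarrow> n i \<ge> 1"
    and S: "\<And>i. i < d \<Longrightarrow> finite (S i) \<and> card (S i) = n i + 1 \<and> S i \<subseteq> I i"
  shows "dd_tensor d S W = 0"
proof -
  obtain A :: "nat \<Rightarrow> nat \<Rightarrow> (nat \<Rightarrow> real) \<Rightarrow> real" where A: "\<And>x. x \<in> box_of d I \<Longrightarrow>
      W x = (\<Sum>i<d. \<Sum>k\<le>n i - 1. A i k (restrict x ({..<d} - {i})) * x i ^ k)"
    using W[unfolded pseudo_polynomial_def] by (elim exE) (rule that, erule bspec)
  have sub: "Pi\<^sub>E {..<d} S \<subseteq> box_of d I" using S by (intro PiE_mono) auto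
  have "dd_tensor d S W =
      dd_tensor d S (\<lambda>x. \<Sum>i<d. \<Sum>k\<le>n i - 1. A i k (restrict x ({..<d} - {i})) * x i ^ k)"
    by (rule tensor_cong[OF refl refl A]) (use sub in blast)
  also have "\<dots> = (\<Sum>i<d. \<Sum>k\<le>n i - 1.
      dd_tensor d S (\<lambda>x. A i k (restrict x ({..<d} - {i})) * x i ^ k))"
    by (simp only: tensor_sum)
  also have "\<dots> = 0"
  proof (intro sum.neutral ballI)
    fix i k assume i: "i \<in> {..<d}" and k: "k \<in> {..n i - 1}"
    define c where "c = tensor ({..<d} - {i}) S (\<lambda>i. dd_weight (S i)) (\<lambda>y. A i k (restrict y ({..<d} - {i})))"
    have "dd_tensor d S (\<lambda>x. A i k (restrict x ({..<d} - {i})) * x i ^ k) = (\<Sum>s\<in>S i. dd_weight (S i) s * (c * s ^ k))"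
    proof (subst tensor_extract[of i], use i in simp, intro sum.cong refl arg_cong2[of _ _ _ _ "(*)"])
      fix s
      have "restrict (y(i := s)) ({..<d} - {i}) = restrict y ({..<d} - {i})" for y :: "nat \<Rightarrow> real"
        by auto
      then show "tensor ({..<d} - {i}) S (\<lambda>i. dd_weight (S i))
          (\<lambda>y. A i k (restrict (y(i := s)) ({..<d} - {i})) * (y(i := s)) i ^ k) = c * s ^ k"
        by (simp add: c_def tensor_def sum_distrib_right mult.assoc)
    qed
    also have "\<dots> = c * dd (S i) (\<lambda>s. s ^ k)" by (simp add: dd_def sum_distrib_left mult_ac)
    also have "dd (S i) (\<lambda>s. s ^ k) = 0" using S[of i] n[of i] i k by (intro dd_power) auto
    finally show "dd_tensor d S (\<lambda>x. A i k (restrict x ({..<d} - {i})) * x i ^ k) = 0"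
      by (simp only: mult_zero_right)
  qed
  finally show ?thesis .
qed

text \<open>The product over \<open>i < j\<close> of the operators \<open>Id - P\<^sub>i\<close>, where \<open>P\<^sub>i\<close> interpolates at \<open>T i\<close> in
  direction \<open>i\<close>.\<close>

primrec iter_remainder :: "nat \<Rightarrow> (nat \<Rightarrow> real set) \<Rightarrow> ((nat \<Rightarrow> real) \<Rightarrow> real) \<Rightarrow> (nat \<Rightarrow> real) \<Rightarrow> real" where
  "iter_remainder 0 T F x = F x"
| "iter_remainder (Suc j) T F x = iter_remainder j T F x -
     lagrange (T j) (\<lambda>t. iter_remainder j T F (x(j := t))) (x j)"

lemma lagrange_remainder:
  assumes "finite T" "x \<notin> T"
  shows "g x - lagrange T g x = (\<Prod>s\<in>T. x - s) * dd (insert x T) g"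
  using lagrange_insert[OF assms, of g x] lagrange_node[of "insert x T" x g] assms by simp

lemma iter_remainder_node:
  assumes "\<And>i. i < j \<Longrightarrow> finite (T i)" "i < j" "x i \<in> T i"
  shows "iter_remainder j T F x = 0"
  using assms
proof (induction j arbitrary: x)
  case (Suc j)
  show ?case
  proof (cases "i = j")
    case True
    then show ?thesis using Suc.prems by (simp add: lagrange_node)
  next
    case False
    have "iter_remainder j T F y = 0" if "y i \<in> T i" for y
      by (rule Suc.IH) (use Suc.prems False that in auto)
    then show ?thesis using False Suc.prems(3) by (simp add: lagrange_def)
  qed
qed simp

text \<open>The interpolation error in one variable, nodal polynomial times divided difference, is
  applied in one direction after another. Coordinates from j on stay frozen at x.\<close>

lemma iter_remainder_eq_dd_tensor:
  assumes "\<And>i. i < j \<Longrightarrow> finite (T i) \<and> x i \<notin> T i"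
  shows "iter_remainder j T F x = (\<Prod>i<j. \<Prod>s\<in>T i. x i - s) *
    dd_tensor j (\<lambda>i. insert (x i) (T i)) (\<lambda>y. F (\<lambda>i. if i < j then y i else x i))"
  using assms
proof (induction j arbitrary: x)
  case (Suc j)
  define p where "p = (\<Prod>i<j. \<Prod>s\<in>T i. x i - s)"
  define S where "S i = insert (x i) (T i)" for i
  have IH: "iter_remainder j T F (x(j := t)) =
      p * dd_tensor j S (\<lambda>y. F (\<lambda>i. if i < j then y i else (x(j := t)) i))" for t
  proof -
    have "iter_remainder j T F (x(j := t)) = (\<Prod>i<j. \<Prod>s\<in>T i. (x(j := t)) i - s) *
      dd_tensor j (\<lambda>i. insert ((x(j := t)) i) (T i)) (\<lambda>y. F (\<lambda>i. if i < j then y i else (x(j := t)) i))"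
      by (rule Suc.IH) (use Suc.prems in auto)
    also have "(\<Prod>i<j. \<Prod>s\<in>T i. (x(j := t)) i - s) = p"
      unfolding p_def by (intro prod.cong) auto
    also have "dd_tensor j (\<lambda>i. insert ((x(j := t)) i) (T i)) (\<lambda>y. F (\<lambda>i. if i < j then y i else (x(j := t)) i)) =
      dd_tensor j S (\<lambda>y. F (\<lambda>i. if i < j then y i else (x(j := t)) i))"
      by (rule tensor_cong) (auto simp: S_def)
    finally show ?thesis .
  qed
  have "iter_remainder (Suc j) T F x =
      (\<lambda>t. iter_remainder j T F (x(j := t))) (x j) -
      lagrange (T j) (\<lambda>t. iter_remainder j T F (x(j := t))) (x j)" by simp
  also have "\<dots> = (\<Prod>s\<in>T j. x j - s) * dd (S j) (\<lambda>t. iter_remainder j T F (x(j := t)))"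
    unfolding S_def by (rule lagrange_remainder) (use Suc.prems in auto)
  also have "dd (S j) (\<lambda>t. iter_remainder j T F (x(j := t))) =
      p * (\<Sum>s\<in>S j. dd_weight (S j) s * dd_tensor j S (\<lambda>y. F (\<lambda>i. if i < j then y i else (x(j := s)) i)))"
    unfolding IH by (simp add: dd_def sum_distrib_left mult_ac)
  also have "(\<Sum>s\<in>S j. dd_weight (S j) s * dd_tensor j S (\<lambda>y. F (\<lambda>i. if i < j then y i else (x(j := s)) i))) =
      dd_tensor (Suc j) S (\<lambda>y. F (\<lambda>i. if i < Suc j then y i else x i))"
    unfolding lessThan_Suc
  proof (subst tensor_insert, simp, simp, intro sum.cong refl arg_cong2[of _ _ _ _ "(*)"] tensor_cong arg_cong[of _ _ F] ext)
    show "(if i < j then y i else (x(j := s)) i) = (if i < Suc j then (y(j := s)) i else x i)" for y s i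
      by auto
  qed
  finally show ?case by (simp add: p_def S_def[abs_def] mult_ac)
qed simp

text \<open>The numbers \<open>q t k\<close> depend neither on g nor on x, so interpolation in one
  direction yields powers whose coefficients are functions of the other variables.\<close>

lemma lagrange_eq_sum_powers:
  assumes "finite T"
  obtains q where "\<And>g x. lagrange T g x = (\<Sum>k\<le>card T - 1. (\<Sum>t\<in>T. g t * q t k) * x ^ k)"
proof -
  define Q where "Q t = smult (dd_weight T t) (\<Prod>s\<in>T - {t}. [:- s, 1:])" for t
  have Q: "(\<Sum>k\<le>card T - 1. coeff (Q t) k * x ^ k) = dd_weight T t * (\<Prod>s\<in>T - {t}. x - s)"
    if t: "t \<in> T" for t x
  proof -
    have "degree (\<Prod>s\<in>T - {t}. [:- s, 1:]) = card T - 1"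
      using assms t by (subst degree_prod_eq_sum_degree) (auto simp: card_Diff_singleton)
    then have "degree (Q t) \<le> card T - 1" unfolding Q_def using degree_smult_le by metis
    then have "(\<Sum>k\<le>card T - 1. coeff (Q t) k * x ^ k) = poly (Q t) x"
      unfolding poly_altdef by (intro sum.mono_neutral_right) (auto simp: coeff_eq_0)
    also have "\<dots> = dd_weight T t * (\<Prod>s\<in>T - {t}. x - s)" by (simp add: Q_def poly_prod)
    finally show ?thesis .
  qed
  have "lagrange T g x = (\<Sum>k\<le>card T - 1. (\<Sum>t\<in>T. g t * coeff (Q t) k) * x ^ k)" for g x
  proof -
    have "(\<Sum>k\<le>card T - 1. (\<Sum>t\<in>T. g t * coeff (Q t) k) * x ^ k) =
        (\<Sum>t\<in>T. g t * (\<Sum>k\<le>card T - 1. coeff (Q t) k * x ^ k))"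
      unfolding sum_distrib_left sum_distrib_right by (subst sum.swap) (simp add: mult.assoc)
    also have "\<dots> = lagrange T g x"
      unfolding lagrange_def by (intro sum.cong refl) (simp only: Q mult.assoc)
    finally show ?thesis ..
  qed
  then show ?thesis by (rule that)
qed

text \<open>Telescoping writes F as the final remainder plus, for each i, the interpolant in
  direction i of the i-th remainder. That interpolant is a polynomial of degree at most m i in x i,
  with coefficients free of x i.\<close>

lemma pseudo_polynomialI:
  assumes T: "\<And>i. i < d \<Longrightarrow> finite (T i) \<and> card (T i) = m i + 1"
    and zero: "\<And>x. x \<in> box_of d I \<Longrightarrow> iter_remainder d T F x = 0"
  shows "pseudo_polynomial d I m F"
proof -
  have "\<exists>q. \<forall>g x. lagrange (T i) g x = (\<Sum>k\<le>m i. (\<Sum>t\<in>T i. g t * q t k) * x ^ k)" if i: "i < d" for i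
  proof -
    obtain q where "\<And>g x. lagrange (T i) g x = (\<Sum>k\<le>card (T i) - 1. (\<Sum>t\<in>T i. g t * q t k) * x ^ k)"
      using lagrange_eq_sum_powers[of "T i"] T[OF i] by blast
    then show ?thesis using T[OF i] by auto
  qed
  then obtain q where q: "\<And>i g x. i < d \<Longrightarrow>
      lagrange (T i) g x = (\<Sum>k\<le>m i. (\<Sum>t\<in>T i. g t * q i t k) * x ^ k)" by metis
  define A where "A i k y = (\<Sum>t\<in>T i. iter_remainder i T F (y(i := t)) * q i t k)" for i k and y :: "nat \<Rightarrow> real"
  have tel: "F x = (\<Sum>i<j. lagrange (T i) (\<lambda>t. iter_remainder i T F (x(i := t))) (x i)) + iter_remainder j T F x" for j x
  proof (induction j)
    case (Suc j)
    then show ?case unfolding sum.lessThan_Suc iter_remainder.simps by linarith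
  qed simp
  have "F x = (\<Sum>i<d. \<Sum>k\<le>m i. A i k (restrict x ({..<d} - {i})) * x i ^ k)" if x: "x \<in> box_of d I" for x
  proof -
    have upd: "(restrict x ({..<d} - {i}))(i := t) = x(i := t)" for i t
      using x by (auto simp: fun_eq_iff PiE_def extensional_def)
    have "F x = (\<Sum>i<d. lagrange (T i) (\<lambda>t. iter_remainder i T F (x(i := t))) (x i))"
      using tel[of x d] zero[OF x] by simp
    then show ?thesis by (simp add: q A_def upd)
  qed
  then show ?thesis unfolding pseudo_polynomial_def by blast
qed

section \<open>From rational to real nodes\<close>

lemma continuous_on_dd_insert:
  assumes "finite T" "continuous_on X g"
  shows "continuous_on (X - T) (\<lambda>z. dd (insert z T) g)"
proof -
  have "continuous_on (X - T) (\<lambda>z. g z / (\<Prod>t\<in>T. z - t) + (\<Sum>s\<in>T. dd_weight T s * g s / (s - z)))"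
    using assms
    by (intro continuous_on_add continuous_on_divide continuous_on_sum continuous_on_prod
        continuous_on_diff continuous_on_const continuous_on_id continuous_on_subset[OF assms(2)]) auto
  then show ?thesis
    by (rule continuous_on_cong[THEN iffD1, rotated -1]) (use assms in \<open>auto simp: dd_insert\<close>)
qed

lemma continuous_zero_on_rationals:
  fixes g :: "real \<Rightarrow> real"
  assumes "open X" "continuous_on X g" "\<And>q. q \<in> X \<Longrightarrow> q \<in> \<rat> \<Longrightarrow> g q = 0" "z \<in> X"
  shows "g z = 0"
proof (rule ccontr)
  assume "g z \<noteq> 0"
  have "open (X \<inter> g -` (- {0}))" by (rule continuous_open_preimage[OF assms(2,1)]) auto
  moreover have "z \<in> X \<inter> g -` (- {0})" using assms(4) \<open>g z \<noteq> 0\<close> by simp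
  ultimately obtain e where e: "e > 0" "ball z e \<subseteq> X \<inter> g -` (- {0})"
    using open_contains_ball by blast
  obtain q where q: "q \<in> \<rat>" "z < q" "q < z + e" using Rats_dense_in_real[of z "z + e"] e by auto
  then have "q \<in> ball z e" by (simp add: dist_real_def)
  then have "q \<in> X \<inter> g -` (- {0})" using e(2) by blast
  then show False using assms(3)[of q] q by simp
qed

text \<open>Rationality is given up one coordinate at a time: after stage j the first j of them are
  arbitrary. Since only one coordinate moves per stage, continuity in each variable separately
  suffices.\<close>

lemma dd_tensor_eq_of_rational:
  assumes f: "box_convex d I n f" and g: "box_convex d I n g"
    and I: "\<And>i. i < d \<Longrightarrow> open (I i)" and n: "\<And>i. i < d \<Longrightarrow> n i \<ge> 2"
    and T: "\<And>i. i < d \<Longrightarrow> finite (T i) \<and> card (T i) = n i \<and> T i \<subseteq> I i"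
    and eq: "\<And>x. (\<And>i. i < d \<Longrightarrow> x i \<in> I i - T i \<and> x i \<in> \<rat>) \<Longrightarrow>
      dd_tensor d (\<lambda>i. insert (x i) (T i)) f = dd_tensor d (\<lambda>i. insert (x i) (T i)) g"
    and x: "\<And>i. i < d \<Longrightarrow> x i \<in> I i - T i"
  shows "dd_tensor d (\<lambda>i. insert (x i) (T i)) f = dd_tensor d (\<lambda>i. insert (x i) (T i)) g"
proof -
  have "\<forall>x. (\<forall>i<d. x i \<in> I i - T i \<and> (j \<le> i \<longrightarrow> x i \<in> \<rat>)) \<longrightarrow>
      dd_tensor d (\<lambda>i. insert (x i) (T i)) f = dd_tensor d (\<lambda>i. insert (x i) (T i)) g" if "j \<le> d" for j
    using that
  proof (induction j)
    case 0
    then show ?case using eq by auto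
  next
    case (Suc j)
    show ?case
    proof (intro allI impI)
      fix x assume x: "\<forall>i<d. x i \<in> I i - T i \<and> (Suc j \<le> i \<longrightarrow> x i \<in> \<rat>)"
      have j: "j < d" using Suc.prems by simp
      define S where "S i = insert (x i) (T i)" for i
      define \<Phi> where "\<Phi> F z = tensor ({..<d} - {j}) S (\<lambda>i. dd_weight (S i)) (\<lambda>y. F (y(j := z)))"
        for F :: "(nat \<Rightarrow> real) \<Rightarrow> real" and z
      have S: "finite (S i) \<and> card (S i) = n i + 1 \<and> S i \<subseteq> I i" if "i < d" for i
        using T[OF that] x that by (auto simp: S_def)
      have cont: "continuous_on (I j) (\<Phi> F)" if "box_convex d I n F" for F
        unfolding \<Phi>_def by (rule box_convex_section_continuous[OF that j]) (use I n j S in auto)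
      have dd\<Phi>: "dd_tensor d (\<lambda>i. insert ((x(j := z)) i) (T i)) F = dd (insert z (T j)) (\<Phi> F)" for z F
        unfolding tensor_extract[OF j] dd_def \<Phi>_def
        by (intro sum.cong arg_cong2[of _ _ _ _ "(*)"] tensor_cong) (auto simp: S_def)
      have "dd (insert (x j) (T j)) (\<lambda>z. \<Phi> f z - \<Phi> g z) = 0"
      proof (rule continuous_zero_on_rationals[where X = "I j - T j" and z = "x j" and
            g = "\<lambda>z. dd (insert z (T j)) (\<lambda>z. \<Phi> f z - \<Phi> g z)"])
        show "open (I j - T j)" using I[OF j] T[OF j] by (intro open_Diff finite_imp_closed) auto
        show "continuous_on (I j - T j) (\<lambda>z. dd (insert z (T j)) (\<lambda>z. \<Phi> f z - \<Phi> g z))"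
          using T[OF j] by (intro continuous_on_dd_insert continuous_on_diff cont f g) auto
        show "dd (insert q (T j)) (\<lambda>z. \<Phi> f z - \<Phi> g z) = 0" if "q \<in> I j - T j" "q \<in> \<rat>" for q
        proof -
          have "\<forall>i<d. (x(j := q)) i \<in> I i - T i \<and> (j \<le> i \<longrightarrow> (x(j := q)) i \<in> \<rat>)"
            using x that by (auto simp: Suc_le_eq le_less)
          then have "dd_tensor d (\<lambda>i. insert ((x(j := q)) i) (T i)) f =
              dd_tensor d (\<lambda>i. insert ((x(j := q)) i) (T i)) g"
            using Suc.IH[THEN spec, of "x(j := q)"] j by simp
          then show ?thesis unfolding dd\<Phi> dd_diff by simp
        qed
        show "x j \<in> I j - T j" using x j by auto
      qed
      then show "dd_tensor d (\<lambda>i. insert (x i) (T i)) f = dd_tensor d (\<lambda>i. insert (x i) (T i)) g"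
        using dd\<Phi>[of "x j" f] dd\<Phi>[of "x j" g] by (simp add: dd_diff)
    qed
  qed
  from this[of d] show ?thesis using x by auto
qed

section \<open>Discrete masses and the representing measure\<close>

text \<open>A denominator b divides k! as soon as k \<ge> b.\<close>

lemma rational_in_factorial_grid:
  fixes s :: real
  assumes "s \<in> \<rat>"
  shows "\<forall>\<^sub>F k in sequentially. s \<in> range (\<lambda>m. 1 / fact k * of_int m)"
proof -
  obtain a b :: int where ab: "s = of_int a / of_int b" "b > 0"
    using assms by (metis Rats_cases' of_int_0_less_iff)
  have "s \<in> range (\<lambda>m. 1 / fact k * of_int m)" if k: "k \<ge> nat b" for k
  proof -
    have "nat b dvd fact k" using ab k by (intro dvd_fact) auto
    then obtain c where c: "fact k = nat b * c" by (auto simp: dvd_def)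
    have "(fact k :: real) = real (fact k)" by simp
    also have "\<dots> = of_int b * of_int (int c)" unfolding c using ab by simp
    finally have fk: "(fact k :: real) = of_int b * of_int (int c)" .
    then have "of_int (int c) \<noteq> (0::real)" by (metis fact_nonzero mult_zero_right)
    then have "s = 1 / fact k * of_int (a * int c)" unfolding ab fk using ab by simp
    then show ?thesis by blast
  qed
  then show ?thesis unfolding eventually_sequentially by blast
qed

text \<open>Each direction contributes the factor \<open>fact n * h\<close> of
  \<open>discrete_taylor\<close>. The mass is attached to the point where the window starts, see
  \<open>grid_point\<close>.\<close>

definition mass :: "nat \<Rightarrow> (nat \<Rightarrow> nat) \<Rightarrow> ((nat \<Rightarrow> real) \<Rightarrow> real) \<Rightarrow> nat \<Rightarrow> (nat \<Rightarrow> int) \<Rightarrow> real" where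
  "mass d n f k J = (\<Prod>i<d. fact (n i) * (1 / fact k)) *
     dd_tensor d (\<lambda>i. grid_nodes (n i) (1 / fact k) (J i)) f"

text \<open>The first condition restricts to grid points in [-k, k] and makes the set finite; the
  second makes the masses nonnegative.\<close>

definition grid_indices :: "(nat \<Rightarrow> real set) \<Rightarrow> (nat \<Rightarrow> nat) \<Rightarrow> nat \<Rightarrow> nat \<Rightarrow> int set" where
  "grid_indices I n k i = {j. \<bar>j\<bar> \<le> int k * fact k \<and> grid_nodes (n i) (1 / fact k) j \<subseteq> I i}"

definition grid_point :: "nat \<Rightarrow> nat \<Rightarrow> (nat \<Rightarrow> int) \<Rightarrow> nat \<Rightarrow> real" where
  "grid_point d k J = (\<lambda>i\<in>{..<d}. 1 / fact k * of_int (J i))"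

lemma finite_grid_indices: "finite (grid_indices I n k i)"
  by (rule finite_subset[of _ "{- (int k * fact k)..int k * fact k}"]) (auto simp: grid_indices_def)

lemma node_in_grid_nodes: "h * of_int j \<in> grid_nodes n h j"
  unfolding grid_nodes_def by (rule image_eqI[of _ _ 0]) auto

lemma grid_point_in_box:
  assumes "J \<in> Pi\<^sub>E {..<d} (grid_indices I n k)"
  shows "grid_point d k J \<in> box_of d I"
proof -
  have "1 / fact k * of_int (J i) \<in> I i" if i: "i < d" for i
  proof -
    have "grid_nodes (n i) (1 / fact k) (J i) \<subseteq> I i"
      using assms i unfolding grid_indices_def by (simp add: PiE_iff)
    then show ?thesis using node_in_grid_nodes by blast
  qed
  then show ?thesis by (simp add: grid_point_def)
qed

lemma mass_nonneg:
  assumes "box_convex d I n f" "\<And>i. i < d \<Longrightarrow> grid_nodes (n i) (1 / fact k) (J i) \<subseteq> I i"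
  shows "0 \<le> mass d n f k J"
proof -
  have "0 \<le> dd_tensor d (\<lambda>i. grid_nodes (n i) (1 / fact k) (J i)) f"
    by (rule assms(1)[unfolded box_convex_iff_dd_tensor, rule_format])
      (use assms(2) in \<open>auto simp: card_grid_nodes\<close>)
  then show ?thesis unfolding mass_def by (intro mult_nonneg_nonneg prod_nonneg) auto
qed

text \<open>Used twice: coefficients c = 1 give total masses, and divided differences of discrete
  kernels give the multiple divided differences of \<open>f\<close>.\<close>

lemma sum_mass_mult:
  assumes "\<And>i. i < d \<Longrightarrow> finite (V i)" "\<And>i. i < d \<Longrightarrow> finite (S i)"
    "\<And>i j. i < d \<Longrightarrow> j \<in> V i \<Longrightarrow> grid_nodes (n i) (1 / fact k) j \<subseteq> S i"
    "\<And>i s. i < d \<Longrightarrow> s \<in> S i \<Longrightarrow>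
      w i s = (\<Sum>j\<in>V i. fact (n i) * (1 / fact k) * c i j * dd_weight (grid_nodes (n i) (1 / fact k) j) s)"
  shows "tensor {..<d} S w f = (\<Sum>J\<in>Pi\<^sub>E {..<d} V. mass d n f k J * (\<Prod>i<d. c i (J i)))"
proof -
  have "tensor {..<d} S w f = (\<Sum>J\<in>Pi\<^sub>E {..<d} V. (\<Prod>i<d. fact (n i) * (1 / fact k) * c i (J i)) *
      tensor {..<d} S (\<lambda>i. dd_weight (grid_nodes (n i) (1 / fact k) (J i))) f)"
    by (rule tensor_expand) (use assms in auto)
  also have "\<dots> = (\<Sum>J\<in>Pi\<^sub>E {..<d} V. mass d n f k J * (\<Prod>i<d. c i (J i)))"
  proof (rule sum.cong[OF refl])
    fix J assume J: "J \<in> Pi\<^sub>E {..<d} V"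
    have "tensor {..<d} S (\<lambda>i. dd_weight (grid_nodes (n i) (1 / fact k) (J i))) f =
        dd_tensor d (\<lambda>i. grid_nodes (n i) (1 / fact k) (J i)) f"
    proof (rule tensor_superset)
      show "finite (S i) \<and> grid_nodes (n i) (1 / fact k) (J i) \<subseteq> S i" if "i \<in> {..<d}" for i
        using assms(2,3)[of i] J that by (auto simp: PiE_iff)
      show "dd_weight (grid_nodes (n i) (1 / fact k) (J i)) s = 0"
        if "s \<in> S i - grid_nodes (n i) (1 / fact k) (J i)" for i s
        using that by (simp add: dd_weight_def)
    qed simp
    then show "(\<Prod>i<d. fact (n i) * (1 / fact k) * c i (J i)) *
      tensor {..<d} S (\<lambda>i. dd_weight (grid_nodes (n i) (1 / fact k) (J i))) f =
      mass d n f k J * (\<Prod>i<d. c i (J i))"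
      by (simp only: mass_def prod.distrib mult_ac)
  qed
  finally show ?thesis .
qed

lemma eventually_bounded_imp_bounded:
  fixes g :: "nat \<Rightarrow> real"
  assumes "\<forall>\<^sub>F k in sequentially. g k \<le> C"
  obtains C' where "\<And>k. g k \<le> C'"
proof -
  obtain k0 where k0: "\<And>k. k \<ge> k0 \<Longrightarrow> g k \<le> C" using assms by (auto simp: eventually_sequentially)
  have "g k \<le> \<bar>C\<bar> + (\<Sum>k<k0. \<bar>g k\<bar>)" for k
  proof (cases "k < k0")
    case True
    then have "\<bar>g k\<bar> \<le> (\<Sum>k<k0. \<bar>g k\<bar>)"
      by (intro member_le_sum[of k "{..<k0}" "\<lambda>k. \<bar>g k\<bar>"]) auto
    then show ?thesis by linarith
  next
    case False
    then have "g k \<le> C" by (intro k0) simp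
    moreover have "0 \<le> (\<Sum>k<k0. \<bar>g k\<bar>)" by (intro sum_nonneg) auto
    ultimately show ?thesis by linarith
  qed
  then show ?thesis by (rule that)
qed

lemma tendsto_inverse_fact: "(\<lambda>k. 1 / fact k :: real) \<longlonglongrightarrow> 0"
proof (rule tendsto_sandwich)
  show "\<forall>\<^sub>F k in sequentially. (0::real) \<le> 1 / fact k" by simp
  show "\<forall>\<^sub>F k in sequentially. 1 / fact k \<le> (1 / real k :: real)"
    using eventually_gt_at_top[of 0]
  proof eventually_elim
    case (elim k)
    have "real k \<le> real (fact k)" using fact_ge_self[of k] by (simp only: of_nat_le_iff)
    then have "real k \<le> fact k" by simp
    then show ?case using elim by (intro divide_left_mono) auto
  qed
  show "(\<lambda>k. 1 / real k) \<longlonglongrightarrow> 0" by (rule lim_1_over_n)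
qed auto

text \<open>In each direction the mass weight is dominated by \<open>D i\<close>, a difference of
  two divided differences of order n i - 1 with fixed nodes. Monotonicity of the tensor product then
  bounds the masses on all sufficiently fine grids by one constant; finitely many k remain.\<close>

lemma mass_bounded:
  assumes conv: "box_convex d I n f" and I: "\<And>i. i < d \<Longrightarrow> open (I i) \<and> is_interval (I i)"
    and n: "\<And>i. i < d \<Longrightarrow> n i \<ge> 1" and K: "\<And>i. i < d \<Longrightarrow> compact (K i) \<and> K i \<subseteq> I i"
  obtains C where "\<And>k. (\<Sum>J\<in>{J\<in>Pi\<^sub>E {..<d} (grid_indices I n k). grid_point d k J \<in> box_of d K}. mass d n f k J) \<le> C"
proof (cases "\<exists>i<d. K i = {}")
  case True
  then have "box_of d K = {}" by (auto simp: PiE_eq_empty_iff)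
  then show ?thesis by (intro that[of 0]) simp
next
  case False
  have "\<exists>a b. a \<in> K i \<and> b \<in> K i \<and> K i \<subseteq> {a..b}" if "i < d" for i
  proof -
    have "compact (K i)" "K i \<noteq> {}" using K[OF that] False that by auto
    then obtain a b where "a \<in> K i" "\<forall>x\<in>K i. a \<le> x" "b \<in> K i" "\<forall>x\<in>K i. x \<le> b"
      using compact_attains_inf[of "K i"] compact_attains_sup[of "K i"] by blast
    then show ?thesis by (intro exI[of _ a] exI[of _ b]) auto
  qed
  then obtain a b where ab: "\<And>i. i < d \<Longrightarrow> a i \<in> K i \<and> b i \<in> K i \<and> K i \<subseteq> {a i..b i}" by metis
  define Q where "Q i L R h0 \<longleftrightarrow> finite L \<and> finite R \<and> h0 > 0 \<and>
    (\<forall>h V. 0 < h \<longrightarrow> h < h0 \<longrightarrow> V = {\<lceil>a i / h\<rceil>..<\<lfloor>b i / h\<rfloor> + 1} \<longrightarrow>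
       (\<forall>j\<in>V. grid_nodes (n i) h j \<subseteq> I i) \<and> dd_cone (n i) (I i) (mass_weight (n i) h V) \<and>
       dd_cone (n i) (I i) (\<lambda>s. fact (n i - 1) * (dd_weight R s - dd_weight L s) - mass_weight (n i) h V s))"
    for i :: nat and L R :: "real set" and h0 :: real
  have "\<exists>L R h0. Q i L R h0" if i: "i < d" for i
  proof -
    have "open (I i)" "is_interval (I i)" "a i \<in> I i" "b i \<in> I i" "a i \<le> b i"
      using I[OF i] K[OF i] ab[OF i] by auto
    then obtain L R h0 where "finite L" "finite R" "h0 > 0"
      "\<And>h V. 0 < h \<Longrightarrow> h < h0 \<Longrightarrow> V = {\<lceil>a i / h\<rceil>..<\<lfloor>b i / h\<rfloor> + 1} \<Longrightarrow>
       (\<forall>j\<in>V. grid_nodes (n i) h j \<subseteq> I i) \<and> dd_cone (n i) (I i) (mass_weight (n i) h V) \<and>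
       dd_cone (n i) (I i) (\<lambda>s. fact (n i - 1) * (dd_weight R s - dd_weight L s) - mass_weight (n i) h V s)"
      using mass_weight_dominated[OF _ _ n[OF i]] by blast
    then have "Q i L R h0" unfolding Q_def by blast
    then show ?thesis by blast
  qed
  then obtain L R h0 where Q: "\<And>i. i < d \<Longrightarrow> Q i (L i) (R i) (h0 i)" by metis
  define D where "D i s = fact (n i - 1) * (dd_weight (R i) s - dd_weight (L i) s)" for i s
  define C where "C = tensor {..<d} (\<lambda>i. L i \<union> R i) D f"
  have "\<forall>\<^sub>F k in sequentially. \<forall>i\<in>{..<d}. (1 / fact k :: real) < h0 i"
    using Q by (intro eventually_ball_finite ballI order_tendstoD(2)[OF tendsto_inverse_fact])
      (auto simp: Q_def)
  then have "\<forall>\<^sub>F k in sequentially.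
    (\<Sum>J\<in>{J\<in>Pi\<^sub>E {..<d} (grid_indices I n k). grid_point d k J \<in> box_of d K}. mass d n f k J) \<le> C"
  proof eventually_elim
    case (elim k)
    define h where "h = (1 / fact k :: real)"
    have h: "0 < h" by (simp add: h_def)
    define V where "V i = {\<lceil>a i / h\<rceil>..<\<lfloor>b i / h\<rfloor> + 1}" for i
    have V: "(\<forall>j\<in>V i. grid_nodes (n i) h j \<subseteq> I i)" "dd_cone (n i) (I i) (mass_weight (n i) h (V i))"
       "dd_cone (n i) (I i) (\<lambda>s. D i s - mass_weight (n i) h (V i) s)" if i: "i < d" for i
      using Q[OF i] h elim i unfolding Q_def D_def V_def h_def[symmetric] by simp_all
    have sub: "{J\<in>Pi\<^sub>E {..<d} (grid_indices I n k). grid_point d k J \<in> box_of d K} \<subseteq> Pi\<^sub>E {..<d} V"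
    proof
      fix J assume J: "J \<in> {J\<in>Pi\<^sub>E {..<d} (grid_indices I n k). grid_point d k J \<in> box_of d K}"
      have "J i \<in> V i" if i: "i < d" for i
      proof -
        have "h * of_int (J i) \<in> K i" using J i by (auto simp: grid_point_def h_def PiE_iff)
        then have "a i \<le> h * of_int (J i)" "h * of_int (J i) \<le> b i" using ab[OF i] by auto
        then have "a i / h \<le> of_int (J i)" "of_int (J i) \<le> b i / h"
          using h by (simp_all add: field_simps)
        then show ?thesis unfolding V_def by (simp add: ceiling_le_iff le_floor_iff)
      qed
      then show "J \<in> Pi\<^sub>E {..<d} V" using J by (auto simp: PiE_iff)
    qed
    define S where "S i = L i \<union> R i \<union> (\<Union>j\<in>V i. grid_nodes (n i) h j)" for i
    have finS: "finite (S i)" if "i < d" for i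
      using Q[OF that] by (auto simp: S_def Q_def V_def)
    \<comment> \<open>Passing to the full product of the integer intervals \<open>V i\<close> adds
      only nonnegative masses and makes telescoping possible.\<close>
    have "(\<Sum>J\<in>{J\<in>Pi\<^sub>E {..<d} (grid_indices I n k). grid_point d k J \<in> box_of d K}. mass d n f k J)
        \<le> (\<Sum>J\<in>Pi\<^sub>E {..<d} V. mass d n f k J)"
    proof (rule sum_mono2[OF _ sub])
      show "finite (Pi\<^sub>E {..<d} V)" by (intro finite_PiE) (auto simp: V_def)
      show "0 \<le> mass d n f k J" if "J \<in> Pi\<^sub>E {..<d} V - {J\<in>Pi\<^sub>E {..<d} (grid_indices I n k). grid_point d k J \<in> box_of d K}" for J
        by (rule mass_nonneg[OF conv]) (use that V(1) in \<open>auto simp: h_def PiE_iff\<close>)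
    qed
    also have "\<dots> = (\<Sum>J\<in>Pi\<^sub>E {..<d} V. mass d n f k J * (\<Prod>i<d. 1))" by simp
    also have "\<dots> = tensor {..<d} S (\<lambda>i. mass_weight (n i) h (V i)) f"
      by (rule sum_mass_mult[symmetric])
        (use finS in \<open>auto simp: V_def S_def mass_weight_def h_def\<close>)
    also have "\<dots> \<le> tensor {..<d} S D f"
    proof (rule tensor_mono_dd_cone[OF conv V(2,3) finS])
      show "mass_weight (n i) h (V i) s = 0 \<and> D i s = 0" if "s \<notin> S i" for i s
        using that by (auto simp: mass_weight_def D_def S_def dd_weight_def)
    qed auto
    also have "\<dots> = C"
      unfolding C_def
      by (rule tensor_superset) (use finS in \<open>auto simp: S_def D_def dd_weight_def\<close>)
    finally show ?case .
  qed
  then show ?thesis by (rule eventually_bounded_imp_bounded) (rule that)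
qed

lemma dd_tensor_eq_sum_mass:
  assumes I: "\<And>i. i < d \<Longrightarrow> is_interval (I i)" and n: "\<And>i. i < d \<Longrightarrow> n i \<ge> 2"
    and S: "\<And>i. i < d \<Longrightarrow> finite (S i) \<and> card (S i) = n i + 1 \<and> S i \<subseteq> I i \<inter> \<rat>"
  shows "\<forall>\<^sub>F k in sequentially. (\<forall>i<d. S i \<subseteq> range (\<lambda>m. 1 / fact k * of_int m)) \<and>
    dd_tensor d S f = (\<Sum>J\<in>Pi\<^sub>E {..<d} (grid_indices I n k). mass d n f k J *
      (\<Prod>i<d. dd (S i) (discrete_kernel (n i) (1 / fact k) (grid_point d k J i))))"
proof -
  have "\<forall>\<^sub>F k in sequentially. \<forall>i\<in>{..<d}. \<forall>s\<in>S i. s \<in> range (\<lambda>m. 1 / fact k * of_int m) \<and> \<bar>s\<bar> \<le> real k"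
  proof (intro eventually_ball_finite ballI eventually_conj)
    show "\<forall>\<^sub>F k in sequentially. s \<in> range (\<lambda>m. 1 / fact k * of_int m)" if "i \<in> {..<d}" "s \<in> S i" for i s
      using S[of i] that by (intro rational_in_factorial_grid) auto
    show "\<forall>\<^sub>F k in sequentially. \<bar>s\<bar> \<le> real k" for s :: real
      using eventually_ge_at_top[of "nat \<lceil>\<bar>s\<bar>\<rceil>"] by eventually_elim linarith
  qed (use S in auto)
  then show ?thesis
  proof eventually_elim
    case (elim k)
    define h where "h = (1 / fact k :: real)"
    have h: "0 < h" by (simp add: h_def)
    define V where "V = grid_indices I n k"
    define T where "T i = S i \<union> (\<Union>j\<in>V i. grid_nodes (n i) h j)" for i
    have finV: "finite (V i)" for i by (simp add: V_def finite_grid_indices)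
    have grid: "S i \<subseteq> range (\<lambda>m. h * of_int m)" if "i < d" for i
      using elim that by (auto simp: h_def)
    \<comment> \<open>A window between two nodes of \<open>S i\<close> stays in \<open>I i\<close>
      because \<open>I i\<close> is an interval, and within the index range because k bounds the
      nodes in absolute value.\<close>
    have inV: "j \<in> V i" if i: "i < d" and st: "s \<in> S i" "t \<in> S i" "s \<le> h * of_int j" "h * of_int (j + int (n i)) \<le> t" for i j s t
    proof -
      have mono: "h * of_int j \<le> h * of_int (j + int l)" "h * of_int (j + int l) \<le> h * of_int (j + int (n i))"
        if "l \<le> n i" for l using h that by (auto intro!: mult_left_mono)
      have nodes: "grid_nodes (n i) h j \<subseteq> I i"
      proof
        fix x assume "x \<in> grid_nodes (n i) h j"
        then obtain l where l: "l \<le> n i" "x = h * of_int (j + int l)" by (auto simp: grid_nodes_def)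
        then have "s \<le> x" "x \<le> t" using mono[OF l(1)] st by linarith+
        then show "x \<in> I i" using mem_is_interval_1_I[OF I[OF i]] S[OF i] st by blast
      qed
      have "h * of_int j \<le> t" using mono[of "n i"] st by linarith
      moreover have "\<bar>s\<bar> \<le> real k" "\<bar>t\<bar> \<le> real k" using elim i st by auto
      ultimately have "\<bar>h * of_int j\<bar> \<le> real k" using st by linarith
      then have "\<bar>of_int j :: real\<bar> \<le> real k * fact k" by (simp add: h_def abs_mult field_simps)
      then have "real_of_int \<bar>j\<bar> \<le> real_of_int (int k * fact k)" by simp
      then have "\<bar>j\<bar> \<le> int k * fact k" by (simp only: of_int_le_iff)
      then show ?thesis using nodes by (simp add: V_def grid_indices_def h_def)
    qed
    have "dd_tensor d S f = tensor {..<d} T (\<lambda>i. dd_weight (S i)) f"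
      by (rule tensor_superset[symmetric]) (use S finV in \<open>auto simp: T_def dd_weight_def\<close>)
    also have "\<dots> = (\<Sum>J\<in>Pi\<^sub>E {..<d} V. mass d n f k J *
        (\<Prod>i<d. dd (S i) (discrete_kernel (n i) h (h * of_int (J i)))))"
    proof (rule sum_mass_mult)
      fix i s assume i: "i < d"
      \<comment> \<open>Tested on the indicator of s, the discrete formula becomes the expansion of
        the weight that \<open>sum_mass_mult\<close> requires.\<close>
      have "dd (S i) (\<lambda>x. if x = s then 1 else 0) =
        (\<Sum>j\<in>V i. fact (n i) * h * dd (S i) (discrete_kernel (n i) h (h * of_int j)) *
          dd (grid_nodes (n i) h j) (\<lambda>x. if x = s then 1 else 0))"
        by (rule dd_eq_discrete_sum[OF h n[OF i] _ _ grid[OF i] finV inV[OF i]]) (use S[OF i] in auto)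
      then show "dd_weight (S i) s = (\<Sum>j\<in>V i. fact (n i) * (1 / fact k) *
          dd (S i) (discrete_kernel (n i) h (h * of_int j)) * dd_weight (grid_nodes (n i) (1 / fact k) j) s)"
        using S[OF i] by (simp add: dd_indicator h_def)
    qed (use S finV in \<open>auto simp: T_def h_def\<close>)
    also have "\<dots> = (\<Sum>J\<in>Pi\<^sub>E {..<d} V. mass d n f k J *
      (\<Prod>i<d. dd (S i) (discrete_kernel (n i) h (grid_point d k J i))))"
      by (intro sum.cong arg_cong2[of _ _ _ _ "(*)"] prod.cong) (auto simp: grid_point_def h_def)
    finally show ?case using grid by (simp add: V_def h_def)
  qed
qed

section \<open>Refinement of the mesh\<close>

lemma discrete_kernel_0:
  assumes "n \<ge> 2"
  shows "discrete_kernel n 0 u x = tpow (n - 1) u x / fact (n - 1)"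
  using assms by (auto simp: discrete_kernel_def tpow_def max_def)

text \<open>Joint continuity makes the convergence to the B-splines at h = 0 uniform for u in a
  compact box.\<close>

lemma continuous_on_discrete_kernel_prod:
  fixes S :: "nat \<Rightarrow> real set"
  shows "continuous_on UNIV (\<lambda>(h, u). \<Prod>i<d. dd (S i) (discrete_kernel (n i) h (u i)))"
proof -
  have "continuous_on UNIV (\<lambda>p :: real \<times> (nat \<Rightarrow> real). snd p i)" for i
    by (rule continuous_on_compose2[OF continuous_on_product_coordinates[of i]])
      (auto intro: continuous_on_snd continuous_on_id)
  then show ?thesis
    unfolding case_prod_unfold dd_def discrete_kernel_def
    by (intro continuous_on_prod continuous_on_sum continuous_on_mult continuous_on_const
        continuous_on_divide continuous_on_max continuous_on_diff continuous_on_fst continuous_on_id) auto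
qed

text \<open>Masses and kernels both vary with k. The kernels are first replaced by their limit at h
  = 0, with an error at most the uniform distance times the mass bound on a compact box; vague
  convergence then applies to a fixed test function.\<close>

theorem exists_representing_measure:
  assumes d: "d \<ge> 1" and I: "\<And>i. i < d \<Longrightarrow> open (I i) \<and> is_interval (I i) \<and> I i \<noteq> {}"
    and n: "\<And>i. i < d \<Longrightarrow> n i \<ge> 2" and conv: "box_convex d I n f"
  obtains \<mu> where "locally_finite_borel_measure_on (box_of d I) \<mu>"
    "\<And>S. \<forall>i<d. finite (S i) \<and> card (S i) = n i + 1 \<and> S i \<subseteq> I i \<inter> \<rat> \<Longrightarrow>
      dd_tensor d S f = (\<integral>u. (\<Prod>i<d. dd (S i) (tpow (n i - 1) (u i)) / fact (n i - 1)) \<partial>\<mu>)"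
proof -
  obtain \<Psi> :: "real \<Rightarrow> nat \<Rightarrow> real" and C :: "nat \<Rightarrow> nat \<Rightarrow> real set" and \<theta>
  where \<Psi>: "continuous_on UNIV \<Psi>" "range \<Psi> \<subseteq> box_of d I"
    and C: "\<And>r i. i < d \<Longrightarrow> compact (C r i) \<and> C r i \<subseteq> I i"
    and exh: "\<And>S. \<forall>i<d. compact (S i) \<and> S i \<subseteq> I i \<Longrightarrow> \<exists>r. \<forall>i<d. S i \<subseteq> C r i"
    and \<Psi>C: "\<And>r. box_of d (C r) \<subseteq> \<Psi> ` {0..2 * real r + 3}"
    and \<theta>: "\<And>r. continuous_on (box_of d I) (\<theta> r)" "\<And>r u. 0 \<le> \<theta> r u \<and> \<theta> r u \<le> (1::real)"
    "\<And>r u. u \<in> box_of d I \<Longrightarrow> u \<notin> box_of d (C r) \<Longrightarrow> \<theta> r u = 0"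
    "\<And>u. u \<in> box_of d I \<Longrightarrow> \<exists>r. \<theta> r u > 0"
    by (rule box_curve[where I = I, OF d I], assumption, rule that)
  define U where "U k = Pi\<^sub>E {..<d} (grid_indices I n k)" for k
  have finU: "finite (U k)" for k
    unfolding U_def by (intro finite_PiE) (auto simp: finite_grid_indices)
  have U: "grid_point d k J \<in> box_of d I" "0 \<le> mass d n f k J" if J: "J \<in> U k" for k J
  proof -
    show "grid_point d k J \<in> box_of d I" using J unfolding U_def by (rule grid_point_in_box)
    show "0 \<le> mass d n f k J"
      by (rule mass_nonneg[OF conv]) (use J in \<open>auto simp: U_def grid_indices_def PiE_iff\<close>)
  qed
  have U': "grid_point d k J \<in> box_of d I \<and> 0 \<le> mass d n f k J" if "J \<in> U k" for k J
    using U[OF that] by blast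
  have "\<exists>M. \<forall>k. (\<Sum>J\<in>{J\<in>U k. grid_point d k J \<in> box_of d (C r)}. mass d n f k J) \<le> M" for r
  proof -
    have "n i \<ge> 1" if "i < d" for i using n[OF that] by simp
    then obtain M where "\<And>k. (\<Sum>J\<in>{J\<in>U k. grid_point d k J \<in> box_of d (C r)}. mass d n f k J) \<le> M"
      unfolding U_def using mass_bounded[OF conv _ _ C[of _ r]] I by blast
    then show ?thesis by blast
  qed
  then obtain M where M: "\<And>k r. (\<Sum>J\<in>{J\<in>U k. grid_point d k J \<in> box_of d (C r)}. mass d n f k J) \<le> M r"
    by metis
  have compC: "compact (box_of d (C r))" "box_of d (C r) \<subseteq> box_of d I" for r
  proof -
    show "compact (box_of d (C r))" by (rule compact_PiE_lessThan) (use C in blast)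
    show "box_of d (C r) \<subseteq> box_of d I" by (rule PiE_mono) (use C in blast)
  qed
  have monoR: "mono (\<lambda>r. 2 * real r + 3)" by (intro monoI) simp
  obtain s \<mu> where s: "strict_mono s" and \<mu>: "sets \<mu> = sets (restrict_space borel (box_of d I))"
    "\<And>L. compact L \<Longrightarrow> L \<subseteq> box_of d I \<Longrightarrow> emeasure \<mu> L < \<infinity>"
    and lim: "\<And>r \<psi>. continuous_on (box_of d I) \<psi> \<Longrightarrow> \<forall>u\<in>box_of d I - box_of d (C r). \<psi> u = 0 \<Longrightarrow>
      (\<lambda>k. \<Sum>J\<in>U (s k). mass d n f (s k) J * \<psi> (grid_point d (s k) J)) \<longlonglongrightarrow> (\<integral>u. \<psi> u \<partial>\<mu>)"
    by (rule vague_compactness[where U = U and pt = "grid_point d" and m = "mass d n f" and C = M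
          and \<theta> = \<theta>, OF \<Psi> compC \<Psi>C monoR \<theta> finU U' M], assumption, assumption, assumption,
        assumption, rule that)
  show ?thesis
  proof (rule that[of \<mu>])
    show "locally_finite_borel_measure_on (box_of d I) \<mu>"
      using \<mu> unfolding locally_finite_borel_measure_on_def by blast
  next
    fix S assume S_all: "\<forall>i<d. finite (S i) \<and> card (S i) = n i + 1 \<and> S i \<subseteq> I i \<inter> \<rat>"
    then have S: "finite (S i) \<and> card (S i) = n i + 1 \<and> S i \<subseteq> I i \<inter> \<rat>" if "i < d" for i
      using that by blast
    define \<phi> where "\<phi> h u = (\<Prod>i<d. dd (S i) (discrete_kernel (n i) h (u i)))" for h u
    define H where "H i = {Min (S i)..Max (S i)}" for i
    have neS: "S i \<noteq> {}" "finite (S i)" if "i < d" for i using S[OF that] by auto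
    have HI: "compact (H i) \<and> H i \<subseteq> I i" if i: "i < d" for i
    proof -
      have "Min (S i) \<in> I i" "Max (S i) \<in> I i"
        using Min_in[OF neS(2,1)[OF i]] Max_in[OF neS(2,1)[OF i]] S[OF i] by blast+
      then have "{Min (S i)..Max (S i)} \<subseteq> I i"
        using mem_is_interval_1_I[of "I i" "Min (S i)" "Max (S i)"] I[OF i] by auto
      then show ?thesis by (simp add: H_def)
    qed
    obtain r where r: "\<forall>i<d. H i \<subseteq> C r i" using exh[of H] HI by blast
    have HC: "box_of d H \<subseteq> box_of d (C r)" using r by (intro PiE_mono) auto
    have \<phi>0: "\<phi> 0 u = (\<Prod>i<d. dd (S i) (tpow (n i - 1) (u i)) / fact (n i - 1))" for u
      unfolding \<phi>_def
    proof (rule prod.cong[OF refl])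
      fix i assume "i \<in> {..<d}"
      then have "n i \<ge> 2" using n by simp
      then have "discrete_kernel (n i) 0 (u i) = (\<lambda>x. 1 / fact (n i - 1) * tpow (n i - 1) (u i) x)"
        by (simp add: fun_eq_iff discrete_kernel_0)
      then show "dd (S i) (discrete_kernel (n i) 0 (u i)) = dd (S i) (tpow (n i - 1) (u i)) / fact (n i - 1)"
        by (simp only: dd_cmult) simp
    qed
    have supp0: "\<phi> 0 u = 0" if u: "u \<in> box_of d I" "u \<notin> box_of d H" for u
    proof -
      obtain i where i: "i < d" "u i \<notin> H i" using u by (auto simp: PiE_iff)
      have "dd (S i) (tpow (n i - 1) (u i)) = 0"
      proof (cases "u i < Min (S i)")
        case True
        have "u i \<le> s" if "s \<in> S i" for s using Min_le[OF neS(2)[OF i(1)] that] True by linarith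
        then show ?thesis using S[OF i(1)] n[OF i(1)] by (intro dd_tpow_left) auto
      next
        case False
        then have "Max (S i) < u i" using i(2) by (auto simp: H_def)
        then have "s < u i" if "s \<in> S i" for s using Max_ge[OF neS(2)[OF i(1)] that] by linarith
        then show ?thesis by (rule dd_tpow_right)
      qed
      then show ?thesis unfolding \<phi>0 using i(1) by (intro prod_zero bexI[of _ i]) auto
    qed
    \<comment> \<open>The discrete B-spline is known to vanish outside \<open>H\<close> only at
      points of a grid that also carries the nodes; hence the assumption
      \<open>grid\<close>.\<close>
    have suppk: "\<phi> (1 / fact k) (grid_point d k J) = 0"
      if grid: "\<forall>i<d. S i \<subseteq> range (\<lambda>m. 1 / fact k * of_int m)" and J: "J \<in> U k" "grid_point d k J \<notin> box_of d H" for k J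
    proof -
      define h where "h = (1 / fact k :: real)"
      have h: "0 < h" by (simp add: h_def)
      obtain i where i: "i < d" "h * of_int (J i) \<notin> H i"
        using J by (auto simp: PiE_iff grid_point_def h_def)
      have gr: "S i \<subseteq> range (\<lambda>m. h * of_int m)" using grid i by (simp add: h_def)
      have "dd (S i) (discrete_kernel (n i) h (h * of_int (J i))) = 0"
      proof (cases "h * of_int (J i) < Min (S i)")
        case True
        have "h * of_int (J i) < s" if "s \<in> S i" for s using Min_le[OF neS(2)[OF i(1)] that] True by linarith
        then show ?thesis using S[OF i(1)] n[OF i(1)] gr h by (intro dd_discrete_kernel_left) auto
      next
        case False
        then have *: "Max (S i) < h * of_int (J i)" using i(2) by (auto simp: H_def)
        have "h * of_int (J i) \<le> h * of_int (J i + int (n i))" using h by simp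
        then have "s < h * of_int (J i + int (n i))" if "s \<in> S i" for s
          using Max_ge[OF neS(2)[OF i(1)] that] * by linarith
        then show ?thesis using n[OF i(1)] gr h by (intro dd_discrete_kernel_right) auto
      qed
      moreover have "grid_point d k J i = h * of_int (J i)" using i by (simp add: grid_point_def h_def)
      ultimately have "dd (S i) (discrete_kernel (n i) h (grid_point d k J i)) = 0" by simp
      then show ?thesis unfolding \<phi>_def h_def[symmetric] using i(1) by (intro prod_zero bexI[of _ i]) auto
    qed
    have cont\<phi>: "continuous_on UNIV (\<lambda>(h, u). \<phi> h u)"
      unfolding \<phi>_def by (rule continuous_on_discrete_kernel_prod)
    have cont0: "continuous_on (box_of d I) (\<phi> 0)"
      using continuous_on_compose2[OF cont\<phi>, of "box_of d I" "\<lambda>u. (0, u)"]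
      by (simp add: continuous_on_Pair)
    have zero0: "\<forall>u\<in>box_of d I - box_of d (C r). \<phi> 0 u = 0"
    proof
      fix u assume "u \<in> box_of d I - box_of d (C r)"
      then have "u \<in> box_of d I" "u \<notin> box_of d H" using HC by auto
      then show "\<phi> 0 u = 0" by (rule supp0)
    qed
    have lim0: "(\<lambda>k. \<Sum>J\<in>U (s k). mass d n f (s k) J * \<phi> 0 (grid_point d (s k) J)) \<longlonglongrightarrow> (\<integral>u. \<phi> 0 u \<partial>\<mu>)"
      by (rule lim[OF cont0 zero0])
    have "(\<lambda>k. \<Sum>J\<in>U k. mass d n f k J * \<phi> 0 (grid_point d k J)) \<longlonglongrightarrow> dd_tensor d S f"
    proof (rule tendstoI)
      fix e :: real assume e: "e > 0"
      define \<epsilon> where "\<epsilon> = e / (2 * (\<bar>M r\<bar> + 1))"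
      have \<epsilon>: "\<epsilon> > 0" using e by (simp add: \<epsilon>_def)
      have \<epsilon>M: "\<epsilon> * \<bar>M r\<bar> < e"
      proof -
        have "\<epsilon> * \<bar>M r\<bar> \<le> \<epsilon> * (\<bar>M r\<bar> + 1)" using \<epsilon> by simp
        also have "\<dots> = e / 2" by (simp add: \<epsilon>_def field_simps add_nonneg_eq_0_iff)
        finally show ?thesis using e by linarith
      qed
      have compH: "compact (box_of d H)" by (rule compact_PiE_lessThan) (use HI in blast)
      obtain X where X: "0 \<in> X" "open X"
        "\<forall>h\<in>X \<inter> UNIV. \<forall>u\<in>box_of d H. dist ((\<lambda>(h, u). \<phi> h u) (h, u)) ((\<lambda>(h, u). \<phi> h u) (0, u)) \<le> \<epsilon>"
        by (rule continuous_on_prod_compactE[OF continuous_on_subset[OF cont\<phi>] compH _ \<epsilon>, of UNIV 0]) auto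
      have "\<forall>\<^sub>F k in sequentially. (1 / fact k :: real) \<in> X"
        by (rule topological_tendstoD[OF tendsto_inverse_fact X(2,1)])
      moreover have "\<forall>\<^sub>F k in sequentially. (\<forall>i<d. S i \<subseteq> range (\<lambda>m. 1 / fact k * of_int m)) \<and>
          dd_tensor d S f = (\<Sum>J\<in>U k. mass d n f k J * \<phi> (1 / fact k) (grid_point d k J))"
        unfolding U_def \<phi>_def by (rule dd_tensor_eq_sum_mass) (use I n S in auto)
      ultimately show "\<forall>\<^sub>F k in sequentially.
          dist (\<Sum>J\<in>U k. mass d n f k J * \<phi> 0 (grid_point d k J)) (dd_tensor d S f) < e"
      proof eventually_elim
        case (elim k)
        define A where "A = {J\<in>U k. grid_point d k J \<in> box_of d (C r)}"
        have bound: "\<bar>mass d n f k J * (\<phi> 0 (grid_point d k J) - \<phi> (1 / fact k) (grid_point d k J))\<bar>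
            \<le> (if J \<in> A then mass d n f k J * \<epsilon> else 0)" if J: "J \<in> U k" for J
        proof (cases "grid_point d k J \<in> box_of d H")
          case True
          then have "J \<in> A" using HC J by (auto simp: A_def)
          moreover have "\<bar>\<phi> 0 (grid_point d k J) - \<phi> (1 / fact k) (grid_point d k J)\<bar> \<le> \<epsilon>"
            using X(3) elim(1) True by (auto simp: dist_real_def abs_minus_commute)
          ultimately show ?thesis
            using U(2)[OF J] by (simp add: abs_mult mult_left_mono)
        next
          case False
          then show ?thesis
            using supp0[OF U(1)[OF J] False] suppk[OF _ J False] elim(2) U(2)[OF J] \<epsilon> by auto
        qed
        have "\<bar>(\<Sum>J\<in>U k. mass d n f k J * \<phi> 0 (grid_point d k J)) - dd_tensor d S f\<bar> =
            \<bar>\<Sum>J\<in>U k. mass d n f k J * (\<phi> 0 (grid_point d k J) - \<phi> (1 / fact k) (grid_point d k J))\<bar>"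
          using elim(2) by (simp add: right_diff_distrib sum_subtractf)
        also have "\<dots> \<le> (\<Sum>J\<in>U k. if J \<in> A then mass d n f k J * \<epsilon> else 0)"
          by (intro order_trans[OF sum_abs] sum_mono bound)
        also have "\<dots> = (\<Sum>J\<in>A. mass d n f k J) * \<epsilon>"
        proof -
          have "U k \<inter> {J. J \<in> A} = A" by (auto simp: A_def)
          then show ?thesis using finU[of k] by (simp add: sum.If_cases sum_distrib_right)
        qed
        also have "\<dots> \<le> \<bar>M r\<bar> * \<epsilon>"
          using M[of k r] \<epsilon> unfolding A_def by (intro mult_right_mono) auto
        also have "\<dots> < e" using \<epsilon>M by (simp add: mult.commute)
        finally show ?case by (simp add: dist_real_def)
      qed
    qed
    then have "(\<lambda>k. \<Sum>J\<in>U (s k). mass d n f (s k) J * \<phi> 0 (grid_point d (s k) J)) \<longlonglongrightarrow> dd_tensor d S f"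
      by (rule LIMSEQ_subseq_LIMSEQ[OF _ s, unfolded comp_def])
    then have "dd_tensor d S f = (\<integral>u. \<phi> 0 u \<partial>\<mu>)" using lim0 LIMSEQ_unique by blast
    then show "dd_tensor d S f = (\<integral>u. (\<Prod>i<d. dd (S i) (tpow (n i - 1) (u i)) / fact (n i - 1)) \<partial>\<mu>)"
      unfolding \<phi>0 .
  qed
qed

theorem theorem33:
  fixes d :: nat and I :: "nat \<Rightarrow> real set" and f :: "(nat \<Rightarrow> real) \<Rightarrow> real"
    and \<alpha> :: "nat \<Rightarrow> real" and n :: "nat \<Rightarrow> nat"
  assumes "d \<ge> 1"
    and "\<And>i. i < d \<Longrightarrow> open (I i) \<and> is_interval (I i)"
    and "\<alpha> \<in> box_of d I"
    and "\<And>i. i < d \<Longrightarrow> n i \<ge> 2"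
  shows "box_convex d I n f \<longleftrightarrow>
    (\<exists>W \<mu>. pseudo_polynomial d I (\<lambda>i. n i - 1) W \<and>
       locally_finite_borel_measure_on (box_of d I) \<mu> \<and>
       (\<forall>x\<in>box_of d I.
          f x = W x +
            (\<integral>u. (\<Prod>j<d. (x j - u j) ^ (n j - 1) / fact (n j - 1) * chi_r (\<alpha> j) (x j) (u j)) \<partial>\<mu>)))"
proof
  assume "\<exists>W \<mu>. pseudo_polynomial d I (\<lambda>i. n i - 1) W \<and>
       locally_finite_borel_measure_on (box_of d I) \<mu> \<and>
       (\<forall>x\<in>box_of d I.
          f x = W x +
            (\<integral>u. (\<Prod>j<d. (x j - u j) ^ (n j - 1) / fact (n j - 1) * chi_r (\<alpha> j) (x j) (u j)) \<partial>\<mu>))"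
  then obtain W \<mu> where W: "pseudo_polynomial d I (\<lambda>i. n i - 1) W"
    and \<mu>: "locally_finite_borel_measure_on (box_of d I) \<mu>"
    and f: "\<And>x. x \<in> box_of d I \<Longrightarrow> f x = W x + (\<integral>u. (\<Prod>j<d. spline_kernel (\<alpha> j) (n j) (x j) (u j)) \<partial>\<mu>)"
    unfolding spline_kernel_def by blast
  define G where "G x = (\<integral>u. (\<Prod>j<d. spline_kernel (\<alpha> j) (n j) (x j) (u j)) \<partial>\<mu>)" for x
  have G: "box_convex d I n G"
    unfolding G_def by (rule box_convex_spline_potential[OF assms(2,3,4) \<mu>])
  show "box_convex d I n f"
    unfolding box_convex_iff_dd_tensor
  proof (intro allI impI)
    fix S assume S: "\<forall>i<d. finite (S i) \<and> card (S i) = n i + 1 \<and> S i \<subseteq> I i"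
    have sub: "Pi\<^sub>E {..<d} S \<subseteq> box_of d I" using S by (intro PiE_mono) auto
    have n1: "n i \<ge> 1" if "i < d" for i using assms(4)[OF that] by simp
    have "dd_tensor d S f = dd_tensor d S (\<lambda>x. W x + G x)"
      by (rule tensor_cong) (use sub f in \<open>auto simp: G_def\<close>)
    also have "\<dots> = dd_tensor d S W + dd_tensor d S G" by (rule tensor_add)
    finally have "dd_tensor d S f = dd_tensor d S W + dd_tensor d S G" .
    moreover have "dd_tensor d S W = 0"
      by (rule dd_tensor_pseudo_polynomial[OF W n1]) (use S in auto)
    moreover have "dd_tensor d S G \<ge> 0"
      using G S unfolding box_convex_iff_dd_tensor by blast
    ultimately show "dd_tensor d S f \<ge> 0" by simp
  qed
next
  assume conv: "box_convex d I n f"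
  have I: "open (I i) \<and> is_interval (I i) \<and> I i \<noteq> {}" if "i < d" for i
    using assms(2)[OF that] assms(3) that by auto
  obtain \<mu> where \<mu>: "locally_finite_borel_measure_on (box_of d I) \<mu>"
    and rep: "\<And>S. \<forall>i<d. finite (S i) \<and> card (S i) = n i + 1 \<and> S i \<subseteq> I i \<inter> \<rat> \<Longrightarrow>
      dd_tensor d S f = (\<integral>u. (\<Prod>i<d. dd (S i) (tpow (n i - 1) (u i)) / fact (n i - 1)) \<partial>\<mu>)"
    by (rule exists_representing_measure[where I = I and n = n, OF assms(1) I assms(4) conv], assumption, assumption, rule that)
  define G where "G x = (\<integral>u. (\<Prod>j<d. spline_kernel (\<alpha> j) (n j) (x j) (u j)) \<partial>\<mu>)" for x
  have G: "box_convex d I n G"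
    unfolding G_def by (rule box_convex_spline_potential[OF assms(2,3,4) \<mu>])
  \<comment> \<open>With n i fixed nodes, the moving point x i supplies the last one of a divided
    difference of order n i, and interpolation at them has degree n i - 1. Rational nodes bring
    \<open>rep\<close> into play.\<close>
  have "\<exists>T. finite T \<and> card T = n i \<and> T \<subseteq> I i \<inter> \<rat>" if i: "i < d" for i
  proof -
    obtain x e where x: "e > 0" "ball x e \<subseteq> I i" using I[OF i] open_contains_ball by blast
    have "infinite ({x<..<x + e} \<inter> \<rat>)"
    proof
      assume fin: "finite ({x<..<x + e} \<inter> \<rat>)"
      obtain q where q: "q \<in> \<rat>" "x < q" "q < x + e" using Rats_dense_in_real[of x "x + e"] x by auto
      define m where "m = Min ({x<..<x + e} \<inter> \<rat>)"
      have "m \<in> {x<..<x + e} \<inter> \<rat>" unfolding m_def using fin q by (intro Min_in) auto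
      moreover obtain p where "p \<in> \<rat>" "x < p" "p < m" using Rats_dense_in_real[of x m] calculation by auto
      ultimately show False using Min_le[OF fin, of p] unfolding m_def[symmetric] by auto
    qed
    then obtain T where T: "finite T" "card T = n i" "T \<subseteq> {x<..<x + e} \<inter> \<rat>"
      using infinite_arbitrarily_large by blast
    moreover have "{x<..<x + e} \<subseteq> I i" using x by (auto simp: dist_real_def subset_iff)
    ultimately show ?thesis by blast
  qed
  then obtain T where T: "\<And>i. i < d \<Longrightarrow> finite (T i) \<and> card (T i) = n i \<and> T i \<subseteq> I i \<inter> \<rat>" by metis
  define W where "W x = f x - G x" for x
  have eq: "dd_tensor d (\<lambda>i. insert (x i) (T i)) f = dd_tensor d (\<lambda>i. insert (x i) (T i)) G"
    if x: "\<And>i. i < d \<Longrightarrow> x i \<in> I i - T i" for x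
  proof (rule dd_tensor_eq_of_rational[OF conv G _ assms(4) _ _ x])
    fix x assume x: "\<And>i. i < d \<Longrightarrow> x i \<in> I i - T i \<and> x i \<in> \<rat>"
    have S: "finite (insert (x i) (T i)) \<and> card (insert (x i) (T i)) = n i + 1 \<and> insert (x i) (T i) \<subseteq> I i \<inter> \<rat>"
      if "i < d" for i using x[OF that] T[OF that] by auto
    have "dd_tensor d (\<lambda>i. insert (x i) (T i)) G =
        (\<integral>u. (\<Prod>i<d. dd (insert (x i) (T i)) (tpow (n i - 1) (u i)) / fact (n i - 1)) \<partial>\<mu>)"
      unfolding G_def by (rule dd_tensor_spline_potential[OF assms(2,3,4) \<mu>]) (use S in auto)
    then show "dd_tensor d (\<lambda>i. insert (x i) (T i)) f = dd_tensor d (\<lambda>i. insert (x i) (T i)) G"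
      using rep[of "\<lambda>i. insert (x i) (T i)"] S by simp
  qed (use I T in auto)
  have "pseudo_polynomial d I (\<lambda>i. n i - 1) W"
  proof (rule pseudo_polynomialI[where T = T])
    show "finite (T i) \<and> card (T i) = n i - 1 + 1" if "i < d" for i
      using T[OF that] assms(4)[OF that] by auto
    show "iter_remainder d T W x = 0" if x: "x \<in> box_of d I" for x
    \<comment> \<open>On a node the remainder vanishes by interpolation. Otherwise each x i is a
      genuine additional node and the remainder is a multiple of a divided difference of f -
      G.\<close>
    proof (cases "\<exists>i<d. x i \<in> T i")
      case True
      then show ?thesis using T by (auto intro: iter_remainder_node)
    next
      case False
      have "iter_remainder d T W x = (\<Prod>i<d. \<Prod>s\<in>T i. x i - s) *
          dd_tensor d (\<lambda>i. insert (x i) (T i)) (\<lambda>y. W (\<lambda>i. if i < d then y i else x i))"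
        by (rule iter_remainder_eq_dd_tensor) (use T False in auto)
      also have "dd_tensor d (\<lambda>i. insert (x i) (T i)) (\<lambda>y. W (\<lambda>i. if i < d then y i else x i)) =
          dd_tensor d (\<lambda>i. insert (x i) (T i)) W"
      proof (intro tensor_cong arg_cong[of _ _ W] ext refl)
        fix y i assume "y \<in> Pi\<^sub>E {..<d} (\<lambda>i. insert (x i) (T i))"
        then show "(if i < d then y i else x i) = y i"
          using x by (auto simp: PiE_def extensional_def)
      qed
      also have "\<dots> = 0"
        unfolding W_def[abs_def] tensor_diff using eq[of x] x False by (auto simp: PiE_iff)
      finally show ?thesis by simp
    qed
  qed
  moreover have "\<forall>x\<in>box_of d I. f x = W x +
      (\<integral>u. (\<Prod>j<d. (x j - u j) ^ (n j - 1) / fact (n j - 1) * chi_r (\<alpha> j) (x j) (u j)) \<partial>\<mu>)"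
    by (simp add: W_def G_def spline_kernel_def)
  ultimately show "\<exists>W \<mu>. pseudo_polynomial d I (\<lambda>i. n i - 1) W \<and>
       locally_finite_borel_measure_on (box_of d I) \<mu> \<and>
       (\<forall>x\<in>box_of d I.
          f x = W x +
            (\<integral>u. (\<Prod>j<d. (x j - u j) ^ (n j - 1) / fact (n j - 1) * chi_r (\<alpha> j) (x j) (u j)) \<partial>\<mu>))"
    using \<mu> by blast
qed

end
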